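(* Let $I\subset S_L=L[x_1,\ldots,x_n]$ be a graded ideal and let $V\subset \mathrm{GL}_n(K)$ be a subvariety. Then the generic tropical variety $\mathrm{gT}_V(I)$ of $I$ on $V$ exists, i.e. there is a Zariski-open set $\emptyset\neq U\subset V$ such that $T(g(I))$ is the same polyhedral complex, denoted $\mathrm{gT}_V(I)$, for all $g\in U$. If $\mathrm{gT}_V(I)\neq\emptyset$, then there exists a generic tropical basis of $I$ on $V$.
   Context: $K$ is an algebraically closed field. $L=K\{\!\{t\}\!\}$ is the field of generalized power series over $K$: formal sums $f=\sum_{\nu\in\mathbb{R}}c_\nu t^\nu$ with $c_\nu\in K$ and $\{\nu: c_\nu\neq 0\}$ well-ordered, with addition and multiplication as for polynomials. It is algebraically closed and has the valuation $v(f)=\min\{\nu: c_\nu\ne 0\}$ for $f\neq 0$, $v(0)=\infty$. Let $R_L=\{a\in L: v(a)\ge 0\}$; for $a\in R_L$ let $\overline a$ be its image in the residue field of $R_L$, which is identified with $K$ (so $\overline a$ is the coefficient of $t^0$). $S_L=L[x_1,\ldots,x_n]$ and $S_K=K[x_1,\ldots,x_n]$ carry the standard $\mathbb{Z}$-grading; "graded ideal" refers to this grading. For $0\neq f=\sum_\nu a_\nu x^\nu\in S_L$ and $\omega\in\mathbb{R}^n$ put $W=\min_\nu\{v(a_\nu)+\omega\cdot\nu\}$ and $\mathrm{in}_\omega(f)=\overline{t^{-W}f(x_1t^{\omega_1},\ldots,x_nt^{\omega_n})}\in S_K$ (residue taken coefficientwise); $\mathrm{in}_\omega(0)=0$. For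 a graded ideal $I\subset S_L$, $\mathrm{in}_\omega(I)\subset S_K$ is the ideal generated by all $\mathrm{in}_\omega(f)$, $f\in I$. For a graded ideal $I\subset S_L$ each set $\{\omega'\in\mathbb{R}^n: \mathrm{in}_{\omega'}(I)=\mathrm{in}_\omega(I)\}$ is the relative interior of a polyhedron, and the closures of these sets form a polyhedral complex in $\mathbb{R}^n$, the Gröbner complex $\mathrm{GC}(I)$. The tropical variety $T(I)$ is the (possibly empty) subcomplex of $\mathrm{GC}(I)$ with underlying set $\{\omega\in\mathbb{R}^n: \mathrm{in}_\omega(I)\text{ contains no monomial}\}$. For a homogeneous $f\in S_L$, $T(f)=T((f))$. A tropical basis of a graded ideal $I$ is a finite system of homogeneous generators $f_1,\ldots,f_t$ of $I$ with $T(I)=\bigcap_{i=1}^t T(f_i)$ (as sets). $\mathrm{GL}_n(K)$ is equipped with the Zariski topology (as a subset of $K^{n\times n}$). A subvariety of $\mathrm{GL}_n(K)$ is a non-empty irreducible closed subset, with the induced topology. An element $g=(g_{ij})\in \mathrm{GL}_n(K)$ is identified with the $L$-algebra automorphism of $S_L$ given by $x_i\mapsto\sum_{j=1}^n g_{ji}x_j$, and $g(I)$ is the image of $I$. Let $Y=\{y_{ij}: i,j=1,\ldots,n\}$ be $n^2$ independent variables and let $\mathfrak{p}\subset K[Y]$ be the prime ideal defining $V$. Then $\mathfrak{p}L[Y]$ is prime; put $L[V]=L[Y]/\mathfrak{p}L[Y]$, let $L(V)$ be its quotient field and $S_{L(V)}=L(V)[x_1,\ldots,x_n]$. Let $y:S_L\to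 S_{L(V)}$ be the $L$-algebra homomorphism with $x_i\mapsto\sum_{j=1}^n (y_{ji}+\mathfrak{p}L[Y])x_j$; $y(I)$ also denotes the ideal of $S_{L(V)}$ generated by the image of $I$. For $F(y)\in S_{L(V)}$ and $g\in V$, $F(g)\in S_L$ denotes the polynomial obtained by substituting $g_{ij}$ for $y_{ij}$ in the coefficients, whenever no denominator vanishes at $g$. A generic tropical basis of $I$ on $V$ is a finite set $F_1(y),\ldots,F_s(y)\in y(I)$ for which there is an open set $\emptyset\ne U\subset V$ such that (i) $F_1(g),\ldots,F_s(g)$ (are defined and) form a tropical basis of $g(I)$ for every $g\in U$, and (ii) for every $j$, $T(F_j(g))$ is the same polyhedral complex for all $g\in U$. *)

theory Defs
  imports
    "HOL-Analysis.Analysis"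
    "HOL-Library.Poly_Mapping"
    "HOL-Computational_Algebra.Polynomial"
    "HOL-Algebra.QuotRing"
begin

section \<open>Generalized power series\<close>

definition well_ordered :: "real set \<Rightarrow> bool" where
  "well_ordered A \<longleftrightarrow> (\<forall>B\<subseteq>A. B \<noteq> {} \<longrightarrow> (\<exists>m\<in>B. \<forall>b\<in>B. m \<le> b))"

lemma well_ordered_subset: "well_ordered A \<Longrightarrow> B \<subseteq> A \<Longrightarrow> well_ordered B"
  by (force simp: well_ordered_def)

lemma well_ordered_no_decreasing:
  assumes "well_ordered A" "\<And>n::nat. s n \<in> A" "\<And>n. s (Suc n) < s n"
  shows False
proof -
  obtain m where "m \<in> range s" "\<forall>b\<in>range s. m \<le> b"
    using assms(1,2) unfolding well_ordered_def by (metis empty_not_UNIV image_is_empty image_subsetI)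
  then show False using assms(3) by (metis not_le rangeE rangeI)
qed

lemma well_orderedI:
  assumes "\<And>s. (\<And>n::nat. s n \<in> A) \<Longrightarrow> (\<And>n. s (Suc n) < s n) \<Longrightarrow> False"
  shows "well_ordered A"
  unfolding well_ordered_def
proof (intro allI impI, rule ccontr)
  fix B assume B: "B \<subseteq> A" "B \<noteq> {}" and no: "\<not> (\<exists>m\<in>B. \<forall>b\<in>B. m \<le> b)"
  then have "\<forall>m\<in>B. \<exists>b\<in>B. b < m" by (metis not_le)
  then obtain f where f: "\<And>m. m \<in> B \<Longrightarrow> f m \<in> B \<and> f m < m" by metis
  obtain b where b: "b \<in> B" using B by blast
  have in_B: "(f ^^ n) b \<in> B" for n by (induction n) (auto simp: b f)
  show False
    by (rule assms[of "\<lambda>n. (f ^^ n) b"]) (use in_B B f in auto)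
qed

lemma well_ordered_incseq:
  assumes "well_ordered A" "\<And>n::nat. s n \<in> A"
  obtains r :: "nat \<Rightarrow> nat" where "strict_mono r" "incseq (s \<circ> r)"
proof -
  obtain f :: "nat \<Rightarrow> nat" where f: "strict_mono f" "monoseq (\<lambda>n. s (f n))"
    using seq_monosub by blast
  show thesis
  proof (cases "incseq (\<lambda>n. s (f n))")
    case True
    then show thesis using f that by (auto simp: comp_def)
  next
    case False
    then have dec: "decseq (\<lambda>n. s (f n))" using f(2) by (simp add: monoseq_iff)
    have "\<exists>m\<in>range (\<lambda>n. s (f n)). \<forall>b\<in>range (\<lambda>n. s (f n)). m \<le> b"
      using assms unfolding well_ordered_def by (metis empty_not_UNIV image_is_empty image_subsetI)
    then obtain N where N: "\<And>n. s (f N) \<le> s (f n)" by auto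
    have eq: "s (f (n + N)) = s (f N)" for n
      using N[of "n+N"] decseqD[OF dec, of N "n + N"] by simp
    show thesis
      by (rule that[of "\<lambda>n. f (n + N)"])
        (use f(1) eq in \<open>auto simp: strict_mono_def incseq_def\<close>)
  qed
qed

lemma well_ordered_empty [simp]: "well_ordered {}"
  by (simp add: well_ordered_def)

lemma well_ordered_singleton [simp]: "well_ordered {a}"
  by (auto simp: well_ordered_def)

lemma well_ordered_Un:
  assumes "well_ordered A" "well_ordered B" shows "well_ordered (A \<union> B)"
proof (rule well_orderedI)
  fix s assume s: "\<And>n::nat. s n \<in> A \<union> B" "\<And>n. s (Suc n) < s n"
  have dec: "m < n \<Longrightarrow> s n < s m" for m n
    using lift_Suc_mono_less[of "\<lambda>n. - s n" m n] s(2) by simp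
  have *: False if wo: "well_ordered C" and inf: "infinite {n. s n \<in> C}" for C
  proof -
    obtain r :: "nat \<Rightarrow> nat" where r: "strict_mono r" "\<And>n. r n \<in> {n. s n \<in> C}"
      using infinite_enumerate[OF inf] by blast
    show False
      by (rule well_ordered_no_decreasing[OF wo, of "\<lambda>n. s (r n)"])
        (use r dec in \<open>auto simp: strict_mono_def\<close>)
  qed
  have "{n. s n \<in> A} \<union> {n. s n \<in> B} = UNIV" using s(1) by blast
  then have "infinite {n. s n \<in> A} \<or> infinite {n. s n \<in> B}"
    by (metis finite_Un infinite_UNIV_nat)
  then show False using * assms by blast
qed

lemma well_ordered_UN:
  assumes "finite I" "\<And>i. i \<in> I \<Longrightarrow> well_ordered (A i)" shows "well_ordered (\<Union>i\<in>I. A i)"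
  using assms by (induction rule: finite_induct) (auto intro: well_ordered_Un)

lemma well_ordered_sum:
  assumes "well_ordered A" "well_ordered B"
  shows "well_ordered {a + b |a b. a \<in> A \<and> b \<in> B}"
proof (rule well_orderedI)
  fix s assume s: "\<And>n::nat. s n \<in> {a + b |a b. a \<in> A \<and> b \<in> B}" "\<And>n. s (Suc n) < s n"
  have dec: "m < n \<Longrightarrow> s n < s m" for m n
    using lift_Suc_mono_less[of "\<lambda>n. - s n" m n] s(2) by simp
  have "\<forall>n. \<exists>a b. a \<in> A \<and> b \<in> B \<and> s n = a + b" using s(1) by blast
  then obtain a b where ab: "\<And>n. a n \<in> A" "\<And>n. b n \<in> B" "\<And>n. s n = a n + b n" by metis
  obtain r where r: "strict_mono r" "incseq (a \<circ> r)"
    using well_ordered_incseq[OF assms(1), of a] ab(1) by blast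
  show False
  proof (rule well_ordered_no_decreasing[OF assms(2), of "\<lambda>n. b (r n)"])
    fix n
    have "a (r n) \<le> a (r (Suc n))" using r(2) by (simp add: incseq_def)
    moreover have "s (r (Suc n)) < s (r n)" using dec r(1) by (simp add: strict_mono_def)
    ultimately show "b (r (Suc n)) < b (r n)" using ab(3)[of "r n"] ab(3)[of "r (Suc n)"] by linarith
  qed (rule ab)
qed

lemma well_ordered_fibre_finite:
  assumes "well_ordered A" "well_ordered B"
  shows "finite {a \<in> A. \<nu> - a \<in> B}"
proof (rule ccontr)
  assume inf: "infinite {a \<in> A. \<nu> - a \<in> B}"
  obtain s :: "nat \<Rightarrow> real" where s: "inj s" "range s \<subseteq> {a \<in> A. \<nu> - a \<in> B}"
    using infinite_countable_subset[OF inf] by blast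
  then obtain r where r: "strict_mono r" "incseq (s \<circ> r)"
    using well_ordered_incseq[OF assms(1), of s] by blast
  show False
  proof (rule well_ordered_no_decreasing[OF assms(2), of "\<lambda>n. \<nu> - s (r n)"])
    fix n
    have "s (r n) \<le> s (r (Suc n))" using r(2) by (simp add: incseq_def)
    moreover have "s (r n) \<noteq> s (r (Suc n))"
      using s(1) r(1) by (metis inj_eq lessI strict_mono_eq nat_neq_iff)
    ultimately show "\<nu> - s (r (Suc n)) < \<nu> - s (r n)" by simp
  qed (use s in auto)
qed

text \<open>The generalized power series \<open>\<Sum>c\<^sub>\<nu> t\<^sup>\<nu>\<close> with real exponents and well-ordered support, as their
  coefficient functions; \<open>hahn_monom c \<nu>\<close> is \<open>c t\<^sup>\<nu>\<close>.\<close>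

typedef (overloaded) 'a hahn = "{c :: real \<Rightarrow> 'a::zero. well_ordered {\<nu>. c \<nu> \<noteq> 0}}"
  morphisms hahn_coeff Abs_hahn
  by (rule exI[of _ "\<lambda>_. 0"]) simp

definition hahn_support :: "'a::zero hahn \<Rightarrow> real set" where
  "hahn_support f = {\<nu>. hahn_coeff f \<nu> \<noteq> 0}"

lemma well_ordered_hahn_support [simp]: "well_ordered (hahn_support f)"
  using hahn_coeff[of f] by (simp add: hahn_support_def)

lemma hahn_eqI: "(\<And>\<nu>. hahn_coeff f \<nu> = hahn_coeff g \<nu>) \<Longrightarrow> f = g"
  by (metis ext hahn_coeff_inject)

lemma hahn_coeff_Abs:
  "well_ordered A \<Longrightarrow> (\<And>\<nu>. \<nu> \<notin> A \<Longrightarrow> c \<nu> = 0) \<Longrightarrow> hahn_coeff (Abs_hahn c) = c"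
  by (rule Abs_hahn_inverse) (auto intro: well_ordered_subset)

definition hahn_monom :: "'a::zero \<Rightarrow> real \<Rightarrow> 'a hahn" where
  "hahn_monom c \<nu> = Abs_hahn (\<lambda>\<mu>. if \<mu> = \<nu> then c else 0)"

lemma hahn_coeff_monom: "hahn_coeff (hahn_monom c \<nu>) \<mu> = (if \<mu> = \<nu> then c else 0)"
  unfolding hahn_monom_def by (subst hahn_coeff_Abs[of "{\<nu>}"]) auto

instantiation hahn :: (comm_ring_1) comm_ring_1
begin

definition "0 = Abs_hahn (\<lambda>_. 0)"
definition "1 = hahn_monom 1 0"
definition "f + g = Abs_hahn (\<lambda>\<nu>. hahn_coeff f \<nu> + hahn_coeff g \<nu>)"
definition "- f = Abs_hahn (\<lambda>\<nu>. - hahn_coeff f \<nu>)"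
definition "f - g = Abs_hahn (\<lambda>\<nu>. hahn_coeff f \<nu> - hahn_coeff g \<nu>)"
definition "f * g = Abs_hahn (\<lambda>\<nu>. \<Sum>\<mu> | \<mu> \<in> hahn_support f \<and> \<nu> - \<mu> \<in> hahn_support g.
    hahn_coeff f \<mu> * hahn_coeff g (\<nu> - \<mu>))"

lemma hahn_coeff_0 [simp]: "hahn_coeff 0 \<nu> = 0"
  unfolding zero_hahn_def by (subst hahn_coeff_Abs[of "{}"]) auto

lemma hahn_coeff_1: "hahn_coeff 1 \<nu> = (if \<nu> = 0 then 1 else 0)"
  unfolding one_hahn_def by (rule hahn_coeff_monom)

lemma hahn_coeff_add [simp]: "hahn_coeff (f + g) \<nu> = hahn_coeff f \<nu> + hahn_coeff g \<nu>"
  unfolding plus_hahn_def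
  by (subst hahn_coeff_Abs[of "hahn_support f \<union> hahn_support g"])
    (auto intro!: well_ordered_Un well_ordered_hahn_support, auto simp: hahn_support_def)

lemma hahn_coeff_uminus [simp]: "hahn_coeff (- f) \<nu> = - hahn_coeff f \<nu>"
  unfolding uminus_hahn_def
  by (subst hahn_coeff_Abs[of "hahn_support f"], simp) (auto simp: hahn_support_def)

lemma hahn_coeff_diff [simp]: "hahn_coeff (f - g) \<nu> = hahn_coeff f \<nu> - hahn_coeff g \<nu>"
  unfolding minus_hahn_def
  by (subst hahn_coeff_Abs[of "hahn_support f \<union> hahn_support g"])
    (auto intro!: well_ordered_Un well_ordered_hahn_support, auto simp: hahn_support_def)

lemma hahn_coeff_mult:
  "hahn_coeff (f * g) \<nu> = (\<Sum>\<mu> | \<mu> \<in> hahn_support f \<and> \<nu> - \<mu> \<in> hahn_support g.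
    hahn_coeff f \<mu> * hahn_coeff g (\<nu> - \<mu>))"
  unfolding times_hahn_def
proof (subst hahn_coeff_Abs[of "{a + b |a b. a \<in> hahn_support f \<and> b \<in> hahn_support g}"], goal_cases)
  case (2 \<nu>)
  then have "{\<mu>. \<mu> \<in> hahn_support f \<and> \<nu> - \<mu> \<in> hahn_support g} = {}"
    by (auto dest: spec[of _ "\<nu> - _"])
  then show ?case by (metis sum.empty)
qed (auto intro: well_ordered_sum)

lemma hahn_coeff_mult':
  assumes "well_ordered A" "hahn_support f \<subseteq> A" "well_ordered B" "hahn_support g \<subseteq> B"
  shows "hahn_coeff (f * g) \<nu> = (\<Sum>\<mu> | \<mu> \<in> A \<and> \<nu> - \<mu> \<in> B. hahn_coeff f \<mu> * hahn_coeff g (\<nu> - \<mu>))"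
  unfolding hahn_coeff_mult
  by (rule sum.mono_neutral_left) (use assms well_ordered_fibre_finite[of A B \<nu>] in \<open>auto simp: hahn_support_def\<close>)

lemma hahn_mult_commute: "f * g = g * (f :: 'a hahn)"
  by (rule hahn_eqI, unfold hahn_coeff_mult,
      rule sum.reindex_bij_witness[of _ "\<lambda>\<mu>. _ - \<mu>" "\<lambda>\<mu>. _ - \<mu>"])
    (auto simp: mult.commute)

lemma hahn_support_mult:
  "hahn_support (f * g) \<subseteq> {a + b |a b. a \<in> hahn_support f \<and> b \<in> hahn_support g}"
proof
  fix \<nu> assume "\<nu> \<in> hahn_support (f * g)"
  then have "{\<mu>. \<mu> \<in> hahn_support f \<and> \<nu> - \<mu> \<in> hahn_support g} \<noteq> {}"
    unfolding hahn_support_def[of "f * g"] mem_Collect_eq hahn_coeff_mult by (metis sum.empty)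
  then show "\<nu> \<in> {a + b |a b. a \<in> hahn_support f \<and> b \<in> hahn_support g}"
    by force
qed

lemma hahn_mult_assoc: "(f * g) * h = f * (g * (h :: 'a hahn))"
proof (rule hahn_eqI)
  fix \<nu>
  let ?A = "hahn_support f" and ?B = "hahn_support g" and ?C = "hahn_support h"
  let ?F = "hahn_coeff f" and ?G = "hahn_coeff g" and ?H = "hahn_coeff h"
  let ?AB = "{a + b |a b. a \<in> ?A \<and> b \<in> ?B}" and ?BC = "{a + b |a b. a \<in> ?B \<and> b \<in> ?C}"
  have wAB: "well_ordered ?AB" "well_ordered ?BC" by (simp_all add: well_ordered_sum)
  let ?P = "{s. s \<in> ?AB \<and> \<nu> - s \<in> ?C}" and ?Q = "{a. a \<in> ?A \<and> \<nu> - a \<in> ?BC}"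
  have finP: "finite ?P" and finQ: "finite ?Q"
    by (rule well_ordered_fibre_finite; use wAB in simp)+
  have "hahn_coeff ((f * g) * h) \<nu> = (\<Sum>s\<in>?P. hahn_coeff (f * g) s * ?H (\<nu> - s))"
    by (rule hahn_coeff_mult') (use wAB in \<open>simp_all add: hahn_support_mult\<close>)
  also have "\<dots> = (\<Sum>s\<in>?P. \<Sum>a | a \<in> ?A \<and> s - a \<in> ?B. ?F a * ?G (s - a) * ?H (\<nu> - s))"
    by (simp add: hahn_coeff_mult sum_distrib_right)
  also have "\<dots> = (\<Sum>(s,a)\<in>(SIGMA s:?P. {a. a \<in> ?A \<and> s - a \<in> ?B}). ?F a * ?G (s - a) * ?H (\<nu> - s))"
    by (rule sum.Sigma) (use finP in \<open>auto intro!: well_ordered_fibre_finite\<close>)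
  also have "\<dots> = (\<Sum>(a,b)\<in>(SIGMA a:?Q. {b. b \<in> ?B \<and> (\<nu> - a) - b \<in> ?C}). ?F a * (?G b * ?H (\<nu> - a - b)))"
  proof (rule sum.reindex_bij_witness[of _ "\<lambda>(a,b). (a + b, a)" "\<lambda>(s,a). (a, s - a)"], goal_cases)
    case (2 p)
    then obtain s a where p: "p = (s, a)" "a \<in> ?A" "s - a \<in> ?B" "\<nu> - s \<in> ?C" by auto
    have "\<nu> - a = (s - a) + (\<nu> - s)" by simp
    then have "\<nu> - a \<in> ?BC" using p by blast
    then show ?case using p by simp
  next
    case (4 p)
    then obtain a b where p: "p = (a, b)" "a \<in> ?A" "b \<in> ?B" "\<nu> - a - b \<in> ?C" by auto
    then have "a + b \<in> ?AB" by blast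
    then show ?case using p by (simp add: diff_diff_eq)
  qed (simp_all add: split_def mult.assoc)
  also have "\<dots> = (\<Sum>a\<in>?Q. \<Sum>b | b \<in> ?B \<and> (\<nu> - a) - b \<in> ?C. ?F a * (?G b * ?H (\<nu> - a - b)))"
    by (rule sum.Sigma[symmetric]) (use finQ in \<open>auto intro!: well_ordered_fibre_finite\<close>)
  also have "\<dots> = (\<Sum>a\<in>?Q. ?F a * hahn_coeff (g * h) (\<nu> - a))"
    by (simp add: hahn_coeff_mult sum_distrib_left)
  also have "\<dots> = hahn_coeff (f * (g * h)) \<nu>"
    by (rule hahn_coeff_mult'[symmetric]) (use wAB in \<open>simp_all add: hahn_support_mult\<close>)
  finally show "hahn_coeff ((f * g) * h) \<nu> = hahn_coeff (f * (g * h)) \<nu>" .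
qed

lemma hahn_coeff_monom_mult:
  "hahn_coeff (hahn_monom c a * f) \<nu> = c * hahn_coeff f (\<nu> - a)"
proof -
  have "hahn_coeff (hahn_monom c a * f) \<nu> = (\<Sum>\<mu> | \<mu> \<in> {a} \<and> \<nu> - \<mu> \<in> hahn_support f.
      hahn_coeff (hahn_monom c a) \<mu> * hahn_coeff f (\<nu> - \<mu>))"
    by (rule hahn_coeff_mult')
        (auto simp: hahn_support_def[of "hahn_monom c a"] hahn_coeff_monom split: if_splits)
  also have "{\<mu>. \<mu> \<in> {a} \<and> \<nu> - \<mu> \<in> hahn_support f} = (if \<nu> - a \<in> hahn_support f then {a} else {})"
    by auto
  finally show ?thesis by (auto simp: hahn_coeff_monom hahn_support_def)
qed

instance
proof
  fix f g h :: "'a hahn"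
  show "f * g * h = f * (g * h)" by (rule hahn_mult_assoc)
  show "f * g = g * f" by (rule hahn_mult_commute)
  show "1 * f = f"
    unfolding one_hahn_def by (rule hahn_eqI) (simp add: hahn_coeff_monom_mult)
  show "(f + g) * h = f * h + g * h"
  proof (rule hahn_eqI)
    fix \<nu>
    let ?A = "hahn_support f \<union> hahn_support g" and ?C = "hahn_support h"
    have w: "well_ordered ?A" by (simp add: well_ordered_Un)
    have sub: "hahn_support (f + g) \<subseteq> ?A" by (auto simp: hahn_support_def)
    show "hahn_coeff ((f + g) * h) \<nu> = hahn_coeff (f * h + g * h) \<nu>"
      using hahn_coeff_mult'[OF w sub, of ?C h \<nu>] hahn_coeff_mult'[OF w, of f ?C h \<nu>]
        hahn_coeff_mult'[OF w, of g ?C h \<nu>]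
      by (simp add: sum.distrib algebra_simps)
  qed
  have "hahn_coeff (0 :: 'a hahn) 0 \<noteq> hahn_coeff 1 0" by (simp add: hahn_coeff_1)
  then show "(0 :: 'a hahn) \<noteq> 1" by metis
qed (rule hahn_eqI; simp)+

end

lemma hahn_monom_mult: "hahn_monom c a * hahn_monom d b = hahn_monom (c * d) (a + b)"
  by (rule hahn_eqI) (auto simp: hahn_coeff_monom_mult hahn_coeff_monom)

lemma hahn_coeff_sum: "hahn_coeff (\<Sum>i\<in>I. f i) \<nu> = (\<Sum>i\<in>I. hahn_coeff (f i) \<nu>)"
  by (induction I rule: infinite_finite_induct) auto

lemma hahn_geometric:
  fixes g :: "'a::comm_ring_1 hahn"
  assumes pos: "\<And>\<nu>. \<nu> \<in> hahn_support g \<Longrightarrow> 0 < \<nu>"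
  shows "\<exists>h. (1 - g) * h = 1"
proof -
  obtain s where s: "0 < s" "\<And>\<nu>. \<nu> \<in> hahn_support g \<Longrightarrow> s \<le> \<nu>"
  proof (cases "hahn_support g = {}")
    case True then show thesis using that[of 1] by auto
  next
    case False
    then obtain m where "m \<in> hahn_support g" "\<forall>b\<in>hahn_support g. m \<le> b"
      using well_ordered_hahn_support[of g] unfolding well_ordered_def by blast
    then show thesis using that[of m] pos by auto
  qed
  have supp: "real k * s \<le> \<nu>" if "\<nu> \<in> hahn_support (g ^ k)" for k \<nu>
    using that
  proof (induction k arbitrary: \<nu>)
    case 0 then show ?case by (auto simp: hahn_support_def hahn_coeff_1 split: if_splits)
  next
    case (Suc k)
    then obtain a b where "a \<in> hahn_support g" "b \<in> hahn_support (g ^ k)" "\<nu> = a + b"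
      using hahn_support_mult[of g "g ^ k"] by auto
    then show ?case using Suc.IH[of b] s(2)[of a] by (simp add: algebra_simps)
  qed
  obtain N :: "real \<Rightarrow> nat" where N: "\<And>\<nu> k. N \<nu> < k \<Longrightarrow> \<nu> < real k * s"
  proof -
    have "\<forall>\<nu>. \<exists>n::nat. \<nu> < real n * s" using s(1) reals_Archimedean3 by blast
    then obtain N where N: "\<And>\<nu>. \<nu> < real (N \<nu>) * s" by metis
    show thesis
      by (rule that[of N]) (metis N less_trans mult_less_cancel_right_disj of_nat_less_iff s(1))
  qed
  have vanish: "hahn_coeff (g ^ k) \<nu> = 0" if "N \<mu> < k" "\<nu> \<le> \<mu>" for k \<nu> \<mu>
    using supp[of \<nu> k] N[of \<mu> k] that by (force simp: hahn_support_def)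
  define c where "c \<nu> = (\<Sum>k\<le>N \<nu>. hahn_coeff (g ^ k) \<nu>)" for \<nu>
  have c_eq: "c \<nu> = hahn_coeff (\<Sum>k\<le>N \<mu>. g ^ k) \<nu>" if "\<nu> \<le> \<mu>" for \<mu> \<nu>
  proof -
    have "c \<nu> = (\<Sum>k\<le>max (N \<nu>) (N \<mu>). hahn_coeff (g ^ k) \<nu>)"
      unfolding c_def by (rule sum.mono_neutral_left) (use vanish[of \<nu>] in auto)
    also have "\<dots> = (\<Sum>k\<le>N \<mu>. hahn_coeff (g ^ k) \<nu>)"
      by (rule sum.mono_neutral_right) (use vanish[of \<mu>] that in auto)
    finally show ?thesis by (simp add: hahn_coeff_sum)
  qed
  have wo: "well_ordered {\<nu>. c \<nu> \<noteq> 0}"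
  proof (rule well_orderedI)
    fix q assume q: "\<And>n::nat. q n \<in> {\<nu>. c \<nu> \<noteq> 0}" "\<And>n. q (Suc n) < q n"
    have le: "q n \<le> q 0" for n
      using lift_Suc_antimono_le[of q 0 n] q(2) by (simp add: less_imp_le)
    show False
      by (rule well_ordered_no_decreasing[OF well_ordered_hahn_support[of "\<Sum>k\<le>N (q 0). g ^ k"], of q])
        (use q c_eq[OF le] in \<open>auto simp: hahn_support_def\<close>)
  qed
  define h where "h = Abs_hahn c"
  have h: "hahn_coeff h = c" unfolding h_def by (rule Abs_hahn_inverse) (use wo in simp)
  have "(1 - g) * h = 1"
  proof (rule hahn_eqI)
    fix \<nu>
    define H where "H = (\<Sum>k\<le>N \<nu>. g ^ k)"
    let ?A = "hahn_support (1 - g)" and ?B = "hahn_support h \<union> hahn_support H"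
    have A: "0 \<le> a" if "a \<in> ?A" for a
      using that pos[of a] by (cases "a = 0") (auto simp: hahn_support_def hahn_coeff_1)
    have B: "well_ordered ?B" by (simp add: well_ordered_Un)
    have "hahn_coeff ((1 - g) * h) \<nu> = (\<Sum>a | a \<in> ?A \<and> \<nu> - a \<in> ?B. hahn_coeff (1 - g) a * hahn_coeff h (\<nu> - a))"
      by (rule hahn_coeff_mult') (use B in auto)
    also have "\<dots> = (\<Sum>a | a \<in> ?A \<and> \<nu> - a \<in> ?B. hahn_coeff (1 - g) a * hahn_coeff H (\<nu> - a))"
      by (rule sum.cong) (use A c_eq[of "\<nu> - _" \<nu>] in \<open>auto simp: h H_def\<close>)
    also have "\<dots> = hahn_coeff ((1 - g) * H) \<nu>"
      by (rule hahn_coeff_mult'[symmetric]) (use B in auto)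
    also have "(1 - g) * H = 1 - g ^ Suc (N \<nu>)"
      unfolding H_def by (rule sum_gp_basic)
    also have "hahn_coeff (1 - g ^ Suc (N \<nu>)) \<nu> = hahn_coeff 1 \<nu>"
      using vanish[of \<nu> "Suc (N \<nu>)" \<nu>] by simp
    finally show "hahn_coeff ((1 - g) * h) \<nu> = hahn_coeff 1 \<nu>" .
  qed
  then show ?thesis ..
qed

lemma hahn_unit:
  fixes f :: "'a::field hahn"
  assumes "f \<noteq> 0"
  shows "\<exists>h. f * h = 1"
proof -
  have "hahn_support f \<noteq> {}" using assms by (auto simp: hahn_support_def intro!: hahn_eqI)
  then obtain m where m: "m \<in> hahn_support f" "\<forall>b\<in>hahn_support f. m \<le> b"
    using well_ordered_hahn_support[of f] unfolding well_ordered_def by blast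
  define c where "c = hahn_coeff f m"
  have c: "c \<noteq> 0" using m by (simp add: c_def hahn_support_def)
  define u where "u = hahn_monom (inverse c) (- m)"
  have "\<exists>h. (1 - (1 - u * f)) * h = 1"
  proof (rule hahn_geometric)
    fix \<nu> assume \<nu>: "\<nu> \<in> hahn_support (1 - u * f)"
    then have *: "hahn_coeff 1 \<nu> \<noteq> inverse c * hahn_coeff f (\<nu> + m)"
      by (simp add: hahn_support_def u_def hahn_coeff_monom_mult)
    have "\<nu> \<noteq> 0" using * c by (auto simp: hahn_coeff_1 c_def)
    then have "\<nu> + m \<in> hahn_support f" using * by (auto simp: hahn_coeff_1 hahn_support_def)
    then show "0 < \<nu>" using m(2) \<open>\<nu> \<noteq> 0\<close> by force
  qed
  then obtain h where "u * f * h = 1" by auto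
  then have "f * (u * h) = 1" by (simp add: ac_simps)
  then show ?thesis by blast
qed

instantiation hahn :: (field) field
begin

definition "inverse f = (if f = 0 then 0 else SOME h. f * h = (1 :: 'a hahn))"
definition "f div g = f * inverse (g :: 'a hahn)"

instance
proof
  fix f g :: "'a hahn"
  show "inverse f * f = 1" if "f \<noteq> 0"
    using someI_ex[OF hahn_unit[OF that]] that by (simp add: inverse_hahn_def mult.commute)
qed (simp_all add: inverse_hahn_def divide_hahn_def)

end

section \<open>Polynomial rings and quotient fields\<close>

abbreviation type_ring :: "'a::comm_ring_1 ring" where
  "type_ring \<equiv> \<lparr>carrier = UNIV, mult = (*), one = 1, zero = 0, add = (+)\<rparr>"

lemma cring_type_ring: "cring (type_ring :: 'a::comm_ring_1 ring)"
  by (rule cringI, rule abelian_groupI, simp_all, metis add.commute add.right_inverse)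
    (auto intro!: comm_monoidI simp: algebra_simps)

type_synonym ('n, 'a) mpoly = "('n \<Rightarrow>\<^sub>0 nat) \<Rightarrow>\<^sub>0 'a"

text \<open>A key \<open>m\<close> of a polynomial is the exponent vector of the monomial \<open>x\<^sup>m\<close>.\<close>

definition mconst :: "'a::zero \<Rightarrow> ('n, 'a) mpoly" where
  "mconst c = Poly_Mapping.single 0 c"

definition mvar :: "'n \<Rightarrow> ('n, 'a::zero_neq_one) mpoly" where
  "mvar i = Poly_Mapping.single (Poly_Mapping.single i 1) 1"

text \<open>The image of \<open>f\<close> under the ring homomorphism extending \<open>h\<close> on the coefficients and
  \<open>i \<mapsto> x i\<close> on the variables.\<close>

definition msubst ::
    "('a::zero \<Rightarrow> 'b::comm_ring_1) \<Rightarrow> ('n::finite \<Rightarrow> 'b) \<Rightarrow> ('n, 'a) mpoly \<Rightarrow> 'b" where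
  "msubst h x f = (\<Sum>m\<in>Poly_Mapping.keys f. h (Poly_Mapping.lookup f m) *
     (\<Prod>i\<in>UNIV. x i ^ Poly_Mapping.lookup m i))"

lemma msubst_superset:
  assumes "finite A" "Poly_Mapping.keys f \<subseteq> A" "h 0 = 0"
  shows "msubst h x f = (\<Sum>m\<in>A. h (Poly_Mapping.lookup f m) * (\<Prod>i\<in>UNIV. x i ^ Poly_Mapping.lookup m i))"
  unfolding msubst_def
  by (rule sum.mono_neutral_left) (use assms in \<open>auto simp: in_keys_iff\<close>)

lemma msubst_single:
  "h 0 = 0 \<Longrightarrow> msubst h x (Poly_Mapping.single m c) = h c * (\<Prod>i\<in>UNIV. x i ^ Poly_Mapping.lookup m i)"
  by (subst msubst_superset[of "{m}"]) auto

lemma msubst_add: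
  assumes "h 0 = 0" "\<And>a b. h (a + b) = h a + h b"
  shows "msubst h x (f + g) = msubst h x f + msubst h x g"
proof -
  let ?A = "Poly_Mapping.keys f \<union> Poly_Mapping.keys g"
  have "Poly_Mapping.keys (f + g) \<subseteq> ?A" by (rule Poly_Mapping.keys_add)
  then show ?thesis
    by (simp add: msubst_superset[of ?A] assms lookup_add sum.distrib algebra_simps)
qed

lemma poly_mapping_sum_single: "f = (\<Sum>m\<in>Poly_Mapping.keys f. Poly_Mapping.single m (Poly_Mapping.lookup f m))"
  by (rule poly_mapping_eqI) (auto simp: lookup_sum lookup_single when_def in_keys_iff)

lemma msubst_mult:
  fixes h :: "'a::comm_ring_1 \<Rightarrow> 'b::comm_ring_1"
  assumes h: "h 0 = 0" "\<And>a b. h (a + b) = h a + h b" "\<And>a b. h (a * b) = h a * h b"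
  shows "msubst h x (f * g) = msubst h x f * msubst h x g"
proof -
  let ?s = "\<lambda>f m. Poly_Mapping.single m (Poly_Mapping.lookup f m)"
  have sum: "msubst h x (\<Sum>i\<in>I. F i) = (\<Sum>i\<in>I. msubst h x (F i))" for I and F :: "_ \<Rightarrow> ('c, 'a) mpoly"
    by (induction I rule: infinite_finite_induct)
      (auto simp: msubst_add h, auto simp: msubst_def)
  have "f * g = (\<Sum>m\<in>Poly_Mapping.keys f. \<Sum>l\<in>Poly_Mapping.keys g. ?s f m * ?s g l)"
    by (subst poly_mapping_sum_single[of f], subst poly_mapping_sum_single[of g])
      (simp add: sum_product)
  then have "msubst h x (f * g) = (\<Sum>m\<in>Poly_Mapping.keys f. \<Sum>l\<in>Poly_Mapping.keys g. msubst h x (?s f m * ?s g l))"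
    by (simp add: sum)
  also have "\<dots> = msubst h x f * msubst h x g"
    by (simp add: msubst_def[of h x f] msubst_def[of h x g] sum_product mult_single msubst_single h
        lookup_add power_add prod.distrib algebra_simps)
  finally show ?thesis .
qed

text \<open>The polynomial ring in the variables \<open>'n\<close> over a ring with explicit carrier.\<close>

definition mpoly_ring :: "('a, 'b) ring_scheme \<Rightarrow> (('n \<Rightarrow>\<^sub>0 nat) \<Rightarrow> 'a) ring" where
  "mpoly_ring R =
    \<lparr>carrier = {F. (\<forall>m. F m \<in> carrier R) \<and> finite {m. F m \<noteq> \<zero>\<^bsub>R\<^esub>}},
     mult = (\<lambda>F G m. \<Oplus>\<^bsub>R\<^esub>p\<in>{p. fst p + snd p = m}. F (fst p) \<otimes>\<^bsub>R\<^esub> G (snd p)),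
     one = (\<lambda>m. if m = 0 then \<one>\<^bsub>R\<^esub> else \<zero>\<^bsub>R\<^esub>),
     zero = (\<lambda>m. \<zero>\<^bsub>R\<^esub>),
     add = (\<lambda>F G m. F m \<oplus>\<^bsub>R\<^esub> G m)\<rparr>"

lemma finite_decomp [simp]:
  "finite {p :: ('n::finite \<Rightarrow>\<^sub>0 nat) \<times> ('n \<Rightarrow>\<^sub>0 nat). fst p + snd p = m}"
proof -
  let ?B = "{a :: 'n \<Rightarrow>\<^sub>0 nat. \<forall>i. Poly_Mapping.lookup a i \<le> Poly_Mapping.lookup m i}"
  have "Poly_Mapping.lookup ` ?B \<subseteq> Pi\<^sub>E UNIV (\<lambda>i. {..Poly_Mapping.lookup m i})"
    by auto
  then have "finite (Poly_Mapping.lookup ` ?B)"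
    by (rule finite_subset) (rule finite_PiE; simp)
  then have "finite ?B"
    by (rule finite_imageD) (meson inj_onI lookup_inject)
  moreover have "{p. fst p + snd p = m} \<subseteq> ?B \<times> ?B"
    by (auto simp: lookup_add)
  ultimately show ?thesis by (meson finite_SigmaI finite_subset)
qed

lemma (in abelian_monoid) finsum_Sigma':
  assumes "finite A" "\<And>x. x \<in> A \<Longrightarrow> finite (B x)"
    and "\<And>x y. x \<in> A \<Longrightarrow> y \<in> B x \<Longrightarrow> f x y \<in> carrier G"
  shows "(\<Oplus>x\<in>A. \<Oplus>y\<in>B x. f x y) = (\<Oplus>p\<in>Sigma A B. f (fst p) (snd p))"
  using assms
proof (induction A rule: finite_induct)
  case (insert x A)
  have eq: "Sigma (insert x A) B = Pair x ` B x \<union> Sigma A B" by auto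
  have "(\<Oplus>p\<in>Sigma (insert x A) B. f (fst p) (snd p)) =
      (\<Oplus>p\<in>Pair x ` B x. f (fst p) (snd p)) \<oplus> (\<Oplus>p\<in>Sigma A B. f (fst p) (snd p))"
    unfolding eq using insert by (intro finsum_Un_disjoint) auto
  also have "(\<Oplus>p\<in>Pair x ` B x. f (fst p) (snd p)) = (\<Oplus>y\<in>B x. f x y)"
    using insert by (subst finsum_reindex) (auto simp: inj_on_def)
  finally show ?case
    using insert by (subst finsum_insert) auto
qed simp

lemma (in cring) mpoly_ring_cring: "cring (mpoly_ring R :: (('n::finite \<Rightarrow>\<^sub>0 nat) \<Rightarrow> 'a) ring)"
proof -
  let ?P = "mpoly_ring R :: (('n \<Rightarrow>\<^sub>0 nat) \<Rightarrow> 'a) ring"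
  let ?D = "\<lambda>m. {p :: ('n \<Rightarrow>\<^sub>0 nat) \<times> ('n \<Rightarrow>\<^sub>0 nat). fst p + snd p = m}"
  let ?m = "\<lambda>F G m. \<Oplus>p\<in>?D m. F (fst p) \<otimes> G (snd p)"
  have inR: "F \<in> carrier ?P \<Longrightarrow> F m \<in> carrier R" for F m by (simp add: mpoly_ring_def)
  have mult: "F \<otimes>\<^bsub>?P\<^esub> G = ?m F G" for F G by (simp add: mpoly_ring_def)
  have nz: "\<exists>p\<in>?D m. F (fst p) \<noteq> \<zero> \<and> G (snd p) \<noteq> \<zero>"
    if "F \<in> carrier ?P" "G \<in> carrier ?P" "?m F G m \<noteq> \<zero>" for F G m
  proof (rule ccontr)
    assume "\<not> ?thesis"
    then have "?m F G m = (\<Oplus>p\<in>?D m. \<zero>)"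
      using that inR by (intro finsum_cong') (auto, metis l_null r_null)
    with that show False by simp
  qed
  have add_c: "F \<oplus>\<^bsub>?P\<^esub> G \<in> carrier ?P" if "F \<in> carrier ?P" "G \<in> carrier ?P" for F G
  proof -
    have "{m. F m \<oplus> G m \<noteq> \<zero>} \<subseteq> {m. F m \<noteq> \<zero>} \<union> {m. G m \<noteq> \<zero>}" by auto
    then show ?thesis using that by (auto simp: mpoly_ring_def intro: finite_subset)
  qed
  have mult_c: "F \<otimes>\<^bsub>?P\<^esub> G \<in> carrier ?P" if FG: "F \<in> carrier ?P" "G \<in> carrier ?P" for F G
  proof -
    have "{m. ?m F G m \<noteq> \<zero>} \<subseteq> (\<lambda>(a, b). a + b) ` ({m. F m \<noteq> \<zero>} \<times> {m. G m \<noteq> \<zero>})"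
      using nz[OF FG] by force
    moreover have "finite ({m. F m \<noteq> \<zero>} \<times> {m. G m \<noteq> \<zero>})"
      using FG by (auto simp: mpoly_ring_def)
    ultimately have "finite {m. ?m F G m \<noteq> \<zero>}" by (meson finite_imageI finite_subset)
    then show ?thesis using inR[OF FG(1)] inR[OF FG(2)] by (auto simp: mpoly_ring_def)
  qed
  have one_c: "\<one>\<^bsub>?P\<^esub> \<in> carrier ?P" by (auto simp: mpoly_ring_def)
  have comm: "F \<otimes>\<^bsub>?P\<^esub> G = G \<otimes>\<^bsub>?P\<^esub> F" if FG: "F \<in> carrier ?P" "G \<in> carrier ?P" for F G
  proof (rule ext)
    fix m
    have "?m F G m = (\<Oplus>p\<in>prod.swap ` ?D m. F (fst p) \<otimes> G (snd p))"
    proof -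
      have "prod.swap ` ?D m = ?D m" by (force simp: add.commute image_iff)
      then show ?thesis by simp
    qed
    also have "\<dots> = (\<Oplus>p\<in>?D m. F (snd p) \<otimes> G (fst p))"
      using inR FG by (subst finsum_reindex) auto
    also have "\<dots> = ?m G F m"
      using inR FG by (intro finsum_cong') (auto simp: m_comm)
    finally show "(F \<otimes>\<^bsub>?P\<^esub> G) m = (G \<otimes>\<^bsub>?P\<^esub> F) m" by (simp add: mult)
  qed
  have assoc: "(F \<otimes>\<^bsub>?P\<^esub> G) \<otimes>\<^bsub>?P\<^esub> H = F \<otimes>\<^bsub>?P\<^esub> (G \<otimes>\<^bsub>?P\<^esub> H)"
    if FGH: "F \<in> carrier ?P" "G \<in> carrier ?P" "H \<in> carrier ?P" for F G H
  proof (rule ext)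
    fix m
    let ?S = "Sigma (?D m) (\<lambda>p. ?D (fst p))" and ?T = "Sigma (?D m) (\<lambda>p. ?D (snd p))"
    note c = inR[OF FGH(1)] inR[OF FGH(2)] inR[OF FGH(3)]
    have "?m (?m F G) H m = (\<Oplus>p\<in>?D m. \<Oplus>q\<in>?D (fst p). (F (fst q) \<otimes> G (snd q)) \<otimes> H (snd p))"
      using c by (intro finsum_cong') (auto simp: finsum_ldistr)
    also have "\<dots> = (\<Oplus>r\<in>?S. (F (fst (snd r)) \<otimes> G (snd (snd r))) \<otimes> H (snd (fst r)))"
      using c by (subst finsum_Sigma') auto
    also have "?S = (\<lambda>((a, bc), (b, c)). ((a + b, c), (a, b))) ` ?T"
    proof -
      have "((a + b, c), (a, b)) \<in> (\<lambda>((a, bc), (b, c)). ((a + b, c), (a, b))) ` ?T" if "a + b + c = m" for a b c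
        by (rule image_eqI[of _ _ "((a, b + c), (b, c))"]) (use that in \<open>auto simp: add.assoc\<close>)
      then show ?thesis by (auto simp: add.assoc)
    qed
    also have "(\<Oplus>r\<in>\<dots>. (F (fst (snd r)) \<otimes> G (snd (snd r))) \<otimes> H (snd (fst r))) =
        (\<Oplus>r\<in>?T. (F (fst (fst r)) \<otimes> G (fst (snd r))) \<otimes> H (snd (snd r)))"
      using c by (subst finsum_reindex) (auto simp: inj_on_def split_def)
    also have "\<dots> = (\<Oplus>p\<in>?D m. \<Oplus>q\<in>?D (snd p). (F (fst p) \<otimes> G (fst q)) \<otimes> H (snd q))"
      using c by (subst finsum_Sigma') auto
    also have "\<dots> = ?m F (?m G H) m"
      using c by (intro finsum_cong') (auto simp: finsum_rdistr m_assoc)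
    finally show "((F \<otimes>\<^bsub>?P\<^esub> G) \<otimes>\<^bsub>?P\<^esub> H) m = (F \<otimes>\<^bsub>?P\<^esub> (G \<otimes>\<^bsub>?P\<^esub> H)) m" by (simp add: mult)
  qed
  have one: "\<one>\<^bsub>?P\<^esub> \<otimes>\<^bsub>?P\<^esub> F = F" if F: "F \<in> carrier ?P" for F
  proof (rule ext)
    fix m
    have "(\<one>\<^bsub>?P\<^esub> \<otimes>\<^bsub>?P\<^esub> F) m = (\<Oplus>p\<in>?D m. if p = (0, m) then F m else \<zero>)"
      unfolding mult using inR[OF F] by (intro finsum_cong') (auto simp: mpoly_ring_def)
    also have "\<dots> = (\<Oplus>p\<in>?D m. if (0, m) = p then F m else \<zero>)"
      by (simp add: eq_commute)
    also have "\<dots> = F m" using inR[OF F] by (intro finsum_singleton) auto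
    finally show "(\<one>\<^bsub>?P\<^esub> \<otimes>\<^bsub>?P\<^esub> F) m = F m" .
  qed
  have distr: "(F \<oplus>\<^bsub>?P\<^esub> G) \<otimes>\<^bsub>?P\<^esub> H = F \<otimes>\<^bsub>?P\<^esub> H \<oplus>\<^bsub>?P\<^esub> G \<otimes>\<^bsub>?P\<^esub> H"
    if FGH: "F \<in> carrier ?P" "G \<in> carrier ?P" "H \<in> carrier ?P" for F G H
  proof (rule ext)
    fix m
    note c = inR[OF FGH(1)] inR[OF FGH(2)] inR[OF FGH(3)]
    have "?m (\<lambda>m. F m \<oplus> G m) H m = (\<Oplus>p\<in>?D m. F (fst p) \<otimes> H (snd p) \<oplus> G (fst p) \<otimes> H (snd p))"
      using c by (intro finsum_cong') (auto simp: l_distr)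
    also have "\<dots> = ?m F H m \<oplus> ?m G H m"
      using c by (intro finsum_addf) auto
    finally show "((F \<oplus>\<^bsub>?P\<^esub> G) \<otimes>\<^bsub>?P\<^esub> H) m = (F \<otimes>\<^bsub>?P\<^esub> H \<oplus>\<^bsub>?P\<^esub> G \<otimes>\<^bsub>?P\<^esub> H) m"
      by (simp add: mpoly_ring_def)
  qed
  have "abelian_group ?P"
  proof (rule abelian_groupI)
    fix F assume F: "F \<in> carrier ?P"
    let ?N = "\<lambda>m. \<ominus> F m"
    have "{m. ?N m \<noteq> \<zero>} \<subseteq> {m. F m \<noteq> \<zero>}" by auto
    then have "?N \<in> carrier ?P" using F by (auto simp: mpoly_ring_def intro: finite_subset)
    moreover have "?N \<oplus>\<^bsub>?P\<^esub> F = \<zero>\<^bsub>?P\<^esub>" using F by (auto simp: mpoly_ring_def l_neg)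
    ultimately show "\<exists>G\<in>carrier ?P. G \<oplus>\<^bsub>?P\<^esub> F = \<zero>\<^bsub>?P\<^esub>" by blast
  qed (use add_c in \<open>auto simp: mpoly_ring_def a_ac\<close>)
  then show ?thesis
    by (rule cringI) (auto intro!: comm_monoidI mult_c one_c assoc one comm distr)
qed

text \<open>The quotient field of a domain with explicit carrier: pairs \<open>(a, b)\<close> with \<open>b \<noteq> 0\<close> modulo
  \<open>(a, b) \<sim> (c, d) \<longleftrightarrow> a d = c b\<close>.\<close>

definition frac_rel :: "('a, 'b) ring_scheme \<Rightarrow> (('a \<times> 'a) \<times> ('a \<times> 'a)) set" where
  "frac_rel R = {((a, b), (c, d)) |a b c d. a \<in> carrier R \<and> b \<in> carrier R - {\<zero>\<^bsub>R\<^esub>} \<and>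
     c \<in> carrier R \<and> d \<in> carrier R - {\<zero>\<^bsub>R\<^esub>} \<and> a \<otimes>\<^bsub>R\<^esub> d = c \<otimes>\<^bsub>R\<^esub> b}"

definition fraction :: "('a, 'b) ring_scheme \<Rightarrow> 'a \<Rightarrow> 'a \<Rightarrow> ('a \<times> 'a) set" where
  "fraction R a b = frac_rel R `` {(a, b)}"

definition frac_field :: "('a, 'b) ring_scheme \<Rightarrow> ('a \<times> 'a) set ring" where
  "frac_field R =
    \<lparr>carrier = (carrier R \<times> (carrier R - {\<zero>\<^bsub>R\<^esub>})) // frac_rel R,
     mult = (\<lambda>X Y. \<Union>(a, b)\<in>X. \<Union>(c, d)\<in>Y. fraction R (a \<otimes>\<^bsub>R\<^esub> c) (b \<otimes>\<^bsub>R\<^esub> d)),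
     one = fraction R \<one>\<^bsub>R\<^esub> \<one>\<^bsub>R\<^esub>,
     zero = fraction R \<zero>\<^bsub>R\<^esub> \<one>\<^bsub>R\<^esub>,
     add = (\<lambda>X Y. \<Union>(a, b)\<in>X. \<Union>(c, d)\<in>Y.
       fraction R (a \<otimes>\<^bsub>R\<^esub> d \<oplus>\<^bsub>R\<^esub> c \<otimes>\<^bsub>R\<^esub> b) (b \<otimes>\<^bsub>R\<^esub> d))\<rparr>"

lemma UN_pairs_const:
  assumes "p \<in> X" "q \<in> Y" "\<And>x y z w. (x, y) \<in> X \<Longrightarrow> (z, w) \<in> Y \<Longrightarrow> f x y z w = c"
  shows "(\<Union>(x, y)\<in>X. \<Union>(z, w)\<in>Y. f x y z w) = c"
proof -
  obtain x y z w where p: "p = (x, y)" "q = (z, w)" by (metis surj_pair)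
  show ?thesis
  proof (intro equalityI subsetI)
    fix u assume "u \<in> c"
    then have "u \<in> f x y z w" using assms p by simp
    then show "u \<in> (\<Union>(x, y)\<in>X. \<Union>(z, w)\<in>Y. f x y z w)" using assms(1,2) p by blast
  next
    fix u assume "u \<in> (\<Union>(x, y)\<in>X. \<Union>(z, w)\<in>Y. f x y z w)"
    then obtain x y z w where "(x, y) \<in> X" "(z, w) \<in> Y" "u \<in> f x y z w" by blast
    then show "u \<in> c" using assms(3) by simp
  qed
qed

lemma (in domain) frac_field_field: "field (frac_field R)"
proof -
  let ?Q = "frac_field R" and ?N = "carrier R - {\<zero>}"
  let ?r = "frac_rel R"
  have N: "b \<in> ?N \<Longrightarrow> d \<in> ?N \<Longrightarrow> b \<otimes> d \<in> ?N" for b d using integral by auto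
  have equiv: "equiv (carrier R \<times> ?N) ?r"
  proof (rule equivI)
    show "trans ?r"
    proof (rule transI)
      fix p q s assume "(p, q) \<in> ?r" "(q, s) \<in> ?r"
      then obtain a b c d e f where *: "p = (a, b)" "q = (c, d)" "s = (e, f)"
        "a \<in> carrier R" "c \<in> carrier R" "e \<in> carrier R" "b \<in> ?N" "d \<in> ?N" "f \<in> ?N"
        "a \<otimes> d = c \<otimes> b" "c \<otimes> f = e \<otimes> d" by (auto simp: frac_rel_def)
      have "d \<otimes> (a \<otimes> f) = (a \<otimes> d) \<otimes> f" using *(4-9) by (simp add: m_ac)
      also have "\<dots> = (c \<otimes> f) \<otimes> b" unfolding *(10) using *(4-9) by (simp add: m_ac)
      also have "\<dots> = d \<otimes> (e \<otimes> b)" unfolding *(11) using *(4-9) by (simp add: m_ac)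
      finally have "a \<otimes> f = e \<otimes> b" using * by (subst (asm) m_lcancel) auto
      then show "(p, s) \<in> ?r" using * by (auto simp: frac_rel_def)
    qed
  qed (auto simp: frac_rel_def refl_on_def intro!: symI)
  have frac_eq: "fraction R a b = fraction R c d \<longleftrightarrow> a \<otimes> d = c \<otimes> b"
    if "a \<in> carrier R" "b \<in> ?N" "c \<in> carrier R" "d \<in> ?N" for a b c d
    using eq_equiv_class_iff[OF equiv, of "(a, b)" "(c, d)"] that
    by (auto simp: fraction_def frac_rel_def)
  have in_frac: "(x, y) \<in> fraction R a b \<longleftrightarrow> x \<in> carrier R \<and> y \<in> ?N \<and> a \<otimes> y = x \<otimes> b"
    if "a \<in> carrier R" "b \<in> ?N" for x y a b
    using that by (auto simp: fraction_def frac_rel_def)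
  have carr: "fraction R a b \<in> carrier ?Q" if "a \<in> carrier R" "b \<in> ?N" for a b
    using that by (auto simp: frac_field_def fraction_def intro: quotientI)
  have ex: "\<exists>a b. a \<in> carrier R \<and> b \<in> ?N \<and> X = fraction R a b" if "X \<in> carrier ?Q" for X
    using that by (auto simp: frac_field_def fraction_def elim!: quotientE)
  have multQ: "X \<otimes>\<^bsub>?Q\<^esub> Y = (\<Union>(a, b)\<in>X. \<Union>(c, d)\<in>Y. fraction R (a \<otimes> c) (b \<otimes> d))"
    and addQ: "X \<oplus>\<^bsub>?Q\<^esub> Y = (\<Union>(a, b)\<in>X. \<Union>(c, d)\<in>Y. fraction R (a \<otimes> d \<oplus> c \<otimes> b) (b \<otimes> d))" for X Y
    by (simp_all only: frac_field_def monoid.select_convs ring.select_convs)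
  have mult: "fraction R a b \<otimes>\<^bsub>?Q\<^esub> fraction R c d = fraction R (a \<otimes> c) (b \<otimes> d)"
    if A: "a \<in> carrier R" "b \<in> ?N" "c \<in> carrier R" "d \<in> ?N" for a b c d
  proof -
    have "fraction R (x \<otimes> z) (y \<otimes> w) = fraction R (a \<otimes> c) (b \<otimes> d)"
      if "(x, y) \<in> fraction R a b" "(z, w) \<in> fraction R c d" for x y z w
    proof -
      have B: "x \<in> carrier R" "y \<in> ?N" "z \<in> carrier R" "w \<in> ?N" "a \<otimes> y = x \<otimes> b" "c \<otimes> w = z \<otimes> d"
        using that A by (auto simp: in_frac)
      have "(x \<otimes> z) \<otimes> (b \<otimes> d) = (x \<otimes> b) \<otimes> (z \<otimes> d)" using A B(1-4) by (simp add: m_ac)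
      also have "\<dots> = (a \<otimes> y) \<otimes> (c \<otimes> w)" using B by simp
      also have "\<dots> = (a \<otimes> c) \<otimes> (y \<otimes> w)" using A B(1-4) by (simp add: m_ac)
      finally show ?thesis using A B N by (subst frac_eq) auto
    qed
    moreover have "(a, b) \<in> fraction R a b" "(c, d) \<in> fraction R c d" using A by (auto simp: in_frac)
    ultimately show ?thesis unfolding multQ by (rule UN_pairs_const[rotated 2])
  qed
  have add: "fraction R a b \<oplus>\<^bsub>?Q\<^esub> fraction R c d = fraction R (a \<otimes> d \<oplus> c \<otimes> b) (b \<otimes> d)"
    if A: "a \<in> carrier R" "b \<in> ?N" "c \<in> carrier R" "d \<in> ?N" for a b c d
  proof -
    have "fraction R (x \<otimes> w \<oplus> z \<otimes> y) (y \<otimes> w) = fraction R (a \<otimes> d \<oplus> c \<otimes> b) (b \<otimes> d)"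
      if "(x, y) \<in> fraction R a b" "(z, w) \<in> fraction R c d" for x y z w
    proof -
      have B: "x \<in> carrier R" "y \<in> ?N" "z \<in> carrier R" "w \<in> ?N" "a \<otimes> y = x \<otimes> b" "c \<otimes> w = z \<otimes> d"
        using that A by (auto simp: in_frac)
      have "(x \<otimes> w \<oplus> z \<otimes> y) \<otimes> (b \<otimes> d) = (x \<otimes> b) \<otimes> (w \<otimes> d) \<oplus> (z \<otimes> d) \<otimes> (y \<otimes> b)"
        using A B(1-4) by (simp add: m_ac l_distr r_distr)
      also have "\<dots> = (a \<otimes> y) \<otimes> (w \<otimes> d) \<oplus> (c \<otimes> w) \<otimes> (y \<otimes> b)" using B by simp
      also have "\<dots> = (a \<otimes> d \<oplus> c \<otimes> b) \<otimes> (y \<otimes> w)" using A B(1-4) by (simp add: m_ac l_distr r_distr)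
      finally show ?thesis using A B N by (subst frac_eq) auto
    qed
    moreover have "(a, b) \<in> fraction R a b" "(c, d) \<in> fraction R c d" using A by (auto simp: in_frac)
    ultimately show ?thesis unfolding addQ by (rule UN_pairs_const[rotated 2])
  qed
  have zero: "\<zero>\<^bsub>?Q\<^esub> = fraction R \<zero> \<one>" and one: "\<one>\<^bsub>?Q\<^esub> = fraction R \<one> \<one>"
    by (simp_all add: frac_field_def)
  have oneN: "\<one> \<in> ?N" by simp
  have "abelian_group ?Q"
  proof (rule abelian_groupI)
    fix X Y assume "X \<in> carrier ?Q" "Y \<in> carrier ?Q"
    then obtain a b c d where *: "a \<in> carrier R" "b \<in> ?N" "X = fraction R a b"
      "c \<in> carrier R" "d \<in> ?N" "Y = fraction R c d" using ex by metis
    then show "X \<oplus>\<^bsub>?Q\<^esub> Y \<in> carrier ?Q" using N by (auto simp: add intro!: carr)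
    show "X \<oplus>\<^bsub>?Q\<^esub> Y = Y \<oplus>\<^bsub>?Q\<^esub> X" using * by (simp add: add m_ac a_ac)
    fix Z assume "Z \<in> carrier ?Q"
    then obtain e f where **: "e \<in> carrier R" "f \<in> ?N" "Z = fraction R e f" using ex by metis
    have "b \<otimes> d \<in> ?N" "d \<otimes> f \<in> ?N" using * ** N by auto
    then show "X \<oplus>\<^bsub>?Q\<^esub> Y \<oplus>\<^bsub>?Q\<^esub> Z = X \<oplus>\<^bsub>?Q\<^esub> (Y \<oplus>\<^bsub>?Q\<^esub> Z)"
      using * ** by (simp add: add l_distr r_distr m_ac a_ac)
  next
    show "\<zero>\<^bsub>?Q\<^esub> \<in> carrier ?Q" using oneN by (auto simp: zero intro!: carr)
  next
    fix X assume "X \<in> carrier ?Q"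
    then obtain a b where *: "a \<in> carrier R" "b \<in> ?N" "X = fraction R a b" using ex by metis
    show "\<zero>\<^bsub>?Q\<^esub> \<oplus>\<^bsub>?Q\<^esub> X = X" using * oneN by (simp add: zero add)
    have "fraction R (\<ominus> a) b \<oplus>\<^bsub>?Q\<^esub> X = \<zero>\<^bsub>?Q\<^esub>"
      using * N[of b b] by (simp add: zero add frac_eq l_minus l_neg)
    then show "\<exists>Y\<in>carrier ?Q. Y \<oplus>\<^bsub>?Q\<^esub> X = \<zero>\<^bsub>?Q\<^esub>" using * carr[of "\<ominus> a" b] by auto
  qed
  moreover have "comm_monoid ?Q"
  proof (rule comm_monoidI)
    fix X Y assume "X \<in> carrier ?Q" "Y \<in> carrier ?Q"
    then obtain a b c d where *: "a \<in> carrier R" "b \<in> ?N" "X = fraction R a b"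
      "c \<in> carrier R" "d \<in> ?N" "Y = fraction R c d" using ex by metis
    then show "X \<otimes>\<^bsub>?Q\<^esub> Y \<in> carrier ?Q" using N by (auto simp: mult intro!: carr)
    show "X \<otimes>\<^bsub>?Q\<^esub> Y = Y \<otimes>\<^bsub>?Q\<^esub> X" using * by (simp add: mult m_ac)
    fix Z assume "Z \<in> carrier ?Q"
    then obtain e f where **: "e \<in> carrier R" "f \<in> ?N" "Z = fraction R e f" using ex by metis
    have "b \<otimes> d \<in> ?N" "d \<otimes> f \<in> ?N" using * ** N by auto
    then show "X \<otimes>\<^bsub>?Q\<^esub> Y \<otimes>\<^bsub>?Q\<^esub> Z = X \<otimes>\<^bsub>?Q\<^esub> (Y \<otimes>\<^bsub>?Q\<^esub> Z)"
      using * ** by (simp add: mult m_ac)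
  next
    fix X assume "X \<in> carrier ?Q"
    then obtain a b where *: "a \<in> carrier R" "b \<in> ?N" "X = fraction R a b" using ex by metis
    show "\<one>\<^bsub>?Q\<^esub> \<otimes>\<^bsub>?Q\<^esub> X = X" using * oneN by (simp add: one mult)
  qed (use oneN in \<open>auto simp: one intro!: carr\<close>)
  moreover have "(X \<oplus>\<^bsub>?Q\<^esub> Y) \<otimes>\<^bsub>?Q\<^esub> Z = X \<otimes>\<^bsub>?Q\<^esub> Z \<oplus>\<^bsub>?Q\<^esub> Y \<otimes>\<^bsub>?Q\<^esub> Z"
    if "X \<in> carrier ?Q" "Y \<in> carrier ?Q" "Z \<in> carrier ?Q" for X Y Z
  proof -
    obtain a b where 1: "a \<in> carrier R" "b \<in> ?N" "X = fraction R a b" using ex \<open>X \<in> carrier ?Q\<close> by blast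
    obtain c d where 2: "c \<in> carrier R" "d \<in> ?N" "Y = fraction R c d" using ex \<open>Y \<in> carrier ?Q\<close> by blast
    obtain e f where 3: "e \<in> carrier R" "f \<in> ?N" "Z = fraction R e f" using ex \<open>Z \<in> carrier ?Q\<close> by blast
    have N': "b \<otimes> d \<in> ?N" "b \<otimes> f \<in> ?N" "d \<otimes> f \<in> ?N" "(b \<otimes> d) \<otimes> f \<in> ?N" "(b \<otimes> f) \<otimes> (d \<otimes> f) \<in> ?N"
      using 1(2) 2(2) 3(2) by (simp_all add: integral_iff)
    have c: "a \<in> carrier R" "b \<in> carrier R" "c \<in> carrier R" "d \<in> carrier R" "e \<in> carrier R" "f \<in> carrier R"
      using 1 2 3 by auto
    have "((a \<otimes> d \<oplus> c \<otimes> b) \<otimes> e) \<otimes> ((b \<otimes> f) \<otimes> (d \<otimes> f)) =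
        ((a \<otimes> e) \<otimes> (d \<otimes> f) \<oplus> (c \<otimes> e) \<otimes> (b \<otimes> f)) \<otimes> ((b \<otimes> d) \<otimes> f)"
      using c by (simp add: l_distr r_distr m_ac)
    then have "fraction R ((a \<otimes> d \<oplus> c \<otimes> b) \<otimes> e) ((b \<otimes> d) \<otimes> f) =
        fraction R ((a \<otimes> e) \<otimes> (d \<otimes> f) \<oplus> (c \<otimes> e) \<otimes> (b \<otimes> f)) ((b \<otimes> f) \<otimes> (d \<otimes> f))"
      using c N' by (subst frac_eq) simp_all
    moreover have "(X \<oplus>\<^bsub>?Q\<^esub> Y) \<otimes>\<^bsub>?Q\<^esub> Z = fraction R ((a \<otimes> d \<oplus> c \<otimes> b) \<otimes> e) ((b \<otimes> d) \<otimes> f)"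
      unfolding 1(3) 2(3) 3(3) add[OF 1(1,2) 2(1,2)] by (rule mult) (use c 3(2) N' in auto)
    moreover have "X \<otimes>\<^bsub>?Q\<^esub> Z \<oplus>\<^bsub>?Q\<^esub> Y \<otimes>\<^bsub>?Q\<^esub> Z =
        fraction R ((a \<otimes> e) \<otimes> (d \<otimes> f) \<oplus> (c \<otimes> e) \<otimes> (b \<otimes> f)) ((b \<otimes> f) \<otimes> (d \<otimes> f))"
      unfolding 1(3) 2(3) 3(3) mult[OF 1(1,2) 3(1,2)] mult[OF 2(1,2) 3(1,2)]
      by (rule add) (use c N' in auto)
    ultimately show ?thesis by simp
  qed
  ultimately have "cring ?Q" by (rule cringI)
  moreover have "\<zero>\<^bsub>?Q\<^esub> \<noteq> \<one>\<^bsub>?Q\<^esub>" using oneN by (simp add: zero one frac_eq)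
  moreover have "\<exists>Y\<in>carrier ?Q. X \<otimes>\<^bsub>?Q\<^esub> Y = \<one>\<^bsub>?Q\<^esub>" if "X \<in> carrier ?Q" "X \<noteq> \<zero>\<^bsub>?Q\<^esub>" for X
  proof -
    obtain a b where *: "a \<in> carrier R" "b \<in> ?N" "X = fraction R a b" using ex \<open>X \<in> carrier ?Q\<close> by blast
    have "a \<in> ?N" using * \<open>X \<noteq> \<zero>\<^bsub>?Q\<^esub>\<close> oneN by (auto simp: zero frac_eq)
    then have "X \<otimes>\<^bsub>?Q\<^esub> fraction R b a = \<one>\<^bsub>?Q\<^esub>"
      using * oneN N[of a b] by (auto simp: one mult frac_eq m_ac)
    then show ?thesis using * \<open>a \<in> ?N\<close> carr[of b a] by auto
  qed
  ultimately show ?thesis by (intro cring.cring_fieldI2) auto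
qed

section \<open>Tropical varieties\<close>

definition mdegree :: "('n::finite \<Rightarrow>\<^sub>0 nat) \<Rightarrow> nat" where
  "mdegree m = (\<Sum>i\<in>UNIV. Poly_Mapping.lookup m i)"

definition homogeneous :: "('n::finite, 'a::zero) mpoly \<Rightarrow> bool" where
  "homogeneous f \<longleftrightarrow> (\<exists>d. \<forall>m\<in>Poly_Mapping.keys f. mdegree m = d)"

definition hom_component :: "nat \<Rightarrow> ('n::finite, 'a::comm_ring_1) mpoly \<Rightarrow> ('n, 'a) mpoly" where
  "hom_component d f =
    (\<Sum>m | m \<in> Poly_Mapping.keys f \<and> mdegree m = d. Poly_Mapping.single m (Poly_Mapping.lookup f m))"

definition graded_ideal :: "('n::finite, 'a::comm_ring_1) mpoly set \<Rightarrow> bool" where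
  "graded_ideal I \<longleftrightarrow> ideal I type_ring \<and> (\<forall>f\<in>I. \<forall>d. hom_component d f \<in> I)"

definition hahn_const :: "'k::zero \<Rightarrow> 'k hahn" where
  "hahn_const c = hahn_monom c 0"

text \<open>The valuation; \<open>v(0) = \<infinity>\<close> makes zero coefficients irrelevant for the minimum \<open>W\<close> below, so
  the value at \<open>0\<close> is never used.\<close>

definition hahn_val :: "'k::zero hahn \<Rightarrow> real" where
  "hahn_val a = (LEAST \<nu>. hahn_coeff a \<nu> \<noteq> 0)"

definition trop_weight :: "real ^ 'n::finite \<Rightarrow> ('n, 'k::field hahn) mpoly \<Rightarrow> real" where
  "trop_weight \<omega> f = Min ((\<lambda>m. hahn_val (Poly_Mapping.lookup f m) +
     (\<Sum>i\<in>UNIV. \<omega> $ i * real (Poly_Mapping.lookup m i))) ` Poly_Mapping.keys f)"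

text \<open>The residue class of \<open>a\<close> with \<open>v(a) \<ge> 0\<close> is the coefficient of \<open>t\<^sup>0\<close>.\<close>

definition initial_form ::
    "real ^ 'n::finite \<Rightarrow> ('n, 'k::field hahn) mpoly \<Rightarrow> ('n, 'k) mpoly" where
  "initial_form \<omega> f = (if f = 0 then 0 else
     Poly_Mapping.map (\<lambda>a. hahn_coeff a 0)
       (mconst (hahn_monom 1 (- trop_weight \<omega> f)) *
        msubst mconst (\<lambda>i. mconst (hahn_monom 1 (\<omega> $ i)) * mvar i) f))"

definition initial_ideal ::
    "real ^ 'n::finite \<Rightarrow> ('n, 'k::field hahn) mpoly set \<Rightarrow> ('n, 'k) mpoly set" where
  "initial_ideal \<omega> I = Idl\<^bsub>type_ring\<^esub> (initial_form \<omega> ` I)"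

definition groebner_complex ::
    "('n::finite, 'k::field hahn) mpoly set \<Rightarrow> (real ^ 'n) set set" where
  "groebner_complex I = range (\<lambda>\<omega>. closure {\<omega>'. initial_ideal \<omega>' I = initial_ideal \<omega> I})"

definition tropical_set :: "('n::finite, 'k::field hahn) mpoly set \<Rightarrow> (real ^ 'n) set" where
  "tropical_set I = {\<omega>. \<forall>m. Poly_Mapping.single m 1 \<notin> initial_ideal \<omega> I}"

text \<open>As a polyhedral complex (a set of polyhedra), \<open>T(I)\<close> is the subcomplex of the Groebner complex
  with underlying set \<^term>\<open>tropical_set I\<close>: it consists of all cells contained in that set.\<close>

definition tropical_variety ::
    "('n::finite, 'k::field hahn) mpoly set \<Rightarrow> (real ^ 'n) set set" where
  "tropical_variety I = {P \<in> groebner_complex I. P \<subseteq> tropical_set I}"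

definition tropical_basis ::
    "('n::finite, 'k::field hahn) mpoly set \<Rightarrow> ('n, 'k hahn) mpoly set \<Rightarrow> bool" where
  "tropical_basis I B \<longleftrightarrow> finite B \<and> (\<forall>f\<in>B. homogeneous f) \<and> Idl\<^bsub>type_ring\<^esub> B = I \<and>
     tropical_set I = (\<Inter>f\<in>B. tropical_set (Idl\<^bsub>type_ring\<^esub> {f}))"

section \<open>Subvarieties of the general linear group\<close>

definition mat_eval :: "('k \<Rightarrow> 'a::comm_ring_1) \<Rightarrow> 'k ^ 'n ^ 'n \<Rightarrow> ('n::finite \<times> 'n, 'a) mpoly \<Rightarrow> 'a" where
  "mat_eval h g = msubst id (\<lambda>(i, j). h (g $ i $ j))"

definition GL_zariski :: "('k::field ^ 'n ^ 'n::finite) topology" where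
  "GL_zariski = topology (\<lambda>U. \<exists>F. U = {g. invertible g \<and> (\<exists>f\<in>F. mat_eval id g f \<noteq> 0)})"

lemma openin_GL_zariski:
  "openin GL_zariski U \<longleftrightarrow> (\<exists>F. U = {g :: 'k::field ^ 'n ^ 'n::finite. invertible g \<and> (\<exists>f\<in>F. mat_eval id g f \<noteq> 0)})"
proof -
  let ?D = "\<lambda>F. {g :: 'k ^ 'n ^ 'n. invertible g \<and> (\<exists>f\<in>F. mat_eval id g f \<noteq> 0)}"
  have "istopology (\<lambda>U. \<exists>F. U = ?D F)"
    unfolding istopology_def
  proof (intro conjI allI impI)
    fix S T assume "\<exists>F. S = ?D F" "\<exists>F. T = ?D F"
    then obtain F G where FG: "S = ?D F" "T = ?D G" by (elim exE)
    have "mat_eval id g (a * b) = mat_eval id g a * mat_eval id g b" for g :: "'k ^ 'n ^ 'n" and a b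
      unfolding mat_eval_def by (rule msubst_mult) auto
    then have "(\<exists>f\<in>{a * b |a b. a \<in> F \<and> b \<in> G}. mat_eval id g f \<noteq> 0) \<longleftrightarrow>
        (\<exists>a\<in>F. mat_eval id g a \<noteq> 0) \<and> (\<exists>b\<in>G. mat_eval id g b \<noteq> 0)" for g :: "'k ^ 'n ^ 'n"
      by auto (metis mult_eq_0_iff)
    then have "S \<inter> T = ?D {a * b |a b. a \<in> F \<and> b \<in> G}"
      unfolding FG by blast
    then show "\<exists>F. S \<inter> T = ?D F" by (rule exI)
  next
    fix \<K> assume "\<forall>K\<in>\<K>. \<exists>F. K = ?D F"
    from bchoice[OF this] obtain F where F0: "\<forall>K\<in>\<K>. K = ?D (F K)" by (elim exE)
    have F: "g \<in> K \<longleftrightarrow> invertible g \<and> (\<exists>f\<in>F K. mat_eval id g f \<noteq> 0)" if "K \<in> \<K>" for K g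
      using arg_cong[where f = "\<lambda>X. g \<in> X", OF bspec[OF F0 that]] unfolding mem_Collect_eq by assumption
    have "\<Union>\<K> = ?D (\<Union>K\<in>\<K>. F K)"
    proof (rule Set.set_eqI)
      fix g
      have "g \<in> \<Union>\<K> \<longleftrightarrow> (\<exists>K\<in>\<K>. invertible g \<and> (\<exists>f\<in>F K. mat_eval id g f \<noteq> 0))"
        using F by blast
      then show "g \<in> \<Union>\<K> \<longleftrightarrow> g \<in> ?D (\<Union>K\<in>\<K>. F K)" by simp
    qed
    then show "\<exists>F. \<Union>\<K> = ?D F" by (rule exI)
  qed
  then show ?thesis unfolding GL_zariski_def by (simp add: topology_inverse')
qed

lemma topspace_GL_zariski: "topspace GL_zariski = {g :: 'k::field ^ 'n ^ 'n::finite. invertible g}"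
proof
  show "topspace GL_zariski \<subseteq> {g :: 'k ^ 'n ^ 'n. invertible g}"
    unfolding topspace_def by (auto simp: openin_GL_zariski)
  have "mat_eval id g 1 = 1" for g :: "'k ^ 'n ^ 'n"
    using msubst_single[of id "\<lambda>(i, j). id (g $ i $ j)" 0 1] by (simp add: mat_eval_def single_one)
  then have "openin GL_zariski {g :: 'k ^ 'n ^ 'n. invertible g}"
    unfolding openin_GL_zariski by (intro exI[of _ "{1}"]) auto
  then show "{g :: 'k ^ 'n ^ 'n. invertible g} \<subseteq> topspace GL_zariski"
    by (rule openin_subset)
qed

definition GL_subvariety :: "('k::field ^ 'n ^ 'n::finite) set \<Rightarrow> bool" where
  "GL_subvariety V \<longleftrightarrow> V \<noteq> {} \<and> closedin GL_zariski V \<and>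
     (\<forall>A B. closedin GL_zariski A \<longrightarrow> closedin GL_zariski B \<longrightarrow> V \<subseteq> A \<union> B \<longrightarrow> V \<subseteq> A \<or> V \<subseteq> B)"

text \<open>The automorphism \<open>x\<^sub>i \<mapsto> \<Sum>\<^sub>j g\<^sub>j\<^sub>i x\<^sub>j\<close>; note the transposed indices.\<close>

definition GL_act :: "'k::field ^ 'n ^ 'n \<Rightarrow> ('n::finite, 'k hahn) mpoly \<Rightarrow> ('n, 'k hahn) mpoly" where
  "GL_act g = msubst mconst (\<lambda>i. \<Sum>j\<in>UNIV. mconst (hahn_const (g $ j $ i)) * mvar j)"

definition is_generic_tropical_variety ::
    "('k::field ^ 'n ^ 'n) set \<Rightarrow> ('n::finite, 'k hahn) mpoly set \<Rightarrow> (real ^ 'n) set set \<Rightarrow> bool" where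
  "is_generic_tropical_variety V I T \<longleftrightarrow>
     (\<exists>U. openin (subtopology GL_zariski V) U \<and> U \<noteq> {} \<and>
        (\<forall>g\<in>U. tropical_variety (GL_act g ` I) = T))"

lemma generic_tropical_variety_unique:
  assumes V: "GL_subvariety V"
    and "is_generic_tropical_variety V I T" "is_generic_tropical_variety V I T'"
  shows "T = T'"
proof -
  obtain U U' where U: "openin (subtopology GL_zariski V) U" "U \<noteq> {}"
      "\<And>g. g \<in> U \<Longrightarrow> tropical_variety (GL_act g ` I) = T"
    and U': "openin (subtopology GL_zariski V) U'" "U' \<noteq> {}"
      "\<And>g. g \<in> U' \<Longrightarrow> tropical_variety (GL_act g ` I) = T'"
    using assms unfolding is_generic_tropical_variety_def by metis
  obtain W W' where W: "openin GL_zariski W" "U = W \<inter> V" "openin GL_zariski W'" "U' = W' \<inter> V"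
    using U(1) U'(1) by (auto simp: openin_subtopology)
  have top: "V \<subseteq> topspace GL_zariski" using V by (simp add: GL_subvariety_def closedin_subset)
  have cl: "closedin GL_zariski (topspace GL_zariski - W)" "closedin GL_zariski (topspace GL_zariski - W')"
    using W by (auto intro: openin_closedin_eq[THEN iffD1, THEN conjunct2])
  have "\<not> V \<subseteq> topspace GL_zariski - W" "\<not> V \<subseteq> topspace GL_zariski - W'"
    using U(2) U'(2) W by auto
  then have "\<not> V \<subseteq> (topspace GL_zariski - W) \<union> (topspace GL_zariski - W')"
    using V cl unfolding GL_subvariety_def by blast
  then obtain g where "g \<in> U" "g \<in> U'" using top W by auto
  then show ?thesis using U(3) U'(3) by metis
qed

section \<open>Generic tropical bases\<close>

text \<open>The prime ideal \<open>\<pp>\<close> of \<open>V\<close> in \<open>K[Y]\<close>, where \<open>y\<^sub>i\<^sub>j\<close> is the variable with index \<open>(i, j)\<close>, and its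
  extension \<open>\<pp> L[Y]\<close>.\<close>

definition vanishing_ideal :: "('k::field ^ 'n ^ 'n) set \<Rightarrow> ('n::finite \<times> 'n, 'k) mpoly set" where
  "vanishing_ideal V = {f. \<forall>g\<in>V. mat_eval id g f = 0}"

definition vanishing_ideal_L :: "('k::field ^ 'n ^ 'n) set \<Rightarrow> ('n::finite \<times> 'n, 'k hahn) mpoly set" where
  "vanishing_ideal_L V = Idl\<^bsub>type_ring\<^esub> (Poly_Mapping.map hahn_const ` vanishing_ideal V)"

definition coord_ring :: "('k::field ^ 'n ^ 'n) set \<Rightarrow> ('n::finite \<times> 'n, 'k hahn) mpoly set ring" where
  "coord_ring V = type_ring Quot vanishing_ideal_L V"

definition coord_class ::
    "('k::field ^ 'n ^ 'n) set \<Rightarrow> ('n::finite \<times> 'n, 'k hahn) mpoly \<Rightarrow> ('n \<times> 'n, 'k hahn) mpoly set" where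
  "coord_class V a = vanishing_ideal_L V +>\<^bsub>type_ring\<^esub> a"

type_synonym ('n, 'k) function_field_elem =
  "(('n \<times> 'n, 'k hahn) mpoly set \<times> ('n \<times> 'n, 'k hahn) mpoly set) set"

definition function_field ::
    "('k::field ^ 'n ^ 'n) set \<Rightarrow> ('n::finite, 'k) function_field_elem ring" where
  "function_field V = frac_field (coord_ring V)"

definition rational_fun :: "('k::field ^ 'n ^ 'n) set \<Rightarrow> ('n::finite \<times> 'n, 'k hahn) mpoly \<Rightarrow>
    ('n \<times> 'n, 'k hahn) mpoly \<Rightarrow> ('n, 'k) function_field_elem" where
  "rational_fun V a b = fraction (coord_ring V) (coord_class V a) (coord_class V b)"

text \<open>The homomorphism \<open>y\<close> is the composition of \<open>S\<^sub>L \<rightarrow> L[Y][x\<^sub>1, \<dots>, x\<^sub>n]\<close>,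
  \<open>x\<^sub>i \<mapsto> \<Sum>\<^sub>j y\<^sub>j\<^sub>i x\<^sub>j\<close>, with the coefficientwise map \<open>L[Y] \<rightarrow> L[V] \<rightarrow> L(V)\<close>.\<close>

definition generic_map :: "('k::field ^ 'n ^ 'n) set \<Rightarrow> ('n::finite, 'k hahn) mpoly \<Rightarrow>
    (('n \<Rightarrow>\<^sub>0 nat) \<Rightarrow> ('n, 'k) function_field_elem)" where
  "generic_map V f = (\<lambda>m. rational_fun V
     (Poly_Mapping.lookup
       (msubst (\<lambda>c. mconst (mconst c)) (\<lambda>i. \<Sum>j\<in>UNIV. mconst (mvar (j, i)) * mvar j) f) m) 1)"

definition generic_ideal :: "('k::field ^ 'n ^ 'n) set \<Rightarrow> ('n::finite, 'k hahn) mpoly set \<Rightarrow>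
    (('n \<Rightarrow>\<^sub>0 nat) \<Rightarrow> ('n, 'k) function_field_elem) set" where
  "generic_ideal V I = Idl\<^bsub>mpoly_ring (function_field V)\<^esub> (generic_map V ` I)"

text \<open>\<open>rational_value V g c v\<close>: the rational function \<open>c \<in> L(V)\<close> can be written as a quotient \<open>a/b\<close> with
  \<open>b(g) \<noteq> 0\<close> and has the value \<open>v = a(g)/b(g)\<close> at \<open>g\<close>; for \<open>g \<in> V\<close> this determines \<open>v\<close>.\<close>

definition rational_value :: "('k::field ^ 'n ^ 'n) set \<Rightarrow> 'k ^ 'n ^ 'n \<Rightarrow>
    ('n::finite, 'k) function_field_elem \<Rightarrow> 'k hahn \<Rightarrow> bool" where
  "rational_value V g c v \<longleftrightarrow> (\<exists>a b. c = rational_fun V a b \<and> mat_eval hahn_const g b \<noteq> 0 \<and>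
     v = mat_eval hahn_const g a / mat_eval hahn_const g b)"

definition defined_at :: "('k::field ^ 'n ^ 'n) set \<Rightarrow> 'k ^ 'n ^ 'n \<Rightarrow>
    (('n \<Rightarrow>\<^sub>0 nat) \<Rightarrow> ('n::finite, 'k) function_field_elem) \<Rightarrow> bool" where
  "defined_at V g F \<longleftrightarrow> (\<forall>m. \<exists>v. rational_value V g (F m) v)"

definition specialize :: "('k::field ^ 'n ^ 'n) set \<Rightarrow> 'k ^ 'n ^ 'n \<Rightarrow>
    (('n \<Rightarrow>\<^sub>0 nat) \<Rightarrow> ('n::finite, 'k) function_field_elem) \<Rightarrow> ('n, 'k hahn) mpoly" where
  "specialize V g F = Abs_poly_mapping (\<lambda>m. THE v. rational_value V g (F m) v)"

definition generic_tropical_basis :: "('k::field ^ 'n ^ 'n) set \<Rightarrow> ('n::finite, 'k hahn) mpoly set \<Rightarrow>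
    (('n \<Rightarrow>\<^sub>0 nat) \<Rightarrow> ('n, 'k) function_field_elem) set \<Rightarrow> bool" where
  "generic_tropical_basis V I \<F> \<longleftrightarrow> finite \<F> \<and> \<F> \<subseteq> generic_ideal V I \<and>
     (\<exists>U. openin (subtopology GL_zariski V) U \<and> U \<noteq> {} \<and>
        (\<forall>g\<in>U. (\<forall>F\<in>\<F>. defined_at V g F) \<and> tropical_basis (GL_act g ` I) (specialize V g ` \<F>)) \<and>
        (\<forall>F\<in>\<F>. \<forall>g\<in>U. \<forall>g'\<in>U. tropical_variety (Idl\<^bsub>type_ring\<^esub> {specialize V g F}) =
           tropical_variety (Idl\<^bsub>type_ring\<^esub> {specialize V g' F})))"

end

theory Submission
  imports Defs
begin

text \<open>Initial ideals are studied one degree at a time. Let \<open>W\<close> be the part of degree \<open>d\<close> of a graded ideal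
  of \<open>S\<^sub>L\<close>. The residues at \<open>\<omega>\<close> of the elements of \<open>W\<close> form a \<open>K\<close>-vector space of the same dimension,
  which is the part of degree \<open>d\<close> of the initial ideal. It is controlled by the pivot sets \<open>J\<close> of \<open>W\<close>, the bases
  of its matroid of coordinates: for \<open>j \<in> J\<close> there is, up to a factor, one form \<open>F\<^sub>J\<^sub>j \<in> W\<close> that
  vanishes on \<open>J - {j}\<close>. The set \<open>J\<close> is a pivot set of the initial space if and only if each \<open>F\<^sub>J\<^sub>j\<close> attains
  its weight at \<open>j\<close>, and then the initial forms of the \<open>F\<^sub>J\<^sub>j\<close> are a basis of the initial space. Hence the
  valuations of the coefficients of finitely many forms decide whether two initial spaces are equal and which
  monomials an initial space contains (locale \<open>pivot_forms\<close>).

  These valuations are generically constant. The entries of \<open>g\<close> have valuation \<open>0\<close>, so the valuation of \<open>h(g)\<close>,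
  for \<open>h \<in> L[Y]\<close>, is generically the least exponent of \<open>t\<close> whose coefficient in \<open>K[Y]\<close> does not vanish on all of \<open>V\<close>
  (\<open>generic_valuation\<close>); as \<open>V\<close> is irreducible, finitely many generic conditions hold together on a non-empty
  open set. Elimination without division provides the forms \<open>F\<^sub>J\<^sub>j\<close> for all \<open>g(I)\<close> at once, as
  elements of the ideal of \<open>L[Y][x]\<close> generated by \<open>y(I)\<close> (\<open>generic_pivot_forms_exist\<close>).

  Finitely many degrees suffice for all \<open>\<omega>\<close> and all \<open>g\<close>, because all ideals \<open>in\<^sub>\<omega>(g(I))\<close> have the Hilbert
  function of \<open>I\<close>. Only finitely many monomial ideals have a given Hilbert function
  (\<open>finite_monomial_ideals\<close>). Passing to leading monomials, one obtains a degree \<open>D\<close> such that every graded ideal with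
  this Hilbert function is generated in degree at most \<open>D\<close> and, if it contains a monomial, contains one of
  degree at most \<open>D\<close> (\<open>uniform_generation_bound\<close>, \<open>uniform_monomial_bound\<close>).

  So the Groebner complex and the tropical variety of \<open>g(I)\<close> are generically constant, and the forms \<open>F\<^sub>J\<^sub>j\<close> of
  degree at most \<open>D\<close> specialize to a tropical basis of \<open>g(I)\<close>: they contain a vector space basis of \<open>g(I)\<close> in every such degree,
  and a monomial in \<open>in\<^sub>\<omega>(g(I))\<close> is, up to a constant, the initial form of one of them
  (\<open>generic_tropical_structure\<close>). The principal ideals \<open>(F\<^sub>J\<^sub>j(g))\<close> again form a family with constant
  Hilbert function, so the same theorem shows that their tropical varieties are generically constant.\<close>

abbreviation coef :: "('a \<Rightarrow>\<^sub>0 'b::zero) \<Rightarrow> 'a \<Rightarrow> 'b" where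
  "coef \<equiv> Poly_Mapping.lookup"

abbreviation keys :: "('a \<Rightarrow>\<^sub>0 'b::zero) \<Rightarrow> 'a set" where
  "keys \<equiv> Poly_Mapping.keys"

abbreviation single :: "'a \<Rightarrow> 'b::zero \<Rightarrow> 'a \<Rightarrow>\<^sub>0 'b" where
  "single \<equiv> Poly_Mapping.single"

section \<open>Monomial ideals with a prescribed Hilbert function\<close>

definition monomial_ideal :: "('n \<Rightarrow>\<^sub>0 nat) set \<Rightarrow> bool" where
  "monomial_ideal N \<longleftrightarrow> (\<forall>m\<in>N. \<forall>u. m + u \<in> N)"

definition mons :: "nat \<Rightarrow> ('n::finite \<Rightarrow>\<^sub>0 nat) set" where
  "mons d = {m. mdegree m = d}"

lemma mem_mons [simp]: "m \<in> mons d \<longleftrightarrow> mdegree m = d"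
  by (simp add: mons_def)

lemma mdegree_add [simp]: "mdegree (m + u) = mdegree m + mdegree u"
  by (simp add: mdegree_def lookup_add sum.distrib)

lemma mdegree_0 [simp]: "mdegree 0 = 0"
  by (simp add: mdegree_def)

lemma finite_mdegree_le: "finite {m :: 'n::finite \<Rightarrow>\<^sub>0 nat. mdegree m \<le> d}"
proof -
  have "coef m i \<le> d" if "mdegree m \<le> d" for m :: "'n \<Rightarrow>\<^sub>0 nat" and i
    using that member_le_sum[of i UNIV "coef m"] by (simp add: mdegree_def)
  then have "coef ` {m :: 'n \<Rightarrow>\<^sub>0 nat. mdegree m \<le> d} \<subseteq> Pi\<^sub>E UNIV (\<lambda>i. {..d})"
    by auto
  then have "finite (coef ` {m :: 'n \<Rightarrow>\<^sub>0 nat. mdegree m \<le> d})"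
    by (rule finite_subset) (rule finite_PiE; simp)
  then show ?thesis by (rule finite_imageD) (meson inj_onI lookup_inject)
qed

lemma finite_mons [simp]: "finite (mons d :: ('n::finite \<Rightarrow>\<^sub>0 nat) set)"
  by (rule finite_subset[OF _ finite_mdegree_le[of d]]) auto

lemma diff_add_monomial:
  fixes m u :: "'n \<Rightarrow>\<^sub>0 nat"
  assumes "\<And>i. coef u i \<le> coef m i"
  shows "u + (m - u) = m"
  by (rule poly_mapping_eqI) (simp add: lookup_add lookup_minus assms)

lemma nat_seq_incseq_subseq:
  fixes s :: "nat \<Rightarrow> nat"
  obtains r :: "nat \<Rightarrow> nat" where "strict_mono r" "incseq (s \<circ> r)"
proof -
  have "well_ordered (real ` UNIV)"
    unfolding well_ordered_def
  proof (intro allI impI)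
    fix B assume "B \<subseteq> range real" "B \<noteq> {}"
    then obtain k where "real k \<in> B" by blast
    from exists_least_iff[THEN iffD1, OF exI[of "\<lambda>k. real k \<in> B", OF this]]
    obtain l where "real l \<in> B" "\<And>k. k < l \<Longrightarrow> real k \<notin> B" by blast
    then show "\<exists>m\<in>B. \<forall>b\<in>B. m \<le> b"
      using \<open>B \<subseteq> range real\<close> by (intro bexI[of _ "real l"]) (force intro: leI)+
  qed
  then obtain r :: "nat \<Rightarrow> nat" where "strict_mono r" "incseq ((\<lambda>n. real (s n)) \<circ> r)"
    using well_ordered_incseq[of "range real" "\<lambda>n. real (s n)"] by blast
  then show thesis using that[of r] by (simp add: incseq_def)
qed

text \<open>Dickson's lemma, in the form that every sequence of monomials has a subsequence that increases
  for divisibility: refine it once for each variable.\<close>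

lemma monomial_seq_incseq_subseq:
  fixes s :: "nat \<Rightarrow> 'n::finite \<Rightarrow>\<^sub>0 nat"
  obtains r :: "nat \<Rightarrow> nat" where "strict_mono r" "\<And>i. incseq (\<lambda>k. coef (s (r k)) i)"
proof -
  have "\<exists>r :: nat \<Rightarrow> nat. strict_mono r \<and> (\<forall>i\<in>A. incseq (\<lambda>k. coef (s (r k)) i))" for A :: "'n set"
  proof (induction A rule: infinite_finite_induct)
    case (infinite A) then show ?case by simp
  next
    case empty then show ?case by (intro exI[of _ id]) (simp add: strict_mono_def)
  next
    case (insert a A)
    then obtain r :: "nat \<Rightarrow> nat" where r: "strict_mono r" "\<And>i. i \<in> A \<Longrightarrow> incseq (\<lambda>k. coef (s (r k)) i)"
      by blast
    obtain q :: "nat \<Rightarrow> nat" where q: "strict_mono q" "incseq ((\<lambda>k. coef (s (r k)) a) \<circ> q)"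
      by (rule nat_seq_incseq_subseq)
    have "strict_mono (r \<circ> q)" using r(1) q(1) by (simp add: strict_mono_def)
    moreover have "incseq (\<lambda>k. coef (s ((r \<circ> q) k)) i)" if "i \<in> insert a A" for i
    proof (cases "i = a")
      case True then show ?thesis using q(2) by (simp add: comp_def)
    next
      case False
      then have "incseq (\<lambda>k. coef (s (r k)) i)" using that r(2) by blast
      then show ?thesis using strict_mono_less_eq[OF q(1)] by (simp add: incseq_def)
    qed
    ultimately show ?case by blast
  qed
  from this[of UNIV] show thesis using that by auto
qed

definition generated_within :: "nat \<Rightarrow> ('n::finite \<Rightarrow>\<^sub>0 nat) set \<Rightarrow> bool" where
  "generated_within D N \<longleftrightarrow> (\<forall>m\<in>N. \<exists>u\<in>N. \<exists>w. mdegree u \<le> D \<and> m = u + w)"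

lemma generated_within_mono: "generated_within D N \<Longrightarrow> D \<le> E \<Longrightarrow> generated_within E N"
  unfolding generated_within_def by (meson order_trans)

text \<open>Otherwise there would be a sequence in \<open>N\<close> whose \<open>D\<close>-th member is not divisible by any member of \<open>N\<close> of degree
  at most \<open>D\<close>; but its first member along an increasing subsequence divides all later ones.\<close>

lemma monomial_set_generated_within: "\<exists>D. generated_within D (N :: ('n::finite \<Rightarrow>\<^sub>0 nat) set)"
proof (rule ccontr)
  assume "\<nexists>D. generated_within D N"
  then have "\<forall>D. \<exists>m\<in>N. \<forall>u\<in>N. mdegree u \<le> D \<longrightarrow> (\<forall>w. m \<noteq> u + w)"
    unfolding generated_within_def by blast
  then obtain s where s: "\<And>D. s D \<in> N" "\<And>D u w. u \<in> N \<Longrightarrow> mdegree u \<le> D \<Longrightarrow> s D \<noteq> u + w" by metis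
  obtain r :: "nat \<Rightarrow> nat" where r: "strict_mono r" "\<And>i. incseq (\<lambda>k. coef (s (r k)) i)"
    using monomial_seq_incseq_subseq[of s] by blast
  define k where "k = mdegree (s (r 0))"
  have "mdegree (s (r 0)) \<le> r k" using seq_suble[OF r(1)] by (simp add: k_def)
  moreover have "s (r k) = s (r 0) + (s (r k) - s (r 0))"
    by (rule diff_add_monomial[symmetric]) (use r(2) in \<open>auto simp: incseq_def\<close>)
  ultimately show False using s by blast
qed

definition monomial_ideals :: "(nat \<Rightarrow> nat) \<Rightarrow> ('n::finite \<Rightarrow>\<^sub>0 nat) set set" where
  "monomial_ideals h = {N. monomial_ideal N \<and> (\<forall>d. card (N \<inter> mons d) = h d)}"

text \<open>If there were infinitely many, then by Koenig's lemma there would be a monomial ideal \<open>M\<close> each of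
  whose truncations is shared by infinitely many of them. As \<open>M\<close> is finitely generated, infinitely many
  of them contain \<open>M\<close>, and having the same Hilbert function as \<open>M\<close> they are all equal to \<open>M\<close>.\<close>

lemma finite_monomial_ideals: "finite (monomial_ideals h :: ('n::finite \<Rightarrow>\<^sub>0 nat) set set)"
proof (rule ccontr)
  let ?X = "monomial_ideals h :: ('n \<Rightarrow>\<^sub>0 nat) set set"
  let ?tr = "\<lambda>d N. N \<inter> {m :: 'n \<Rightarrow>\<^sub>0 nat. mdegree m \<le> d}"
  assume inf: "infinite ?X"
  have pick: "\<exists>T. infinite {N \<in> Y. ?tr d N = T}" if "infinite Y" for Y d
  proof -
    have "?tr d ` Y \<subseteq> Pow {m :: 'n \<Rightarrow>\<^sub>0 nat. mdegree m \<le> d}" by blast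
    then have "finite (?tr d ` Y)" by (rule finite_subset) (simp add: finite_mdegree_le)
    from pigeonhole_infinite[OF that this] show ?thesis by blast
  qed
  have "\<exists>T. \<forall>d. infinite {N \<in> ?X. ?tr d N = T d} \<and> ?tr d (T (Suc d)) = T d"
  proof (rule dependent_nat_choice)
    show "\<exists>T. infinite {N \<in> ?X. ?tr 0 N = T}" using pick[OF inf] by blast
  next
    fix T d assume "infinite {N \<in> ?X. ?tr d N = T}"
    from pick[OF this, of "Suc d"] obtain T' where
      T': "infinite {N \<in> {N \<in> ?X. ?tr d N = T}. ?tr (Suc d) N = T'}" by blast
    from infinite_imp_nonempty[OF this] obtain N where N: "?tr d N = T" "?tr (Suc d) N = T'"
      by blast
    have "?tr d T' = T" unfolding N(1)[symmetric] N(2)[symmetric] by auto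
    moreover have "infinite {N \<in> ?X. ?tr (Suc d) N = T'}"
      by (rule infinite_super[OF _ T']) blast
    ultimately show "\<exists>T'. infinite {N \<in> ?X. ?tr (Suc d) N = T'} \<and> ?tr d T' = T" by blast
  qed
  then obtain T where T: "\<And>d. infinite {N \<in> ?X. ?tr d N = T d}" "\<And>d. ?tr d (T (Suc d)) = T d"
    by blast
  define M where "M = (\<Union>d. T d)"
  have ex: "\<exists>N\<in>?X. ?tr d N = T d" for d
    using infinite_imp_nonempty[OF T(1)[of d]] by blast
  have T_le: "mdegree m \<le> d" if "m \<in> T d" for m d
    using that unfolding T(2)[of d, symmetric] by simp
  have T_Suc: "m \<in> T d \<longleftrightarrow> m \<in> T (Suc d)" if "mdegree m \<le> d" for m d
    using that unfolding T(2)[of d, symmetric] by simp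
  have T_eq: "m \<in> T d \<longleftrightarrow> m \<in> T (d + k)" if "mdegree m \<le> d" for m d k
  proof (induction k)
    case (Suc k) then show ?case using T_Suc[of m "d + k"] that by simp
  qed simp
  have M_T: "m \<in> M \<longleftrightarrow> m \<in> T d" if m: "mdegree m \<le> d" for m d
  proof
    assume "m \<in> M"
    then obtain e where e: "m \<in> T e" by (auto simp: M_def)
    then have "m \<in> T (d + e)" using T_eq[OF T_le[OF e], of d] by (simp add: add.commute)
    then show "m \<in> T d" using T_eq[OF m, of e] by simp
  qed (auto simp: M_def)
  have M_N: "m \<in> M \<longleftrightarrow> m \<in> N" if "?tr d N = T d" "mdegree m \<le> d" for m d N
    using that(2) M_T[of m d] unfolding that(1)[symmetric] by simp
  obtain D where D: "generated_within D M" using monomial_set_generated_within by blast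
  have "N = M" if N: "N \<in> ?X" "?tr D N = T D" for N
  proof -
    have sub: "M \<subseteq> N"
    proof
      fix m assume "m \<in> M"
      then obtain u w where "u \<in> M" "mdegree u \<le> D" "m = u + w"
        using D unfolding generated_within_def by blast
      then show "m \<in> N" using N(1) M_N[OF N(2), of u] by (simp add: monomial_ideals_def monomial_ideal_def)
    qed
    have N_d: "N \<inter> mons d = M \<inter> mons d" for d
    proof (rule card_subset_eq[symmetric])
      obtain N' where N': "N' \<in> ?X" "?tr d N' = T d" using ex by blast
      have "M \<inter> mons d = N' \<inter> mons d" using M_N[OF N'(2)] by (intro Set.set_eqI) auto
      then show "card (M \<inter> mons d) = card (N \<inter> mons d)"
        using N(1) N'(1) by (simp add: monomial_ideals_def)
    qed (use sub in auto)
    show "N = M"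
    proof (rule Set.set_eqI)
      fix m show "m \<in> N \<longleftrightarrow> m \<in> M" using N_d[of "mdegree m"] by (auto simp: set_eq_iff)
    qed
  qed
  then have "{N \<in> ?X. ?tr D N = T D} \<subseteq> {M}" by blast
  then show False using T(1)[of D] finite_subset by blast
qed

lemma monomial_ideals_generated_within:
  assumes "finite H"
  obtains D where "\<And>h (N :: ('n::finite \<Rightarrow>\<^sub>0 nat) set). h \<in> H \<Longrightarrow> N \<in> monomial_ideals h \<Longrightarrow> generated_within D N"
proof -
  let ?X = "\<Union>h\<in>H. monomial_ideals h :: ('n \<Rightarrow>\<^sub>0 nat) set set"
  have fin: "finite ?X" using assms finite_monomial_ideals by blast
  obtain d where d: "\<And>N :: ('n \<Rightarrow>\<^sub>0 nat) set. generated_within (d N) N"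
    using monomial_set_generated_within by metis
  show thesis
  proof (rule that[of "\<Sum>N\<in>?X. d N"])
    fix h N assume "h \<in> H" "N \<in> (monomial_ideals h :: ('n \<Rightarrow>\<^sub>0 nat) set set)"
    then have "d N \<le> (\<Sum>N\<in>?X. d N)" using fin by (intro member_le_sum) auto
    then show "generated_within (\<Sum>N\<in>?X. d N) N" using d generated_within_mono by blast
  qed
qed

section \<open>Pivot sets of spaces of polynomials\<close>

lemma coef_mconst_mult [simp]: "coef (mconst c * f) m = c * coef (f :: ('n, 'a::comm_ring_1) mpoly) m"
  unfolding mconst_def mult_map_scale_conv_mult[symmetric] by (auto simp: Poly_Mapping.map.rep_eq when_def)

lemma mconst_0 [simp]: "mconst 0 = 0" and mconst_1 [simp]: "mconst 1 = 1"
  by (simp_all add: mconst_def)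

lemma mconst_add: "mconst (a + b) = mconst a + mconst b"
  by (simp add: mconst_def single_add)

lemma mconst_mult: "mconst (a * b) = mconst a * mconst (b :: 'a::comm_ring_1)"
  by (simp add: mconst_def mult_single)

interpretation mpoly_vs: vector_space "\<lambda>(c :: 'a::field) (f :: ('n, 'a) mpoly). mconst c * f"
  by standard (simp_all add: mconst_add mconst_mult algebra_simps)

text \<open>The coordinates \<open>J\<close> form a pivot set of \<open>P\<close> if restriction to \<open>J\<close> is an isomorphism onto the
  coordinate space with index set \<open>J\<close>; in matroid terms, \<open>J\<close> is a basis of the matroid of \<open>P\<close>. Pivot sets replace Pluecker
  coordinates in what follows.\<close>

definition pivot_set :: "('n, 'a::comm_ring_1) mpoly set \<Rightarrow> ('n \<Rightarrow>\<^sub>0 nat) set \<Rightarrow> bool" where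
  "pivot_set P J \<longleftrightarrow> (\<forall>f\<in>P. (\<forall>j\<in>J. coef f j = 0) \<longrightarrow> f = 0) \<and>
     (\<forall>j\<in>J. \<exists>f\<in>P. \<forall>i\<in>J. coef f i = (if i = j then 1 else 0))"

lemma pivot_setI:
  assumes "\<And>f. f \<in> P \<Longrightarrow> \<forall>j\<in>J. coef f j = 0 \<Longrightarrow> f = 0"
    and "\<And>j. j \<in> J \<Longrightarrow> \<exists>f\<in>P. \<forall>i\<in>J. coef f i = (if i = j then 1 else 0)"
  shows "pivot_set P J"
  unfolding pivot_set_def using assms by simp

lemma pivot_set_zero: "pivot_set P J \<Longrightarrow> f \<in> P \<Longrightarrow> \<forall>j\<in>J. coef f j = 0 \<Longrightarrow> f = 0"
  by (simp add: pivot_set_def)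

lemma pivot_set_basis:
  assumes "pivot_set P J"
  obtains b where "\<And>j. j \<in> J \<Longrightarrow> b j \<in> P"
    "\<And>j i. j \<in> J \<Longrightarrow> i \<in> J \<Longrightarrow> coef (b j) i = (if i = j then 1 else 0)"
proof -
  have "\<forall>j\<in>J. \<exists>f. f \<in> P \<and> (\<forall>i\<in>J. coef f i = (if i = j then 1 else 0))"
    using assms unfolding pivot_set_def by blast
  then show thesis using that by metis
qed

lemma pivot_expansion:
  fixes P :: "('n, 'a::field) mpoly set"
  assumes "mpoly_vs.subspace P" "finite J" "\<And>f. f \<in> P \<Longrightarrow> (\<forall>j\<in>J. coef f j = 0) \<Longrightarrow> f = 0"
    and b: "\<And>j. j \<in> J \<Longrightarrow> b j \<in> P" "\<And>j i. j \<in> J \<Longrightarrow> i \<in> J \<Longrightarrow> coef (b j) i = (if i = j then 1 else 0)"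
    and f: "f \<in> P"
  shows "f = (\<Sum>j\<in>J. mconst (coef f j) * b j)"
proof -
  let ?g = "f - (\<Sum>j\<in>J. mconst (coef f j) * b j)"
  have "?g \<in> P"
    by (intro mpoly_vs.subspace_diff[OF assms(1)] mpoly_vs.subspace_sum[OF assms(1)]
        mpoly_vs.subspace_scale[OF assms(1)] b(1) f)
  moreover have "\<forall>i\<in>J. coef ?g i = 0"
    using assms(2) by (simp add: b(2) lookup_minus lookup_sum if_distrib cong: if_cong)
  ultimately have "?g = 0" by (rule assms(3))
  then show ?thesis by simp
qed

lemma pivot_set_dim:
  fixes P :: "('n, 'a::field) mpoly set"
  assumes sub: "mpoly_vs.subspace P" and fin: "finite J" and J: "pivot_set P J"
  shows "mpoly_vs.dim P = card J"
proof -
  obtain b where b: "\<And>j. j \<in> J \<Longrightarrow> b j \<in> P"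
      "\<And>j i. j \<in> J \<Longrightarrow> i \<in> J \<Longrightarrow> coef (b j) i = (if i = j then 1 else 0)"
    using pivot_set_basis[OF J] by metis
  have inj: "inj_on b J" by (rule inj_onI) (metis b(2) zero_neq_one)
  show ?thesis
  proof (rule mpoly_vs.dim_unique[of "b ` J"])
    show "P \<subseteq> mpoly_vs.span (b ` J)"
    proof
      fix f assume f: "f \<in> P"
      have "f = (\<Sum>j\<in>J. mconst (coef f j) * b j)"
        by (rule pivot_expansion[OF sub fin]) (rule f b pivot_set_zero[OF J] | assumption)+
      also have "\<dots> \<in> mpoly_vs.span (b ` J)"
        by (intro mpoly_vs.span_sum mpoly_vs.span_scale mpoly_vs.span_base imageI)
      finally show "f \<in> mpoly_vs.span (b ` J)" .
    qed
    show "\<not> mpoly_vs.dependent (b ` J)"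
    proof (rule mpoly_vs.independent_if_scalars_zero)
      fix c x assume c: "(\<Sum>x\<in>b ` J. mconst (c x) * x) = 0" and "x \<in> b ` J"
      then obtain i where i: "i \<in> J" "x = b i" by blast
      have "0 = coef (\<Sum>j\<in>J. mconst (c (b j)) * b j) i" using c by (simp add: sum.reindex[OF inj])
      also have "\<dots> = c x" using i fin by (simp add: b(2) lookup_sum if_distrib cong: if_cong)
      finally show "c x = 0" by simp
    qed (use fin in simp)
    show "card (b ` J) = card J" by (rule card_image[OF inj])
  qed (use b in auto)
qed

text \<open>An inclusion-minimal set of coordinates that separates the elements of \<open>P\<close> is a pivot set: as \<open>j\<close>
  cannot be removed, some nonzero element vanishes on \<open>J - {j}\<close>, and a multiple of it has entry \<open>1\<close> at \<open>j\<close>.\<close>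

lemma pivot_subset_exists:
  fixes P :: "('n, 'a::field) mpoly set"
  assumes "mpoly_vs.subspace P" "finite J" "\<forall>f\<in>P. (\<forall>j\<in>J. coef f j = 0) \<longrightarrow> f = 0"
  shows "\<exists>J'\<subseteq>J. pivot_set P J'"
  using assms(2,3)
proof (induction J rule: finite_psubset_induct)
  case (psubset J)
  define Q where "Q j \<longleftrightarrow> (\<forall>f\<in>P. (\<forall>i\<in>J - {j}. coef f i = 0) \<longrightarrow> f = 0)" for j
  show ?case
  proof (cases "\<exists>j\<in>J. Q j")
    case True
    then obtain j where j: "j \<in> J" "Q j" by blast
    have "J - {j} \<subset> J" using j(1) by blast
    from psubset.IH[OF this j(2)[unfolded Q_def]] show ?thesis by blast
  next
    case False
    have "\<exists>f\<in>P. \<forall>i\<in>J. coef f i = (if i = j then 1 else 0)" if j: "j \<in> J" for j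
    proof -
      have "\<not> Q j" using False j by blast
      then obtain f where f: "f \<in> P" "\<forall>i\<in>J - {j}. coef f i = 0" "f \<noteq> 0"
        unfolding Q_def by blast
      have "coef f j \<noteq> 0"
      proof
        assume "coef f j = 0"
        with f(2) have "\<forall>i\<in>J. coef f i = 0" by auto
        with bspec[OF psubset.prems f(1)] have "f = 0" by (rule mp)
        with f(3) show False by (rule notE)
      qed
      then have "\<forall>i\<in>J. coef (mconst (inverse (coef f j)) * f) i = (if i = j then 1 else 0)" using f(2) by simp
      with mpoly_vs.subspace_scale[OF assms(1) f(1)] show ?thesis by (rule bexI[rotated])
    qed
    then have "\<forall>j\<in>J. \<exists>f\<in>P. \<forall>i\<in>J. coef f i = (if i = j then 1 else 0)" by (rule ballI)
    with psubset.prems have "pivot_set P J" unfolding pivot_set_def by (rule conjI)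
    then show ?thesis by blast
  qed
qed

lemma pivot_set_if_card_eq_dim:
  fixes P :: "('n, 'a::field) mpoly set"
  assumes "mpoly_vs.subspace P" "finite J" "\<And>f. f \<in> P \<Longrightarrow> (\<forall>j\<in>J. coef f j = 0) \<Longrightarrow> f = 0"
    and "card J = mpoly_vs.dim P"
  shows "pivot_set P J"
proof -
  have "\<forall>f\<in>P. (\<forall>j\<in>J. coef f j = 0) \<longrightarrow> f = 0" by (intro ballI impI, rule assms(3))
  from pivot_subset_exists[OF assms(1,2) this] obtain J' where J': "J' \<subseteq> J" "pivot_set P J'" by blast
  then have "card J' = card J"
    using pivot_set_dim[OF assms(1) _ J'(2)] assms(2,4) finite_subset by metis
  then have "J' = J" using J'(1) assms(2) card_subset_eq by blast
  then show ?thesis using J'(2) by simp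
qed

section \<open>Graded ideals and their leading monomials\<close>

lemma ideal_type_ring_iff:
  "ideal I (type_ring :: 'a::comm_ring_1 ring) \<longleftrightarrow>
    0 \<in> I \<and> (\<forall>f\<in>I. \<forall>g\<in>I. f + g \<in> I) \<and> (\<forall>f\<in>I. \<forall>q. q * f \<in> I)"
proof
  assume "ideal I (type_ring :: 'a ring)"
  then interpret ideal I "type_ring :: 'a ring" .
  have "0 \<in> I" using additive_subgroup.zero_closed[OF is_additive_subgroup] by simp
  moreover have "f + g \<in> I" if "f \<in> I" "g \<in> I" for f g
    using additive_subgroup.a_closed[OF is_additive_subgroup that] by simp
  moreover have "q * f \<in> I" if "f \<in> I" for f q
    using I_l_closed[OF that, of q] by simp
  ultimately show "0 \<in> I \<and> (\<forall>f\<in>I. \<forall>g\<in>I. f + g \<in> I) \<and> (\<forall>f\<in>I. \<forall>q. q * f \<in> I)"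
    by blast
next
  assume *: "0 \<in> I \<and> (\<forall>f\<in>I. \<forall>g\<in>I. f + g \<in> I) \<and> (\<forall>f\<in>I. \<forall>q. q * f \<in> I)"
  interpret cring "type_ring :: 'a ring" by (rule cring_type_ring)
  have neg: "inv\<^bsub>add_monoid type_ring\<^esub> f = - f" for f :: 'a
    unfolding a_inv_def[symmetric] by (rule minus_equality) simp_all
  have "- f \<in> I" if "f \<in> I" for f using * that by (metis mult_minus_left mult_1_left)
  then have "subgroup I (add_monoid (type_ring :: 'a ring))"
    using * by (intro subgroup.intro) (simp_all only: neg, simp_all)
  then show "ideal I (type_ring :: 'a ring)"
    by (rule idealI[OF ring_axioms]) (use * in \<open>simp_all add: mult.commute\<close>)
qed

lemma ideal_type_ringD:
  assumes "ideal I (type_ring :: 'a::comm_ring_1 ring)"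
  shows "0 \<in> I" "\<And>f g. f \<in> I \<Longrightarrow> g \<in> I \<Longrightarrow> f + g \<in> I" "\<And>f q. f \<in> I \<Longrightarrow> q * f \<in> I"
  using assms unfolding ideal_type_ring_iff by blast+

lemma ideal_genideal: "ideal (Idl\<^bsub>type_ring\<^esub> S) (type_ring :: 'a::comm_ring_1 ring)"
  by (rule ring.genideal_ideal) (simp_all add: cring.axioms(1)[OF cring_type_ring])

lemma subset_genideal: "S \<subseteq> Idl\<^bsub>(type_ring :: 'a::comm_ring_1 ring)\<^esub> S"
  by (rule ring.genideal_self) (simp_all add: cring.axioms(1)[OF cring_type_ring])

lemma genideal_least: "ideal I (type_ring :: 'a::comm_ring_1 ring) \<Longrightarrow> S \<subseteq> I \<Longrightarrow> Idl\<^bsub>type_ring\<^esub> S \<subseteq> I"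
  by (rule ring.genideal_minimal) (simp_all add: cring.axioms(1)[OF cring_type_ring])

lemma genideal_singleton: "Idl\<^bsub>type_ring\<^esub> {f :: 'a::comm_ring_1} = range (\<lambda>q. q * f)"
proof
  have "0 \<in> range (\<lambda>q. q * f)" by (rule range_eqI[of _ _ 0]) simp
  moreover have "a * f + b * f \<in> range (\<lambda>q. q * f)" for a b
    by (rule range_eqI[of _ _ "a + b"]) (simp add: distrib_right)
  moreover have "p * (a * f) \<in> range (\<lambda>q. q * f)" for a p
    by (rule range_eqI[of _ _ "p * a"]) (simp add: mult.assoc)
  ultimately have "ideal (range (\<lambda>q. q * f)) type_ring"
    unfolding ideal_type_ring_iff by blast
  moreover have "{f} \<subseteq> range (\<lambda>q. q * f)" using range_eqI[of f "\<lambda>q. q * f" 1] by simp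
  ultimately show "Idl\<^bsub>type_ring\<^esub> {f} \<subseteq> range (\<lambda>q. q * f)" by (rule genideal_least)
  show "range (\<lambda>q. q * f) \<subseteq> Idl\<^bsub>type_ring\<^esub> {f}"
    using ideal_genideal[of "{f}"] subset_genideal[of "{f}"] unfolding ideal_type_ring_iff by blast
qed

lemma coef_hom_component [simp]: "coef (hom_component d f) m = (if mdegree m = d then coef f m else 0)"
  unfolding hom_component_def
  by (auto simp: lookup_sum lookup_single when_def in_keys_iff sum.If_cases cong: if_cong)

lemma sum_hom_components: "(\<Sum>d\<in>mdegree ` keys f. hom_component d f) = f"
  by (rule poly_mapping_eqI) (auto simp: lookup_sum in_keys_iff)

definition degree_part :: "('n::finite, 'a::comm_ring_1) mpoly set \<Rightarrow> nat \<Rightarrow> ('n, 'a) mpoly set" where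
  "degree_part P d = {f \<in> P. keys f \<subseteq> mons d}"

definition hilbert :: "('n::finite, 'a::field) mpoly set \<Rightarrow> nat \<Rightarrow> nat" where
  "hilbert P d = mpoly_vs.dim (degree_part P d)"

lemma keys_subset_mons_iff: "keys f \<subseteq> mons d \<longleftrightarrow> hom_component d f = f"
  by (auto simp: poly_mapping_eq_iff fun_eq_iff in_keys_iff subset_iff)

lemma hom_component_in_degree_part: "graded_ideal I \<Longrightarrow> f \<in> I \<Longrightarrow> hom_component d f \<in> degree_part I d"
  by (auto simp: graded_ideal_def degree_part_def in_keys_iff split: if_splits)

lemma graded_ideal_subsetI:
  assumes "graded_ideal I" "ideal I' type_ring" "\<And>d. degree_part I d \<subseteq> I'"
  shows "I \<subseteq> I'"
proof
  fix f assume "f \<in> I"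
  then have *: "hom_component d f \<in> I'" for d using hom_component_in_degree_part assms by blast
  have "(\<Sum>d\<in>A. hom_component d f) \<in> I'" for A
    by (induction A rule: infinite_finite_induct) (use * assms(2) in \<open>auto simp: ideal_type_ring_iff\<close>)
  then show "f \<in> I'" using sum_hom_components[of f] by metis
qed

lemma graded_ideal_ideal: "graded_ideal I \<Longrightarrow> ideal I type_ring"
  by (simp add: graded_ideal_def)

lemma subspace_ideal: "ideal I type_ring \<Longrightarrow> mpoly_vs.subspace I"
  by (auto simp: ideal_type_ring_iff mpoly_vs.subspace_def)

lemma subspace_degree_part:
  assumes "mpoly_vs.subspace (P :: ('n::finite, 'a::field) mpoly set)"
  shows "mpoly_vs.subspace (degree_part P d)"
proof -
  have "{f :: ('n, 'a) mpoly. keys f \<subseteq> mons d} = {f. \<forall>m. m \<notin> mons d \<longrightarrow> coef f m = 0}"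
    by (auto simp: in_keys_iff)
  then have "mpoly_vs.subspace {f :: ('n, 'a) mpoly. keys f \<subseteq> mons d}"
    by (auto simp: mpoly_vs.subspace_def lookup_add)
  from mpoly_vs.subspace_inter[OF assms this] show ?thesis
    by (simp add: degree_part_def Int_def Collect_conj_eq[symmetric])
qed

lemma degree_part_image:
  assumes M: "graded_ideal M" and \<phi>: "\<And>d F. hom_component d (\<phi> F) = \<phi> (hom_component d F)"
  shows "degree_part (\<phi> ` M) d = \<phi> ` degree_part M d"
proof (intro equalityI subsetI)
  fix f assume f: "f \<in> degree_part (\<phi> ` M) d"
  then obtain F where F: "F \<in> M" "f = \<phi> F" by (auto simp: degree_part_def)
  have "hom_component d f = f" using f unfolding degree_part_def mem_Collect_eq keys_subset_mons_iff by (rule conjunct2)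
  then have "f = \<phi> (hom_component d F)" by (simp add: F(2) \<phi>)
  then show "f \<in> \<phi> ` degree_part M d" by (rule image_eqI[OF _ hom_component_in_degree_part[OF M F(1)]])
next
  fix f assume "f \<in> \<phi> ` degree_part M d"
  then obtain F where F: "F \<in> degree_part M d" "f = \<phi> F" by blast
  have FM: "F \<in> M" "hom_component d F = F"
    using F(1) unfolding degree_part_def mem_Collect_eq keys_subset_mons_iff by (rule conjunct1, rule conjunct2)
  have "hom_component d f = f" by (simp add: F(2) \<phi> FM(2))
  moreover have "f \<in> \<phi> ` M" using FM(1) F(2) by simp
  ultimately show "f \<in> degree_part (\<phi> ` M) d"
    unfolding degree_part_def mem_Collect_eq keys_subset_mons_iff by simp
qed

lemma graded_ideal_Int: "graded_ideal I \<Longrightarrow> graded_ideal J \<Longrightarrow> graded_ideal (I \<inter> J)"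
  by (simp add: graded_ideal_def ideal_type_ring_iff)

text \<open>The lexicographic order for the order of the variables given by \<open>e\<close>, but with the comparison of
  exponents reversed. It is compatible with multiplication, and of two monomials the one with the larger exponent at
  the first variable is the smaller one, as for the reverse lexicographic order.\<close>

definition mless :: "('n \<Rightarrow> nat) \<Rightarrow> ('n \<Rightarrow>\<^sub>0 nat) \<Rightarrow> ('n \<Rightarrow>\<^sub>0 nat) \<Rightarrow> bool" where
  "mless e m m' \<longleftrightarrow> (\<exists>i. coef m' i < coef m i \<and> (\<forall>j. e j < e i \<longrightarrow> coef m j = coef m' j))"

lemma mless_irrefl: "\<not> mless e m m"
  by (simp add: mless_def)

lemma mless_trans:
  assumes "inj e" "mless e a b" "mless e b c"
  shows "mless e a c"
proof -
  obtain i j where i: "coef b i < coef a i" "\<And>k. e k < e i \<Longrightarrow> coef a k = coef b k"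
    and j: "coef c j < coef b j" "\<And>k. e k < e j \<Longrightarrow> coef b k = coef c k"
    using assms unfolding mless_def by blast
  consider "e i < e j" | "i = j" | "e j < e i" using assms(1) by (metis injD nat_neq_iff)
  then show ?thesis
  proof cases
    case 1 then show ?thesis unfolding mless_def using i j by (intro exI[of _ i]) auto
  next
    case 2 then show ?thesis unfolding mless_def using i j by (intro exI[of _ i]) auto
  next
    case 3 then show ?thesis unfolding mless_def using i j by (intro exI[of _ j]) auto
  qed
qed

lemma mless_total:
  assumes "inj e" "m \<noteq> m'"
  shows "mless e m m' \<or> mless e m' m"
proof -
  have "\<exists>i. coef m i \<noteq> coef m' i" using assms(2) by (metis poly_mapping_eqI)
  then obtain i where i: "coef m i \<noteq> coef m' i" "\<And>j. coef m j \<noteq> coef m' j \<Longrightarrow> e i \<le> e j"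
    using ex_has_least_nat[of "\<lambda>i. coef m i \<noteq> coef m' i" _ e] by metis
  then have "\<forall>j. e j < e i \<longrightarrow> coef m j = coef m' j" by (metis not_le)
  then show ?thesis unfolding mless_def using i(1) by (metis nat_neq_iff)
qed

lemma mless_add_iff: "mless e (u + a) (u + b) \<longleftrightarrow> mless e a b"
  by (simp add: mless_def lookup_add)

definition is_lead :: "('n \<Rightarrow> nat) \<Rightarrow> ('n, 'a::zero) mpoly \<Rightarrow> ('n \<Rightarrow>\<^sub>0 nat) \<Rightarrow> bool" where
  "is_lead e f m \<longleftrightarrow> coef f m \<noteq> 0 \<and> (\<forall>a. coef f a \<noteq> 0 \<longrightarrow> a = m \<or> mless e a m)"

lemma is_lead_exists:
  assumes "inj e" "f \<noteq> 0"
  shows "\<exists>m. is_lead e f m"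
proof -
  have *: "\<exists>m\<in>A. \<forall>a\<in>A. a = m \<or> mless e a m" if "finite A" "A \<noteq> {}" for A
    using that
  proof (induction A rule: finite_ne_induct)
    case (insert x A)
    then obtain m where m: "m \<in> A" "\<forall>a\<in>A. a = m \<or> mless e a m" by blast
    show ?case
    proof (cases "mless e m x")
      case True
      have "a = x \<or> mless e a x" if "a \<in> insert x A" for a
        using that m(2) True mless_trans[OF assms(1) _ True, of a] by auto
      then show ?thesis by blast
    next
      case False
      then have "x = m \<or> mless e x m" using mless_total[OF assms(1)] by blast
      then show ?thesis using m by (intro bexI[of _ m]) auto
    qed
  qed simp
  have "\<exists>k. coef f k \<noteq> 0" using assms(2) by (metis lookup_zero poly_mapping_eqI)
  then have "keys f \<noteq> {}" by (auto simp: in_keys_iff)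
  from *[OF finite_keys this] obtain m where
    m: "m \<in> keys f" "\<forall>a\<in>keys f. a = m \<or> mless e a m" by (rule bexE)
  have "is_lead e f m" unfolding is_lead_def using m by (simp add: in_keys_iff)
  then show ?thesis by (rule exI)
qed

lemma mult_eq_sum_single:
  "f * g = (\<Sum>a\<in>keys f. \<Sum>b\<in>keys g. single (a + b) (coef f a * coef g b))"
  for f g :: "('n, 'a::comm_ring_1) mpoly"
proof -
  have "f * g = (\<Sum>a\<in>keys f. single a (coef f a)) *
      (\<Sum>b\<in>keys g. single b (coef g b))"
    by (simp only: poly_mapping_sum_single[symmetric])
  then show ?thesis by (simp add: sum_product mult_single)
qed

lemma is_lead_mult:
  fixes f g :: "('n, 'a::idom) mpoly"
  assumes e: "inj e" and f: "is_lead e f m" and g: "is_lead e g u"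
  shows "is_lead e (f * g) (m + u)"
proof -
  have less: "a + b = m + u \<or> mless e (a + b) (m + u)" "a + b = m + u \<Longrightarrow> a = m \<and> b = u"
    if "coef f a \<noteq> 0" "coef g b \<noteq> 0" for a b
  proof -
    have a: "a = m \<or> mless e a m" and b: "b = u \<or> mless e b u" using that f g by (auto simp: is_lead_def)
    have "a + b = m + b \<or> mless e (a + b) (m + b)" using a mless_add_iff[of e b a m] by (auto simp: add.commute)
    moreover have "m + b = m + u \<or> mless e (m + b) (m + u)" using b mless_add_iff[of e m b u] by auto
    ultimately show "a + b = m + u \<or> mless e (a + b) (m + u)" using mless_trans[OF e] by metis
    assume eq: "a + b = m + u"
    have "\<not> mless e (a + b) (m + b)"
      using \<open>m + b = m + u \<or> mless e (m + b) (m + u)\<close> mless_irrefl mless_trans[OF e] unfolding eq by metis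
    then have "a = m" using a mless_add_iff[of e b a m] by (auto simp: add.commute)
    then show "a = m \<and> b = u" using eq by simp
  qed
  have c: "coef (f * g) k = (\<Sum>a\<in>keys f. \<Sum>b\<in>keys g. (coef f a * coef g b when a + b = k))" for k
    by (subst mult_eq_sum_single) (simp add: lookup_sum lookup_single)
  have "coef (f * g) (m + u) = (\<Sum>a\<in>keys f. \<Sum>b\<in>keys g.
      (if a = m then if b = u then coef f a * coef g b else 0 else 0))"
    unfolding c by (intro sum.cong refl) (use less in \<open>auto simp: when_def in_keys_iff\<close>)
  also have "\<dots> = (\<Sum>a\<in>keys f. if a = m then coef f m * coef g u else 0)"
    by (intro sum.cong refl) (use g in \<open>auto simp: is_lead_def in_keys_iff\<close>)
  also have "\<dots> = coef f m * coef g u"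
    using f by (simp add: is_lead_def in_keys_iff)
  finally have "coef (f * g) (m + u) \<noteq> 0" using f g by (simp add: is_lead_def)
  moreover have "k = m + u \<or> mless e k (m + u)" if "coef (f * g) k \<noteq> 0" for k
  proof -
    have "k \<in> keys (f * g)" using that by (simp add: in_keys_iff)
    then obtain a b where "a \<in> keys f" "b \<in> keys g" "k = a + b"
      using keys_mult[of f g] by blast
    then show ?thesis using less(1) by (simp add: in_keys_iff)
  qed
  ultimately show ?thesis by (simp add: is_lead_def)
qed

definition leading_monomials :: "('n \<Rightarrow> nat) \<Rightarrow> ('n::finite, 'a::comm_ring_1) mpoly set \<Rightarrow> ('n \<Rightarrow>\<^sub>0 nat) set" where
  "leading_monomials e P = {m. \<exists>f\<in>degree_part P (mdegree m). is_lead e f m}"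

text \<open>Interreduction: a polynomial with leading monomial \<open>j\<close> is cleared, by recursion along the order, at
  the smaller leading monomials, and vanishes at the larger ones by itself.\<close>

lemma pivot_set_leads:
  fixes W :: "('n, 'a::field) mpoly set"
  assumes e: "inj e" and sub: "mpoly_vs.subspace W" and fin: "finite {m. \<exists>f\<in>W. is_lead e f m}"
  shows "pivot_set W {m. \<exists>f\<in>W. is_lead e f m}"
proof -
  define M where "M = {m. \<exists>f\<in>W. is_lead e f m}"
  have M: "finite M" using fin by (simp add: M_def)
  have zero: "f = 0" if "f \<in> W" "\<forall>j\<in>M. coef f j = 0" for f
  proof (rule ccontr)
    assume "f \<noteq> 0"
    then obtain m where m: "is_lead e f m" using is_lead_exists[OF e] by blast
    then have "m \<in> M" using that(1) by (auto simp: M_def)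
    then show False using m that(2) by (simp add: is_lead_def)
  qed
  define Q where "Q j f \<longleftrightarrow> f \<in> W \<and> (\<forall>i\<in>M. coef f i = (if i = j then 1 else 0))" for j f
  have "\<exists>f. Q j f" if "j \<in> M" for j
    using that
  proof (induction "card {i \<in> M. mless e i j}" arbitrary: j rule: less_induct)
    case (less j)
    let ?B = "{i \<in> M. mless e i j}"
    have "\<forall>k\<in>?B. \<exists>f. Q k f"
    proof
      fix k assume k: "k \<in> ?B"
      have "{i \<in> M. mless e i k} \<subset> ?B"
        using k mless_trans[OF e, of _ k j] mless_irrefl[of e k] by blast
      then have "card {i \<in> M. mless e i k} < card ?B" using M by (intro psubset_card_mono) simp_all
      moreover have "k \<in> M" using k by simp
      ultimately show "\<exists>f. Q k f" by (rule less.hyps)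
    qed
    from bchoice[OF this] obtain b where Qb: "\<And>k. k \<in> ?B \<Longrightarrow> Q k (b k)" by blast
    have b: "b k \<in> W" "i \<in> M \<Longrightarrow> coef (b k) i = (if i = k then 1 else 0)" if "k \<in> ?B" for k i
      using Qb[OF that] by (simp_all add: Q_def)
    obtain f where f: "f \<in> W" "is_lead e f j" using less.prems by (auto simp: M_def)
    define g where "g = f - (\<Sum>k\<in>?B. mconst (coef f k) * b k)"
    have "g \<in> W" unfolding g_def
      by (intro mpoly_vs.subspace_diff[OF sub] mpoly_vs.subspace_sum[OF sub] mpoly_vs.subspace_scale[OF sub] b(1) f(1))
    have g: "coef g i = (if i = j then coef f j else 0)" if i: "i \<in> M" for i
    proof -
      have "(\<Sum>k\<in>?B. coef f k * coef (b k) i) = (\<Sum>k\<in>?B. if k = i then coef f i else 0)"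
        by (rule sum.cong) (simp_all add: b(2)[OF _ i])
      also have "\<dots> = (if i \<in> ?B then coef f i else 0)" using M by simp
      finally have *: "coef g i = coef f i - (if i \<in> ?B then coef f i else 0)"
        by (simp add: g_def lookup_minus lookup_sum)
      have "i \<notin> ?B" if "i = j" using that mless_irrefl[of e j] by simp
      moreover have "i \<in> ?B \<or> coef f i = 0" if "i \<noteq> j" using that i f(2) by (auto simp: is_lead_def)
      ultimately show ?thesis using * by auto
    qed
    have "coef f j \<noteq> 0" using f(2) by (simp add: is_lead_def)
    then have "\<forall>i\<in>M. coef (mconst (inverse (coef f j)) * g) i = (if i = j then 1 else 0)" by (simp add: g)
    then have "Q j (mconst (inverse (coef f j)) * g)"
      using mpoly_vs.subspace_scale[OF sub \<open>g \<in> W\<close>] by (simp add: Q_def)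
    then show ?case by (rule exI)
  qed
  then have "\<exists>f\<in>W. \<forall>i\<in>M. coef f i = (if i = j then 1 else 0)" if "j \<in> M" for j
    using that unfolding Q_def Bex_def by blast
  with zero show ?thesis unfolding M_def[symmetric] by (rule pivot_setI)
qed

lemma leading_monomials_Int_mons:
  "leading_monomials e P \<inter> mons d = {m. \<exists>f\<in>degree_part P d. is_lead e f m}"
proof -
  have "mdegree m = d" if "f \<in> degree_part P d" "is_lead e f m" for f m
  proof -
    have "m \<in> keys f" using that(2) by (simp add: is_lead_def in_keys_iff)
    then have "m \<in> mons d" using that(1) unfolding degree_part_def by blast
    then show ?thesis by simp
  qed
  then show ?thesis unfolding leading_monomials_def by (intro Set.set_eqI) auto
qed

lemma pivot_set_leading_monomials:
  fixes P :: "('n::finite, 'a::field) mpoly set"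
  assumes "inj e" "mpoly_vs.subspace P"
  shows "pivot_set (degree_part P d) (leading_monomials e P \<inter> mons d)"
  unfolding leading_monomials_Int_mons
  by (rule pivot_set_leads[OF assms(1) subspace_degree_part[OF assms(2)]])
    (simp add: leading_monomials_Int_mons[symmetric])

lemma card_leading_monomials:
  fixes P :: "('n::finite, 'a::field) mpoly set"
  assumes "inj e" "mpoly_vs.subspace P"
  shows "card (leading_monomials e P \<inter> mons d) = hilbert P d"
  unfolding hilbert_def
  by (rule pivot_set_dim[symmetric, OF subspace_degree_part[OF assms(2)] _ pivot_set_leading_monomials[OF assms]]) simp

lemma keys_mult_subset_mons:
  assumes "keys f \<subseteq> mons c" "keys g \<subseteq> mons d"
  shows "keys (f * g) \<subseteq> mons (c + d)"
proof
  fix k assume "k \<in> keys (f * g)"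
  then obtain a b where ab: "k = a + b" "a \<in> keys f" "b \<in> keys g"
    using keys_mult[of f g] by blast
  have "mdegree a = c" "mdegree b = d" using subsetD[OF assms(1) ab(2)] subsetD[OF assms(2) ab(3)] by simp_all
  then show "k \<in> mons (c + d)" using ab(1) by simp
qed

lemma is_lead_single: "c \<noteq> 0 \<Longrightarrow> is_lead e (single u c) u"
  by (auto simp: is_lead_def lookup_single when_def)

lemma keys_single_subset_mons: "keys (single u c) \<subseteq> mons (mdegree u)"
  by (auto simp: in_keys_iff lookup_single when_def split: if_splits)

lemma monomial_ideal_leading_monomials:
  fixes I :: "('n::finite, 'a::idom) mpoly set"
  assumes "inj e" "ideal I type_ring"
  shows "monomial_ideal (leading_monomials e I)"
  unfolding monomial_ideal_def
proof (intro ballI allI)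
  fix m u assume "m \<in> leading_monomials e I"
  then obtain f where f: "f \<in> I" "keys f \<subseteq> mons (mdegree m)" "is_lead e f m"
    by (auto simp: leading_monomials_def degree_part_def)
  let ?g = "single u 1 * f"
  have "?g \<in> I" using assms(2) f(1) unfolding ideal_type_ring_iff by blast
  moreover have "keys ?g \<subseteq> mons (mdegree (m + u))"
    using keys_mult_subset_mons[OF keys_single_subset_mons f(2), of u 1] by (simp add: add.commute)
  moreover have "is_lead e ?g (m + u)"
    using is_lead_mult[OF assms(1) is_lead_single f(3), of 1 u] by (simp add: add.commute)
  ultimately show "m + u \<in> leading_monomials e I"
    by (auto simp: leading_monomials_def degree_part_def)
qed

lemma leading_monomials_in_monomial_ideals:
  fixes I :: "('n::finite, 'a::field) mpoly set"
  assumes "inj e" "ideal I type_ring"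
  shows "leading_monomials e I \<in> monomial_ideals (hilbert I)"
  using card_leading_monomials[OF assms(1) subspace_ideal[OF assms(2)]] monomial_ideal_leading_monomials[OF assms]
  by (simp add: monomial_ideals_def)

text \<open>In each degree the leading monomials are a pivot set of both ideals, so the adapted basis of the smaller
  ideal is also one of the larger ideal.\<close>

lemma subset_if_leading_monomials_subset:
  fixes I J :: "('n::finite, 'a::field) mpoly set"
  assumes e: "inj e" and I: "graded_ideal I" and J: "graded_ideal J" and sub: "J \<subseteq> I"
    and lead: "leading_monomials e I \<subseteq> leading_monomials e J"
  shows "I \<subseteq> J"
proof (rule graded_ideal_subsetI[OF I graded_ideal_ideal[OF J]])
  fix d
  have vs: "mpoly_vs.subspace I" "mpoly_vs.subspace J"
    using I J by (simp_all add: graded_ideal_ideal subspace_ideal)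
  let ?M = "leading_monomials e I \<inter> mons d"
  have "leading_monomials e J \<subseteq> leading_monomials e I"
    using sub unfolding leading_monomials_def degree_part_def by blast
  then have eq: "leading_monomials e J \<inter> mons d = ?M" using lead by blast
  have pI: "pivot_set (degree_part I d) ?M" by (rule pivot_set_leading_monomials[OF e vs(1)])
  have pJ: "pivot_set (degree_part J d) ?M"
    using pivot_set_leading_monomials[OF e vs(2), of d] by (simp add: eq)
  obtain b where b: "\<And>j. j \<in> ?M \<Longrightarrow> b j \<in> degree_part J d"
      "\<And>j i. j \<in> ?M \<Longrightarrow> i \<in> ?M \<Longrightarrow> coef (b j) i = (if i = j then 1 else 0)"
    using pivot_set_basis[OF pJ] by metis
  have bI: "b j \<in> degree_part I d" if "j \<in> ?M" for j using b(1)[OF that] sub by (auto simp: degree_part_def)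
  show "degree_part I d \<subseteq> J"
  proof
    fix f assume f: "f \<in> degree_part I d"
    have "finite ?M" by simp
    have "f = (\<Sum>j\<in>?M. mconst (coef f j) * b j)"
      by (rule pivot_expansion[OF subspace_degree_part[OF vs(1)] \<open>finite ?M\<close>])
        (rule f bI b(2) pivot_set_zero[OF pI] | assumption)+
    moreover have "(\<Sum>j\<in>?M. mconst (coef f j) * b j) \<in> J"
      using b(1) by (intro mpoly_vs.subspace_sum[OF vs(2)] mpoly_vs.subspace_scale[OF vs(2)]) (simp add: degree_part_def)
    ultimately show "f \<in> J" by metis
  qed
qed

text \<open>A graded ideal is generated in the degrees in which its ideal of leading monomials is: the intersection of
  \<open>I\<close> and \<open>J\<close> has all leading monomials of degree at most \<open>D\<close>, hence all leading monomials of \<open>I\<close>.\<close>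

lemma graded_ideal_subset_if_degree_parts:
  fixes I J :: "('n::finite, 'a::field) mpoly set"
  assumes e: "inj e" and I: "graded_ideal I" and J: "graded_ideal J"
    and D: "generated_within D (leading_monomials e I)"
    and sub: "\<And>d. d \<le> D \<Longrightarrow> degree_part I d \<subseteq> J"
  shows "I \<subseteq> J"
proof -
  have IJ: "graded_ideal (I \<inter> J)" by (rule graded_ideal_Int[OF I J])
  have "leading_monomials e I \<subseteq> leading_monomials e (I \<inter> J)"
  proof
    fix m assume "m \<in> leading_monomials e I"
    then obtain u w where u: "u \<in> leading_monomials e I" "mdegree u \<le> D" "m = u + w"
      using D unfolding generated_within_def by blast
    then have "u \<in> leading_monomials e (I \<inter> J)"
      using sub[OF u(2)] unfolding leading_monomials_def degree_part_def by blast
    then show "m \<in> leading_monomials e (I \<inter> J)"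
      using monomial_ideal_leading_monomials[OF e graded_ideal_ideal[OF IJ]] u(3)
      unfolding monomial_ideal_def by blast
  qed
  then have "I \<subseteq> I \<inter> J" by (intro subset_if_leading_monomials_subset[OF e I IJ]) auto
  then show ?thesis by blast
qed

section \<open>Monomials of bounded degree in ideals with a given Hilbert function\<close>

lemma coef_single_mult_add: "coef (single u c * f) (u + m) = c * coef f m"
  for f :: "('n, 'a::comm_ring_1) mpoly"
proof -
  have "single u c * f =
      single u c * (\<Sum>a\<in>keys f. single a (coef f a))"
    using poly_mapping_sum_single[of f] by (rule arg_cong)
  then have "coef (single u c * f) (u + m) =
      (\<Sum>a\<in>keys f. if a = m then c * coef f a else 0)"
    by (simp add: sum_distrib_left mult_single lookup_sum lookup_single when_def)
  then show ?thesis by (simp add: in_keys_iff)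
qed

lemma coef_single_mult_eq_0:
  fixes f :: "('n, 'a::comm_ring_1) mpoly"
  assumes "\<And>m. a \<noteq> u + m"
  shows "coef (single u c * f) a = 0"
proof (rule ccontr)
  assume "\<not> ?thesis"
  then have "a \<in> keys (single u c * f)" by (simp add: in_keys_iff)
  then obtain b m where "b \<in> keys (single u c)" "a = b + m"
    using keys_mult[of "single u c" f] by blast
  then show False using assms[of m] by (simp split: if_splits)
qed

lemma hom_component_single_mult:
  "hom_component (mdegree u + d) (single u c * f) = single u c * hom_component d f"
  for f :: "('n::finite, 'a::comm_ring_1) mpoly"
proof (rule poly_mapping_eqI)
  fix a show "coef (hom_component (mdegree u + d) (single u c * f)) a =
      coef (single u c * hom_component d f) a"
  proof (cases "\<exists>m. a = u + m")
    case True then show ?thesis by (auto simp: coef_single_mult_add)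
  next
    case False then show ?thesis by (simp add: coef_single_mult_eq_0)
  qed
qed

definition colon :: "('n::finite, 'a::comm_ring_1) mpoly set \<Rightarrow> ('n \<Rightarrow>\<^sub>0 nat) \<Rightarrow> ('n, 'a) mpoly set" where
  "colon I u = {f. single u 1 * f \<in> I}"

lemma graded_ideal_colon:
  assumes "graded_ideal I"
  shows "graded_ideal (colon I u)"
  unfolding graded_ideal_def
proof (intro conjI ballI allI)
  note I = ideal_type_ringD[OF graded_ideal_ideal[OF assms]]
  show "ideal (colon I u) type_ring"
    unfolding ideal_type_ring_iff colon_def
  proof (intro conjI ballI allI; unfold mem_Collect_eq)
    show "single u 1 * 0 \<in> I" using I(1) by simp
  next
    fix f g assume "single u 1 * f \<in> I" "single u 1 * g \<in> I"
    then show "single u 1 * (f + g) \<in> I" unfolding distrib_left by (rule I(2))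
  next
    fix f q assume "single u 1 * f \<in> I"
    from I(3)[OF this, of q] show "single u 1 * (q * f) \<in> I" by (simp add: mult.left_commute)
  qed
  fix f d assume "f \<in> colon I u"
  then have "hom_component (mdegree u + d) (single u 1 * f) \<in> I"
    using assms by (simp add: colon_def graded_ideal_def)
  then show "hom_component d f \<in> colon I u"
    by (simp add: colon_def hom_component_single_mult)
qed

definition power_mon :: "'n \<Rightarrow> nat \<Rightarrow> ('n \<Rightarrow>\<^sub>0 nat)" where
  "power_mon i k = single i k"

lemma coef_power_mon: "coef (power_mon i k) j = (if j = i then k else 0)"
  by (simp add: power_mon_def lookup_single when_def)

lemma mdegree_power_mon [simp]: "mdegree (power_mon i k :: 'n::finite \<Rightarrow>\<^sub>0 nat) = k"
  by (simp add: mdegree_def coef_power_mon)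

lemma power_mon_add: "power_mon i (a + b) = power_mon i a + power_mon i b"
  by (simp add: power_mon_def single_add)

text \<open>This makes the order suitable for saturations: no monomial below the leading one has a smaller exponent
  at the first variable.\<close>

lemma power_mon_dvd_if_dvd_lead:
  fixes f :: "('n::finite, 'a::comm_ring_1) mpoly"
  assumes e: "\<forall>j. j \<noteq> i \<longrightarrow> e i < e j" and lead: "is_lead e f (power_mon i k + m)"
  shows "\<exists>g. f = single (power_mon i k) 1 * g"
proof -
  have ge: "k \<le> coef a i" if "a \<in> keys f" for a
  proof -
    have "a = power_mon i k + m \<or> mless e a (power_mon i k + m)"
      using that lead by (simp add: is_lead_def in_keys_iff)
    then show ?thesis
    proof
      assume "mless e a (power_mon i k + m)"
      then obtain j where j: "coef (power_mon i k + m) j < coef a j"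
          "\<And>l. e l < e j \<Longrightarrow> coef a l = coef (power_mon i k + m) l"
        unfolding mless_def by blast
      show ?thesis
        using j(1) j(2)[of i] e[rule_format, of j] by (cases "j = i") (simp_all add: lookup_add coef_power_mon)
    qed (simp add: lookup_add coef_power_mon)
  qed
  have eq: "power_mon i k + (a - power_mon i k) = a" if "a \<in> keys f" for a
    by (rule diff_add_monomial) (use ge[OF that] in \<open>simp add: coef_power_mon\<close>)
  define g where "g = (\<Sum>a\<in>keys f. single (a - power_mon i k) (coef f a))"
  have "single (power_mon i k) 1 * g = (\<Sum>a\<in>keys f. single a (coef f a))"
    by (simp add: g_def sum_distrib_left mult_single eq)
  also have "\<dots> = f" by (rule poly_mapping_sum_single[symmetric])
  finally show ?thesis by metis
qed

lemma is_lead_single_mult_iff: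
  fixes f :: "('n::finite, 'a::comm_ring_1) mpoly"
  shows "is_lead e (single u 1 * f) (u + m) \<longleftrightarrow> is_lead e f m"
proof
  assume L: "is_lead e (single u 1 * f) (u + m)"
  show "is_lead e f m"
    unfolding is_lead_def
  proof (intro conjI allI impI)
    show "coef f m \<noteq> 0" using L by (simp add: is_lead_def coef_single_mult_add)
    fix a assume "coef f a \<noteq> 0"
    then have "coef (single u 1 * f) (u + a) \<noteq> 0" by (simp add: coef_single_mult_add)
    then have "u + a = u + m \<or> mless e (u + a) (u + m)" using L unfolding is_lead_def by blast
    then show "a = m \<or> mless e a m" by (simp add: mless_add_iff)
  qed
next
  assume L: "is_lead e f m"
  show "is_lead e (single u 1 * f) (u + m)"
    unfolding is_lead_def
  proof (intro conjI allI impI)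
    show "coef (single u 1 * f) (u + m) \<noteq> 0" using L by (simp add: is_lead_def coef_single_mult_add)
    fix a assume a: "coef (single u 1 * f) a \<noteq> 0"
    then obtain b where b: "a = u + b" using coef_single_mult_eq_0[of a u 1 f] by blast
    then have "coef f b \<noteq> 0" using a by (simp add: coef_single_mult_add)
    then have "b = m \<or> mless e b m" using L unfolding is_lead_def by blast
    then show "a = u + m \<or> mless e a (u + m)" by (auto simp: b mless_add_iff)
  qed
qed

lemma keys_single_mult_subset_mons_iff:
  "keys (single u 1 * f) \<subseteq> mons (mdegree u + d) \<longleftrightarrow> keys f \<subseteq> mons d"
  for f :: "('n::finite, 'a::comm_ring_1) mpoly"
proof
  assume L: "keys (single u 1 * f) \<subseteq> mons (mdegree u + d)"
  show "keys f \<subseteq> mons d"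
  proof
    fix a assume "a \<in> keys f"
    then have "u + a \<in> keys (single u 1 * f)"
      by (simp add: in_keys_iff coef_single_mult_add)
    then have "u + a \<in> mons (mdegree u + d)" using L by blast
    then show "a \<in> mons d" by simp
  qed
qed (rule keys_mult_subset_mons[OF keys_single_subset_mons])

lemma mem_leading_monomials:
  "m \<in> leading_monomials e P \<longleftrightarrow> (\<exists>f. f \<in> P \<and> keys f \<subseteq> mons (mdegree m) \<and> is_lead e f m)"
  by (simp only: leading_monomials_def degree_part_def mem_Collect_eq Bex_def conj_assoc)

lemma leading_monomials_colon:
  fixes I :: "('n::finite, 'a::comm_ring_1) mpoly set"
  assumes e: "\<forall>j. j \<noteq> i \<longrightarrow> e i < e j"
  shows "m \<in> leading_monomials e (colon I (power_mon i k)) \<longleftrightarrow> power_mon i k + m \<in> leading_monomials e I"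
proof
  assume "m \<in> leading_monomials e (colon I (power_mon i k))"
  then obtain f where "f \<in> colon I (power_mon i k)" "keys f \<subseteq> mons (mdegree m)" "is_lead e f m"
    unfolding mem_leading_monomials by (elim exE conjE)
  then have "single (power_mon i k) 1 * f \<in> I \<and>
      keys (single (power_mon i k) 1 * f) \<subseteq> mons (mdegree (power_mon i k + m)) \<and>
      is_lead e (single (power_mon i k) 1 * f) (power_mon i k + m)"
    unfolding colon_def mdegree_add keys_single_mult_subset_mons_iff is_lead_single_mult_iff mem_Collect_eq
    by (intro conjI)
  then show "power_mon i k + m \<in> leading_monomials e I"
    unfolding mem_leading_monomials by (rule exI)
next
  assume "power_mon i k + m \<in> leading_monomials e I"
  then obtain f where f: "f \<in> I" "keys f \<subseteq> mons (mdegree (power_mon i k) + mdegree m)"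
      "is_lead e f (power_mon i k + m)"
    unfolding mem_leading_monomials mdegree_add by (elim exE conjE)
  obtain g where g: "f = single (power_mon i k) 1 * g"
    using power_mon_dvd_if_dvd_lead[OF e f(3)] by blast
  have "g \<in> colon I (power_mon i k)" using f(1) by (simp add: colon_def g)
  moreover have "keys g \<subseteq> mons (mdegree m)" "is_lead e g m"
    using f(2,3) unfolding g keys_single_mult_subset_mons_iff is_lead_single_mult_iff by simp_all
  ultimately show "m \<in> leading_monomials e (colon I (power_mon i k))"
    unfolding mem_leading_monomials by (intro exI[of _ g] conjI)
qed

lemma colon_power_mon_mono:
  assumes "ideal I type_ring" "a \<le> b"
  shows "colon I (power_mon i a) \<subseteq> colon I (power_mon i b)"
proof
  fix f assume "f \<in> colon I (power_mon i a)"
  then have "single (power_mon i (b - a)) 1 * (single (power_mon i a) 1 * f) \<in> I"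
    using assms(1) unfolding ideal_type_ring_iff colon_def by blast
  also have "single (power_mon i (b - a)) 1 * (single (power_mon i a) 1 * f) =
      single (power_mon i b) 1 * f"
    using assms(2) by (simp add: mult.assoc[symmetric] mult_single power_mon_add[symmetric])
  finally show "f \<in> colon I (power_mon i b)" by (simp add: colon_def)
qed

text \<open>A generator of the ideal of leading monomials of degree at most \<open>D\<close> has exponent at most \<open>D\<close> at \<open>x\<^sub>i\<close>. So the
  colon ideals by powers of \<open>x\<^sub>i\<close> have the same leading monomials from the exponent \<open>D\<close> on.\<close>

lemma colon_power_mon_stable:
  fixes I :: "('n::finite, 'a::field) mpoly set"
  assumes I: "graded_ideal I" and inj: "inj e" and e: "\<forall>j. j \<noteq> i \<longrightarrow> e i < e j"
    and D: "generated_within D (leading_monomials e I)"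
  shows "colon I (power_mon i a) \<subseteq> colon I (power_mon i D)"
proof (cases "a \<le> D")
  case True then show ?thesis by (rule colon_power_mon_mono[OF graded_ideal_ideal[OF I]])
next
  case False
  show ?thesis
  proof (rule subset_if_leading_monomials_subset[OF inj graded_ideal_colon[OF I] graded_ideal_colon[OF I]])
    show "colon I (power_mon i D) \<subseteq> colon I (power_mon i a)"
      by (rule colon_power_mon_mono[OF graded_ideal_ideal[OF I]]) (use False in simp)
    show "leading_monomials e (colon I (power_mon i a)) \<subseteq> leading_monomials e (colon I (power_mon i D))"
    proof
      fix m assume "m \<in> leading_monomials e (colon I (power_mon i a))"
      then have "power_mon i a + m \<in> leading_monomials e I"
        using leading_monomials_colon[OF e] by blast
      then obtain u w where u: "u \<in> leading_monomials e I" "mdegree u \<le> D" "power_mon i a + m = u + w"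
        using D unfolding generated_within_def by blast
      have "coef u j \<le> coef (power_mon i D + m) j" for j
      proof (cases "j = i")
        case True
        have "coef u i \<le> mdegree u" unfolding mdegree_def by (rule member_le_sum) simp_all
        then show ?thesis using u(2) True by (simp add: lookup_add coef_power_mon)
      next
        case False
        then show ?thesis using arg_cong[OF u(3), of "\<lambda>p. coef p j"] by (simp add: lookup_add coef_power_mon)
      qed
      then have "u + (power_mon i D + m - u) = power_mon i D + m" by (rule diff_add_monomial)
      moreover have "u + (power_mon i D + m - u) \<in> leading_monomials e I"
        using monomial_ideal_leading_monomials[OF inj graded_ideal_ideal[OF I]] u(1)
        unfolding monomial_ideal_def by blast
      ultimately have "power_mon i D + m \<in> leading_monomials e I" by simp
      then show "m \<in> leading_monomials e (colon I (power_mon i D))"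
        using leading_monomials_colon[OF e] by blast
    qed
  qed
qed

lemma exists_variable_order:
  obtains e :: "'n::finite \<Rightarrow> nat" where "inj e" "\<forall>j. j \<noteq> i \<longrightarrow> e i < e j"
proof -
  obtain f :: "'n \<Rightarrow> nat" where f: "inj f" using finite_imp_inj_to_nat_seg[of "UNIV :: 'n set"] by auto
  show thesis
    by (rule that[of "\<lambda>j. if j = i then 0 else Suc (f j)"]) (use f in \<open>auto simp: inj_def\<close>)
qed

text \<open>The variables are removed one at a time. For all ideals in question, the colon ideal by the same power
  \<open>x\<^sub>i\<^sup>D\<close> is the saturation with respect to \<open>x\<^sub>i\<close>; it contains a monomial in the other variables, and its Hilbert
  function can be read off from the leading monomials of the given ideal, which leaves finitely many possibilities.\<close>

lemma bounded_monomial_in_variables: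
  assumes "finite A" "finite H"
  shows "\<exists>B. \<forall>I :: ('n::finite, 'a::field) mpoly set. graded_ideal I \<longrightarrow> hilbert I \<in> H \<longrightarrow>
    (\<exists>m. keys m \<subseteq> A \<and> single m 1 \<in> I) \<longrightarrow>
    (\<exists>m. keys m \<subseteq> A \<and> mdegree m \<le> B \<and> single m 1 \<in> I)"
  using assms
proof (induction A arbitrary: H rule: finite_induct)
  case empty
  show ?case by (rule exI[of _ 0]) (auto simp: mdegree_def)
next
  case (insert i A)
  obtain e :: "'n \<Rightarrow> nat" where e: "inj e" "\<forall>j. j \<noteq> i \<longrightarrow> e i < e j" using exists_variable_order[of i] by metis
  obtain D where D: "\<And>h (N :: ('n \<Rightarrow>\<^sub>0 nat) set). h \<in> H \<Longrightarrow> N \<in> monomial_ideals h \<Longrightarrow> generated_within D N"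
    using monomial_ideals_generated_within[OF insert.prems] by blast
  define H' where "H' = (\<lambda>(N :: ('n \<Rightarrow>\<^sub>0 nat) set) d. card {m \<in> mons d. power_mon i D + m \<in> N}) `
      (\<Union>h\<in>H. monomial_ideals h)"
  have "finite H'" unfolding H'_def
    by (intro finite_imageI finite_UN_I insert.prems finite_monomial_ideals)
  from insert.IH[OF this] obtain B where B: "\<And>(I :: ('n, 'a) mpoly set). graded_ideal I \<Longrightarrow> hilbert I \<in> H' \<Longrightarrow>
      \<exists>m. keys m \<subseteq> A \<and> single m 1 \<in> I \<Longrightarrow>
      \<exists>m. keys m \<subseteq> A \<and> mdegree m \<le> B \<and> single m 1 \<in> I" by blast
  show ?case
  proof (intro exI[of _ "D + B"] allI impI)
    fix I :: "('n, 'a) mpoly set"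
    assume I: "graded_ideal I" "hilbert I \<in> H"
    assume "\<exists>m. keys m \<subseteq> insert i A \<and> single m 1 \<in> I"
    then obtain m where m: "keys m \<subseteq> insert i A" "single m 1 \<in> I" by blast
    define m' where "m' = m - power_mon i (coef m i)"
    have m'_coef: "coef m' j = (if j = i then 0 else coef m j)" for j
      by (simp add: m'_def lookup_minus coef_power_mon)
    have m': "m = power_mon i (coef m i) + m'"
      unfolding m'_def by (rule diff_add_monomial[symmetric]) (simp add: coef_power_mon)
    have keys_m': "keys m' \<subseteq> A"
    proof
      fix j assume "j \<in> keys m'"
      then have "j \<noteq> i" "j \<in> keys m" by (simp_all add: in_keys_iff m'_coef split: if_splits)
      then show "j \<in> A" using m(1) by blast
    qed
    have lm: "leading_monomials e I \<in> monomial_ideals (hilbert I)"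
      by (rule leading_monomials_in_monomial_ideals[OF e(1) graded_ideal_ideal[OF I(1)]])
    have gen: "generated_within D (leading_monomials e I)" by (rule D[OF I(2) lm])
    let ?C = "colon I (power_mon i D)"
    have C: "graded_ideal ?C" by (rule graded_ideal_colon[OF I(1)])
    have "single m' 1 \<in> colon I (power_mon i (coef m i))"
      using m(2) m' by (simp add: colon_def mult_single)
    then have m'_C: "single m' 1 \<in> ?C"
      using colon_power_mon_stable[OF I(1) e gen] by blast
    have "hilbert ?C d = card {m \<in> mons d. power_mon i D + m \<in> leading_monomials e I}" for d
    proof -
      have "hilbert ?C d = card (leading_monomials e ?C \<inter> mons d)"
        by (rule card_leading_monomials[OF e(1) subspace_ideal[OF graded_ideal_ideal[OF C]], symmetric])
      also have "leading_monomials e ?C \<inter> mons d = {m \<in> mons d. power_mon i D + m \<in> leading_monomials e I}"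
        using leading_monomials_colon[OF e(2)] by blast
      finally show ?thesis .
    qed
    then have "hilbert ?C = (\<lambda>d. card {m \<in> mons d. power_mon i D + m \<in> leading_monomials e I})" by blast
    then have "hilbert ?C \<in> H'" unfolding H'_def using lm I(2) by blast
    from B[OF C this] keys_m' m'_C obtain u where
      u: "keys u \<subseteq> A" "mdegree u \<le> B" "single u 1 \<in> ?C" by blast
    have "keys (power_mon i D + u) \<subseteq> insert i A"
    proof
      fix j assume "j \<in> keys (power_mon i D + u)"
      then have "j = i \<or> j \<in> keys u"
        by (auto simp: in_keys_iff lookup_add coef_power_mon split: if_splits)
      then show "j \<in> insert i A" using u(1) by blast
    qed
    moreover have "mdegree (power_mon i D + u) \<le> D + B" using u(2) by simp
    moreover have "single (power_mon i D + u) 1 \<in> I"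
      using u(3) by (simp add: colon_def mult_single)
    ultimately show "\<exists>m. keys m \<subseteq> insert i A \<and> mdegree m \<le> D + B \<and> single m 1 \<in> I"
      by blast
  qed
qed

text \<open>The leading monomials of a graded ideal with Hilbert function \<open>h\<close> form one of finitely many monomial
  ideals, so their degree bounds serve all such ideals at once.\<close>

lemma uniform_generation_bound:
  "\<exists>D. \<forall>I J :: ('n::finite, 'a::field) mpoly set. graded_ideal I \<longrightarrow> graded_ideal J \<longrightarrow> hilbert I = h \<longrightarrow>
    (\<forall>d\<le>D. degree_part I d \<subseteq> J) \<longrightarrow> I \<subseteq> J"
proof -
  obtain e :: "'n \<Rightarrow> nat" where e: "inj e" using exists_variable_order[of undefined] by metis
  obtain D where D: "\<And>h' (N :: ('n \<Rightarrow>\<^sub>0 nat) set). h' \<in> {h} \<Longrightarrow> N \<in> monomial_ideals h' \<Longrightarrow> generated_within D N"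
    using monomial_ideals_generated_within[of "{h}"] by blast
  show ?thesis
  proof (intro exI[of _ D] allI impI)
    fix I J :: "('n, 'a) mpoly set"
    assume I: "graded_ideal I" and J: "graded_ideal J" and h: "hilbert I = h"
      and sub: "\<forall>d\<le>D. degree_part I d \<subseteq> J"
    have "generated_within D (leading_monomials e I)"
      by (rule D[of h]) (use leading_monomials_in_monomial_ideals[OF e graded_ideal_ideal[OF I]] h in simp_all)
    from graded_ideal_subset_if_degree_parts[OF e I J this] sub show "I \<subseteq> J" by simp
  qed
qed

lemma uniform_monomial_bound:
  "\<exists>D. \<forall>I :: ('n::finite, 'a::field) mpoly set. graded_ideal I \<longrightarrow> hilbert I = h \<longrightarrow>
    (\<exists>m. single m 1 \<in> I) \<longrightarrow> (\<exists>m. mdegree m \<le> D \<and> single m 1 \<in> I)"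
  using bounded_monomial_in_variables[of UNIV "{h}"] by simp

section \<open>Initial forms as residues\<close>

lemma hahn_val_exists:
  assumes "a \<noteq> (0 :: 'k::comm_ring_1 hahn)"
  shows "hahn_coeff a (hahn_val a) \<noteq> 0 \<and> (\<forall>\<nu>. hahn_coeff a \<nu> \<noteq> 0 \<longrightarrow> hahn_val a \<le> \<nu>)"
proof -
  have "\<exists>\<nu>. hahn_coeff a \<nu> \<noteq> 0" using assms by (metis hahn_eqI hahn_coeff_0)
  then have "hahn_support a \<noteq> {}" by (simp add: hahn_support_def)
  then obtain \<mu> where \<mu>: "\<mu> \<in> hahn_support a" "\<forall>b\<in>hahn_support a. \<mu> \<le> b"
    using well_ordered_hahn_support[of a] unfolding well_ordered_def by blast
  then have "hahn_val a = \<mu>"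
    unfolding hahn_val_def by (intro Least_equality) (simp_all add: hahn_support_def)
  then show ?thesis using \<mu> by (simp add: hahn_support_def)
qed

lemma hahn_coeff_val: "a \<noteq> 0 \<Longrightarrow> hahn_coeff a (hahn_val a) \<noteq> 0" for a :: "'k::comm_ring_1 hahn"
  using hahn_val_exists by blast

lemma hahn_coeff_less_val: "a \<noteq> 0 \<Longrightarrow> \<nu> < hahn_val a \<Longrightarrow> hahn_coeff a \<nu> = 0" for a :: "'k::comm_ring_1 hahn"
  using hahn_val_exists by fastforce

lemma hahn_val_eqI:
  fixes a :: "'k::comm_ring_1 hahn"
  assumes "hahn_coeff a v \<noteq> 0" "\<And>\<nu>. \<nu> < v \<Longrightarrow> hahn_coeff a \<nu> = 0"
  shows "hahn_val a = v"
  unfolding hahn_val_def by (rule Least_equality, rule assms(1), rule leI) (use assms(2) in blast)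

lemma hahn_coeff_mult_eq_0:
  fixes a b :: "'k::comm_ring_1 hahn"
  assumes "\<And>\<nu>. \<nu> \<le> \<alpha> \<Longrightarrow> hahn_coeff a \<nu> = 0" "\<And>\<nu>. \<nu> < \<beta> \<Longrightarrow> hahn_coeff b \<nu> = 0" "\<nu> \<le> \<alpha> + \<beta>"
  shows "hahn_coeff (a * b) \<nu> = 0"
proof (rule ccontr)
  assume "\<not> ?thesis"
  then have "\<nu> \<in> hahn_support (a * b)" by (simp add: hahn_support_def)
  then obtain x y where "x \<in> hahn_support a" "y \<in> hahn_support b" "\<nu> = x + y"
    using hahn_support_mult[of a b] by blast
  then have "\<alpha> < x" "\<beta> \<le> y" using assms(1,2) unfolding hahn_support_def by (force simp: not_le[symmetric])+
  then show False using assms(3) \<open>\<nu> = x + y\<close> by linarith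
qed

lemma hahn_coeff_mult_eq_0':
  fixes a b :: "'k::comm_ring_1 hahn"
  assumes "\<And>\<nu>. \<nu> < \<alpha> \<Longrightarrow> hahn_coeff a \<nu> = 0" "\<And>\<nu>. \<nu> < \<beta> \<Longrightarrow> hahn_coeff b \<nu> = 0" "\<nu> < \<alpha> + \<beta>"
  shows "hahn_coeff (a * b) \<nu> = 0"
  by (rule hahn_coeff_mult_eq_0[of "\<nu> - \<beta>" _ \<beta>]) (use assms in auto)

lemma hahn_val_mult:
  fixes a b :: "'k::field hahn"
  assumes "a \<noteq> 0" "b \<noteq> 0"
  shows "hahn_val (a * b) = hahn_val a + hahn_val b"
proof (rule hahn_val_eqI)
  let ?v = "hahn_val a + hahn_val b"
  have S: "{\<mu>. \<mu> \<in> hahn_support a \<and> ?v - \<mu> \<in> hahn_support b} = {hahn_val a}"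
    using hahn_val_exists[OF assms(1)] hahn_val_exists[OF assms(2)]
    by (force simp: hahn_support_def)
  show "hahn_coeff (a * b) ?v \<noteq> 0"
    unfolding hahn_coeff_mult S using hahn_coeff_val[OF assms(1)] hahn_coeff_val[OF assms(2)] by simp
  show "hahn_coeff (a * b) \<nu> = 0" if "\<nu> < ?v" for \<nu>
    by (rule hahn_coeff_mult_eq_0'[of "hahn_val a" _ "hahn_val b"]) (use that hahn_coeff_less_val assms in auto)
qed

definition mdot :: "real ^ 'n::finite \<Rightarrow> ('n \<Rightarrow>\<^sub>0 nat) \<Rightarrow> real" where
  "mdot \<omega> m = (\<Sum>i\<in>UNIV. \<omega> $ i * real (coef m i))"

lemma mdot_add: "mdot \<omega> (a + b) = mdot \<omega> a + mdot \<omega> b"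
  by (simp add: mdot_def lookup_add algebra_simps sum.distrib)

text \<open>Polynomials for which \<open>f(x\<^sub>1 t\<^sup>\<omega>\<^sup>1, \<dots>, x\<^sub>n t\<^sup>\<omega>\<^sup>n)\<close> has coefficients in the valuation ring.
  After multiplication by a suitable power of \<open>t\<close>, which keeps an ideal, the initial form is the residue of
  such a polynomial; unlike the initial form, this residue is additive in \<open>f\<close>.\<close>

definition integral_at :: "real ^ 'n::finite \<Rightarrow> ('n, 'k::field hahn) mpoly \<Rightarrow> bool" where
  "integral_at \<omega> f \<longleftrightarrow> (\<forall>m \<nu>. \<nu> < - mdot \<omega> m \<longrightarrow> hahn_coeff (coef f m) \<nu> = 0)"

definition residue_at :: "real ^ 'n::finite \<Rightarrow> ('n, 'k::field hahn) mpoly \<Rightarrow> ('n, 'k) mpoly" where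
  "residue_at \<omega> f = (\<Sum>m\<in>keys f. single m (hahn_coeff (coef f m) (- mdot \<omega> m)))"

lemma coef_residue_at [simp]: "coef (residue_at \<omega> f) m = hahn_coeff (coef f m) (- mdot \<omega> m)"
  by (auto simp: residue_at_def lookup_sum lookup_single when_def in_keys_iff)

definition term_weight :: "real ^ 'n::finite \<Rightarrow> ('n, 'k::field hahn) mpoly \<Rightarrow> ('n \<Rightarrow>\<^sub>0 nat) \<Rightarrow> real" where
  "term_weight \<omega> f m = hahn_val (coef f m) + mdot \<omega> m"

definition initial_support :: "real ^ 'n::finite \<Rightarrow> ('n, 'k::field hahn) mpoly \<Rightarrow> ('n \<Rightarrow>\<^sub>0 nat) set" where
  "initial_support \<omega> f =
    {m \<in> keys f. \<forall>l\<in>keys f. term_weight \<omega> f m \<le> term_weight \<omega> f l}"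

lemma trop_weight_eq: "trop_weight \<omega> f = Min (term_weight \<omega> f ` keys f)"
  by (simp add: trop_weight_def term_weight_def mdot_def)

lemma initial_support_iff:
  "m \<in> initial_support \<omega> f \<longleftrightarrow> m \<in> keys f \<and> term_weight \<omega> f m = trop_weight \<omega> f"
proof (cases "m \<in> keys f")
  case True
  then have "term_weight \<omega> f m = trop_weight \<omega> f \<longleftrightarrow> (\<forall>l\<in>keys f. term_weight \<omega> f m \<le> term_weight \<omega> f l)"
    unfolding trop_weight_eq by (subst eq_commute, subst Min_eq_iff) auto
  then show ?thesis using True by (simp add: initial_support_def)
qed (simp add: initial_support_def)

lemma trop_weight_le: "m \<in> keys f \<Longrightarrow> trop_weight \<omega> f \<le> term_weight \<omega> f m"
  unfolding trop_weight_eq by (intro Min_le) auto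

lemma initial_support_nonempty:
  assumes "f \<noteq> 0" shows "initial_support \<omega> f \<noteq> {}"
proof -
  have "keys f \<noteq> {}"
    using assms by (metis poly_mapping_sum_single sum.empty)
  then have "trop_weight \<omega> f \<in> term_weight \<omega> f ` keys f"
    unfolding trop_weight_eq by (intro Min_in) auto
  then obtain m where "m \<in> keys f" "term_weight \<omega> f m = trop_weight \<omega> f" by auto
  then show ?thesis using initial_support_iff by blast
qed

lemma single_power: "single u c ^ k = single (\<Sum>i<k. u) (c ^ k)"
  for c :: "'a::comm_ring_1" and u :: "'n \<Rightarrow>\<^sub>0 nat"
  by (induction k) (simp_all add: mult_single add.commute mult.commute)

lemma prod_single: "(\<Prod>i\<in>A. single (u i) (c i)) = single (\<Sum>i\<in>A. u i) (\<Prod>i\<in>A. c i)"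
  for c :: "'i \<Rightarrow> 'a::comm_ring_1" and u :: "'i \<Rightarrow> 'n \<Rightarrow>\<^sub>0 nat"
  by (induction A rule: infinite_finite_induct) (simp_all add: mult_single)

lemma hahn_monom_1_power: "hahn_monom (1 :: 'k::comm_ring_1) a ^ k = hahn_monom 1 (a * real k)"
  by (induction k) (simp_all add: one_hahn_def hahn_monom_mult algebra_simps)

lemma hahn_monom_1_prod: "(\<Prod>i\<in>A. hahn_monom (1 :: 'k::comm_ring_1) (a i)) = hahn_monom 1 (\<Sum>i\<in>A. a i)"
  by (induction A rule: infinite_finite_induct) (simp_all add: one_hahn_def hahn_monom_mult)

lemma substituted_monomial:
  "(\<Prod>i\<in>UNIV. (mconst (hahn_monom (1 :: 'k::field) (\<omega> $ i)) * mvar i) ^ coef m i) =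
    single m (hahn_monom 1 (mdot \<omega> m))" for \<omega> :: "real ^ 'n::finite"
proof -
  have "(mconst (hahn_monom (1 :: 'k) (\<omega> $ i)) * mvar i) ^ coef m i =
      single (\<Sum>k<coef m i. single i 1) (hahn_monom 1 (\<omega> $ i * real (coef m i)))" for i
    by (simp only: mconst_def mvar_def mult_single single_power hahn_monom_1_power add_0_left mult_1_right)
  moreover have "(\<Sum>i\<in>UNIV. \<Sum>k<coef m i. single i 1) = m"
    by (rule poly_mapping_eqI) (simp add: lookup_sum lookup_single when_def if_distrib cong: if_cong)
  ultimately show ?thesis by (simp add: prod_single hahn_monom_1_prod mdot_def)
qed

lemma coef_initial_form:
  assumes "f \<noteq> 0"
  shows "coef (initial_form \<omega> f) m = hahn_coeff (coef f m) (trop_weight \<omega> f - mdot \<omega> m)"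
proof -
  have "msubst mconst (\<lambda>i. mconst (hahn_monom 1 (\<omega> $ i)) * mvar i) f =
      (\<Sum>m\<in>keys f. single m (coef f m * hahn_monom 1 (mdot \<omega> m)))"
    by (simp add: msubst_def substituted_monomial) (simp add: mconst_def mult_single)
  then have "coef (mconst (hahn_monom 1 (- trop_weight \<omega> f)) *
      msubst mconst (\<lambda>i. mconst (hahn_monom 1 (\<omega> $ i)) * mvar i) f) m =
      hahn_monom 1 (- trop_weight \<omega> f) * (hahn_monom 1 (mdot \<omega> m) * coef f m)"
    by (auto simp: lookup_sum lookup_single when_def in_keys_iff mult.commute)
  moreover have "coef (Poly_Mapping.map (\<lambda>a. hahn_coeff a 0) p) m = hahn_coeff (coef p m) 0"
    for p :: "('a, 'b hahn) mpoly"
    by (simp add: Poly_Mapping.map.rep_eq when_def)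
  ultimately have "coef (initial_form \<omega> f) m =
      hahn_coeff (hahn_monom 1 (- trop_weight \<omega> f) * (hahn_monom 1 (mdot \<omega> m) * coef f m)) 0"
    using assms by (simp only: initial_form_def if_False)
  then show ?thesis by (simp only: hahn_coeff_monom_mult) simp
qed

lemma coef_initial_form_support:
  "coef (initial_form \<omega> f) m = (if m \<in> initial_support \<omega> f then hahn_coeff (coef f m) (hahn_val (coef f m)) else 0)"
proof (cases "f = 0")
  case True then show ?thesis by (simp add: initial_form_def initial_support_def)
next
  case False
  show ?thesis
  proof (cases "m \<in> keys f")
    case True
    then have nz: "coef f m \<noteq> 0" by (simp add: in_keys_iff)
    show ?thesis
    proof (cases "m \<in> initial_support \<omega> f")
      case True
      then have "trop_weight \<omega> f - mdot \<omega> m = hahn_val (coef f m)"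
        by (simp add: initial_support_iff term_weight_def)
      then show ?thesis using True by (simp add: coef_initial_form[OF \<open>f \<noteq> 0\<close>])
    next
      case False
      then have "trop_weight \<omega> f < term_weight \<omega> f m"
        using True trop_weight_le[OF True, of \<omega>] initial_support_iff[of m \<omega> f] by fastforce
      then show ?thesis
        using False hahn_coeff_less_val[OF nz] by (simp add: coef_initial_form[OF \<open>f \<noteq> 0\<close>] term_weight_def)
    qed
  next
    case False
    then show ?thesis by (simp add: coef_initial_form[OF \<open>f \<noteq> 0\<close>] in_keys_iff initial_support_def)
  qed
qed

lemma coef_initial_form_nonzero_iff: "coef (initial_form \<omega> f) m \<noteq> 0 \<longleftrightarrow> m \<in> initial_support \<omega> f"
  unfolding coef_initial_form_support
  using hahn_coeff_val[of "coef f m"] by (auto simp: initial_support_def in_keys_iff)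

lemma initial_form_eq_0_iff: "initial_form \<omega> f = 0 \<longleftrightarrow> f = 0"
proof
  assume "initial_form \<omega> f = 0"
  then have "initial_support \<omega> f = {}" using coef_initial_form_nonzero_iff[of \<omega> f] by fastforce
  then show "f = 0" using initial_support_nonempty by blast
qed (simp add: initial_form_def)

lemma integral_at_normalized: "integral_at \<omega> (mconst (hahn_monom 1 (- trop_weight \<omega> f)) * f)"
  unfolding integral_at_def
proof (intro allI impI)
  fix m \<nu> assume \<nu>: "\<nu> < - mdot \<omega> m"
  show "hahn_coeff (coef (mconst (hahn_monom 1 (- trop_weight \<omega> f)) * f) m) \<nu> = 0"
  proof (cases "coef f m = 0")
    case False
    then have "trop_weight \<omega> f \<le> term_weight \<omega> f m" by (intro trop_weight_le) (simp add: in_keys_iff)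
    then show ?thesis
      using \<nu> hahn_coeff_less_val[OF False] by (simp add: hahn_coeff_monom_mult term_weight_def)
  qed simp
qed

lemma initial_form_eq_residue:
  "initial_form \<omega> f = residue_at \<omega> (mconst (hahn_monom 1 (- trop_weight \<omega> f)) * f)"
proof (cases "f = 0")
  case True then show ?thesis by (simp add: initial_form_def residue_at_def)
next
  case False then show ?thesis
    by (intro poly_mapping_eqI) (simp add: coef_initial_form hahn_coeff_monom_mult)
qed

lemma residue_eq_initial_form:
  assumes "integral_at \<omega> f" "residue_at \<omega> f \<noteq> 0"
  shows "residue_at \<omega> f = initial_form \<omega> f"
proof -
  have f: "f \<noteq> 0" using assms(2) by (auto simp: residue_at_def)
  obtain m where m: "hahn_coeff (coef f m) (- mdot \<omega> m) \<noteq> 0"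
    using assms(2) by (metis coef_residue_at lookup_zero poly_mapping_eqI)
  have ge: "- mdot \<omega> l \<le> hahn_val (coef f l)" if "coef f l \<noteq> 0" for l
    using assms(1) hahn_coeff_val[OF that] unfolding integral_at_def by (metis not_le)
  have mk: "m \<in> keys f" using m by (auto simp: in_keys_iff)
  have "hahn_val (coef f m) = - mdot \<omega> m"
    by (rule hahn_val_eqI) (use m assms(1) in \<open>auto simp: integral_at_def\<close>)
  then have "term_weight \<omega> f m = 0" by (simp add: term_weight_def)
  moreover have "\<forall>l\<in>keys f. 0 \<le> term_weight \<omega> f l"
    using ge by (force simp: term_weight_def in_keys_iff)
  ultimately have "m \<in> initial_support \<omega> f" using mk by (simp add: initial_support_def)
  then have "trop_weight \<omega> f = 0" using \<open>term_weight \<omega> f m = 0\<close> by (simp add: initial_support_iff)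
  then show ?thesis by (intro poly_mapping_eqI) (simp add: coef_initial_form[OF f])
qed

definition residues :: "real ^ 'n::finite \<Rightarrow> ('n, 'k::field hahn) mpoly set \<Rightarrow> ('n, 'k) mpoly set" where
  "residues \<omega> W = residue_at \<omega> ` {f \<in> W. integral_at \<omega> f}"

lemma integral_at_add: "integral_at \<omega> f \<Longrightarrow> integral_at \<omega> g \<Longrightarrow> integral_at \<omega> (f + g)"
  by (simp add: integral_at_def lookup_add)

lemma residue_at_add: "residue_at \<omega> (f + g) = residue_at \<omega> f + residue_at \<omega> g"
  by (rule poly_mapping_eqI) (simp add: lookup_add)

lemma residuesI: "f \<in> W \<Longrightarrow> integral_at \<omega> f \<Longrightarrow> g = residue_at \<omega> f \<Longrightarrow> g \<in> residues \<omega> W"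
  by (simp add: residues_def)

lemma residuesE: "g \<in> residues \<omega> W \<Longrightarrow> (\<And>f. f \<in> W \<Longrightarrow> integral_at \<omega> f \<Longrightarrow> g = residue_at \<omega> f \<Longrightarrow> thesis) \<Longrightarrow> thesis"
  by (auto simp: residues_def)

lemma residues_zero: "0 \<in> W \<Longrightarrow> 0 \<in> residues \<omega> W"
  by (rule residuesI[of 0]) (auto simp: integral_at_def residue_at_def)

lemma residues_add:
  assumes "\<And>f g. f \<in> W \<Longrightarrow> g \<in> W \<Longrightarrow> f + g \<in> W" "g \<in> residues \<omega> W" "h \<in> residues \<omega> W"
  shows "g + h \<in> residues \<omega> W"
proof -
  obtain a b where "a \<in> W" "integral_at \<omega> a" "g = residue_at \<omega> a" "b \<in> W" "integral_at \<omega> b" "h = residue_at \<omega> b"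
    using assms(2,3) by (metis residuesE)
  then show ?thesis by (intro residuesI[of "a + b"]) (simp_all add: assms(1) integral_at_add residue_at_add)
qed

lemma residue_single_mult:
  fixes f :: "('n::finite, 'k::field hahn) mpoly"
  assumes "integral_at \<omega> f"
  shows "integral_at \<omega> (single u (hahn_monom c (- mdot \<omega> u)) * f)"
    and "residue_at \<omega> (single u (hahn_monom c (- mdot \<omega> u)) * f) = single u c * residue_at \<omega> f"
proof -
  let ?g = "single u (hahn_monom c (- mdot \<omega> u)) * f"
  have 1: "hahn_coeff (coef ?g (u + m)) \<nu> = c * hahn_coeff (coef f m) (\<nu> + mdot \<omega> u)" for m \<nu>
    by (simp add: coef_single_mult_add hahn_coeff_monom_mult)
  show "integral_at \<omega> ?g"
    unfolding integral_at_def
  proof (intro allI impI)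
    fix a \<nu> assume "\<nu> < - mdot \<omega> a"
    show "hahn_coeff (coef ?g a) \<nu> = 0"
    proof (cases "\<exists>m. a = u + m")
      case True
      then obtain m where m: "a = u + m" by blast
      then have "\<nu> + mdot \<omega> u < - mdot \<omega> m" using \<open>\<nu> < - mdot \<omega> a\<close> by (simp add: mdot_add)
      then show ?thesis using assms unfolding m 1 by (simp add: integral_at_def)
    qed (simp add: coef_single_mult_eq_0)
  qed
  show "residue_at \<omega> ?g = single u c * residue_at \<omega> f"
  proof (rule poly_mapping_eqI)
    fix a show "coef (residue_at \<omega> ?g) a = coef (single u c * residue_at \<omega> f) a"
    proof (cases "\<exists>m. a = u + m")
      case True
      then obtain m where m: "a = u + m" by blast
      show ?thesis unfolding m coef_residue_at 1 by (simp add: coef_single_mult_add mdot_add)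
    qed (simp add: coef_single_mult_eq_0)
  qed
qed

lemma subspace_residues:
  assumes "mpoly_vs.subspace W"
  shows "mpoly_vs.subspace (residues \<omega> W)"
  unfolding mpoly_vs.subspace_def
proof (intro conjI ballI allI)
  show "0 \<in> residues \<omega> W" using assms mpoly_vs.subspace_0 residues_zero by blast
  show "g + h \<in> residues \<omega> W" if "g \<in> residues \<omega> W" "h \<in> residues \<omega> W" for g h
    by (rule residues_add[OF mpoly_vs.subspace_add[OF assms] that])
  fix g c assume "g \<in> residues \<omega> W"
  then obtain f where f: "f \<in> W" "integral_at \<omega> f" "g = residue_at \<omega> f" by (rule residuesE)
  have "mdot \<omega> 0 = 0" by (simp add: mdot_def)
  then show "mconst c * g \<in> residues \<omega> W"
    using residue_single_mult[OF f(2), of 0 c] mpoly_vs.subspace_scale[OF assms f(1), of "hahn_monom c 0"]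
    by (intro residuesI[of "mconst (hahn_monom c 0) * f"]) (simp_all add: f(3) mconst_def)
qed

lemma initial_form_in_residues: "mpoly_vs.subspace W \<Longrightarrow> f \<in> W \<Longrightarrow> initial_form \<omega> f \<in> residues \<omega> W"
  by (rule residuesI[OF mpoly_vs.subspace_scale integral_at_normalized initial_form_eq_residue])

text \<open>The monomial \<open>c x\<^sup>u\<close> lifts to \<open>c t\<^sup>- \<^sup>\<omega>\<^sup>\<cdot>\<^sup>u x\<^sup>u\<close>, so the residues are closed under multiplication without
  passing to generated ideals.\<close>

lemma ideal_residues:
  assumes "ideal I type_ring"
  shows "ideal (residues \<omega> I) type_ring"
  unfolding ideal_type_ring_iff
proof (intro conjI ballI allI)
  note I = ideal_type_ringD[OF assms]
  show z: "0 \<in> residues \<omega> I" by (rule residues_zero[OF I(1)])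
  show a: "g + h \<in> residues \<omega> I" if "g \<in> residues \<omega> I" "h \<in> residues \<omega> I" for g h
    by (rule residues_add[OF I(2) that])
  fix g q assume "g \<in> residues \<omega> I"
  then obtain f where f: "f \<in> I" "integral_at \<omega> f" "g = residue_at \<omega> f" by (rule residuesE)
  have s: "single u c * g \<in> residues \<omega> I" for u c
    by (rule residuesI[OF I(3)[OF f(1)] residue_single_mult(1)[OF f(2)]])
      (simp add: f(3) residue_single_mult(2)[OF f(2)])
  have "(\<Sum>u\<in>A. single u (coef q u) * g) \<in> residues \<omega> I" for A
    by (induction A rule: infinite_finite_induct) (simp_all add: z a s)
  then have "(\<Sum>u\<in>keys q. single u (coef q u)) * g \<in> residues \<omega> I"
    by (simp add: sum_distrib_right)
  then show "q * g \<in> residues \<omega> I" by (simp only: poly_mapping_sum_single[symmetric])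
qed

lemma initial_ideal_eq_residues:
  assumes "ideal I type_ring"
  shows "initial_ideal \<omega> I = residues \<omega> I"
proof
  show "initial_ideal \<omega> I \<subseteq> residues \<omega> I"
    unfolding initial_ideal_def
    by (intro genideal_least[OF ideal_residues[OF assms]] image_subsetI
        initial_form_in_residues[OF subspace_ideal[OF assms]])
  show "residues \<omega> I \<subseteq> initial_ideal \<omega> I"
  proof
    fix g assume "g \<in> residues \<omega> I"
    then obtain f where f: "f \<in> I" "integral_at \<omega> f" "g = residue_at \<omega> f" by (rule residuesE)
    show "g \<in> initial_ideal \<omega> I"
    proof (cases "g = 0")
      case True
      then show ?thesis by (simp only: initial_ideal_def ideal_type_ringD(1)[OF ideal_genideal])
    next
      case False
      then have "g = initial_form \<omega> f" using residue_eq_initial_form[OF f(2)] f(3) by simp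
      then show ?thesis unfolding initial_ideal_def
        using subsetD[OF subset_genideal imageI[OF f(1), of "initial_form \<omega>"]] by simp
    qed
  qed
qed

lemma hom_component_residue_at: "hom_component d (residue_at \<omega> f) = residue_at \<omega> (hom_component d f)"
  by (rule poly_mapping_eqI) simp

lemma integral_at_hom_component: "integral_at \<omega> f \<Longrightarrow> integral_at \<omega> (hom_component d f)"
  by (simp add: integral_at_def)

lemma graded_initial_ideal:
  assumes "graded_ideal I"
  shows "graded_ideal (initial_ideal \<omega> I)"
  unfolding graded_ideal_def initial_ideal_eq_residues[OF graded_ideal_ideal[OF assms]]
proof (intro conjI ballI allI)
  show "ideal (residues \<omega> I) type_ring" by (rule ideal_residues[OF graded_ideal_ideal[OF assms]])
  fix g d assume "g \<in> residues \<omega> I"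
  then obtain f where f: "f \<in> I" "integral_at \<omega> f" "g = residue_at \<omega> f" by (rule residuesE)
  have "hom_component d f \<in> I" using assms f(1) by (simp add: graded_ideal_def)
  then show "hom_component d g \<in> residues \<omega> I"
    by (rule residuesI[OF _ integral_at_hom_component[OF f(2)]]) (simp add: f(3) hom_component_residue_at)
qed

lemma degree_part_initial_ideal:
  assumes "graded_ideal I"
  shows "degree_part (initial_ideal \<omega> I) d = residues \<omega> (degree_part I d)"
proof (intro equalityI subsetI)
  fix g assume g: "g \<in> degree_part (initial_ideal \<omega> I) d"
  then have "g \<in> residues \<omega> I"
    by (simp add: degree_part_def initial_ideal_eq_residues[OF graded_ideal_ideal[OF assms]])
  then obtain f where f: "f \<in> I" "integral_at \<omega> f" "g = residue_at \<omega> f" by (rule residuesE)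
  have "hom_component d g = g" using g unfolding degree_part_def mem_Collect_eq keys_subset_mons_iff by (rule conjunct2)
  then have "g = residue_at \<omega> (hom_component d f)" by (simp add: f(3) hom_component_residue_at)
  then show "g \<in> residues \<omega> (degree_part I d)"
    by (rule residuesI[OF hom_component_in_degree_part[OF assms f(1)] integral_at_hom_component[OF f(2)]])
next
  fix g assume "g \<in> residues \<omega> (degree_part I d)"
  then obtain f where f: "f \<in> degree_part I d" "integral_at \<omega> f" "g = residue_at \<omega> f" by (rule residuesE)
  have fI: "f \<in> I" "hom_component d f = f"
    using f(1) unfolding degree_part_def mem_Collect_eq keys_subset_mons_iff by (rule conjunct1, rule conjunct2)
  have "g \<in> residues \<omega> I" using fI(1) f(2,3) by (rule residuesI)
  moreover have "hom_component d g = g" by (simp add: f(3) hom_component_residue_at fI(2))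
  ultimately show "g \<in> degree_part (initial_ideal \<omega> I) d"
    unfolding degree_part_def mem_Collect_eq keys_subset_mons_iff
      initial_ideal_eq_residues[OF graded_ideal_ideal[OF assms]] by (rule conjI)
qed

section \<open>Pivot sets of initial spaces\<close>

text \<open>With coefficient \<open>1\<close> at \<open>j\<close>, the weight of \<open>f\<close> is attained at \<open>j\<close>. In this form the condition is linear
  in \<open>f\<close>.\<close>

definition dominated_by :: "real ^ 'n::finite \<Rightarrow> ('n \<Rightarrow>\<^sub>0 nat) \<Rightarrow> ('n, 'k::field hahn) mpoly \<Rightarrow> bool" where
  "dominated_by \<omega> j f \<longleftrightarrow> (\<forall>m \<nu>. \<nu> < mdot \<omega> j - mdot \<omega> m \<longrightarrow> hahn_coeff (coef f m) \<nu> = 0)"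

lemma dominated_by_normalized:
  assumes "j \<in> initial_support \<omega> f"
  shows "dominated_by \<omega> j (mconst (inverse (coef f j)) * f)"
  unfolding dominated_by_def
proof (intro allI impI)
  fix m \<nu> assume \<nu>: "\<nu> < mdot \<omega> j - mdot \<omega> m"
  have j: "coef f j \<noteq> 0" using assms by (simp add: initial_support_def in_keys_iff)
  let ?a = "coef (mconst (inverse (coef f j)) * f) m"
  show "hahn_coeff ?a \<nu> = 0"
  proof (cases "coef f m = 0")
    case False
    then have a: "?a \<noteq> 0" using j by simp
    have "?a * coef f j = coef f m" using j by simp
    then have "hahn_val ?a + hahn_val (coef f j) = hahn_val (coef f m)"
      using hahn_val_mult[OF a j] by metis
    moreover have "term_weight \<omega> f j \<le> term_weight \<omega> f m"
      using assms False by (simp add: initial_support_def in_keys_iff)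
    ultimately have "\<nu> < hahn_val ?a" using \<nu> by (simp add: term_weight_def)
    then show ?thesis by (rule hahn_coeff_less_val[OF a])
  qed simp
qed

lemma dominated_by_diff: "dominated_by \<omega> j f \<Longrightarrow> dominated_by \<omega> j g \<Longrightarrow> dominated_by \<omega> j (f - g)"
  by (simp add: dominated_by_def lookup_minus)

lemma dominated_by_sum: "(\<And>i. i \<in> A \<Longrightarrow> dominated_by \<omega> j (f i)) \<Longrightarrow> dominated_by \<omega> j (sum f A)"
  by (simp add: dominated_by_def lookup_sum hahn_coeff_sum)

lemma dominated_by_mult:
  assumes f: "dominated_by \<omega> j f" and g: "dominated_by \<omega> i g"
  shows "dominated_by \<omega> j (mconst (coef f i) * g)"
  unfolding dominated_by_def coef_mconst_mult
proof (intro allI impI)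
  fix m \<nu> assume "\<nu> < mdot \<omega> j - mdot \<omega> m"
  then have \<nu>: "\<nu> < (mdot \<omega> j - mdot \<omega> i) + (mdot \<omega> i - mdot \<omega> m)" by simp
  show "hahn_coeff (coef f i * coef g m) \<nu> = 0"
    by (rule hahn_coeff_mult_eq_0'[OF _ _ \<nu>]) (use f g in \<open>simp_all add: dominated_by_def\<close>)
qed

text \<open>Gaussian elimination in which the pivot of a row is a coordinate where the row attains its weight.\<close>

lemma dominated_pivots_exist:
  fixes W :: "('n::finite, 'k::field hahn) mpoly set"
  assumes "finite N" "mpoly_vs.subspace W" "\<forall>f\<in>W. keys f \<subseteq> N"
  shows "\<exists>J b. J \<subseteq> N \<and> (\<forall>f\<in>W. (\<forall>j\<in>J. coef f j = 0) \<longrightarrow> f = 0) \<and>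
    (\<forall>j\<in>J. b j \<in> W \<and> dominated_by \<omega> j (b j) \<and> (\<forall>i\<in>J. coef (b j) i = (if i = j then 1 else 0)))"
  using assms
proof (induction N arbitrary: W rule: finite_psubset_induct)
  case (psubset N)
  note sub = psubset.prems(1)
  show ?case
  proof (cases "\<exists>f\<in>W. f \<noteq> 0")
    case False
    then show ?thesis by (intro exI[of _ "{}"] exI[of _ "\<lambda>_. 0"]) simp
  next
    case True
    then obtain f0 where f0: "f0 \<in> W" "f0 \<noteq> 0" by (rule bexE)
    obtain j where j: "j \<in> initial_support \<omega> f0" using initial_support_nonempty[OF f0(2)] by blast
    have jk: "j \<in> keys f0" using j by (simp add: initial_support_def)
    have jN: "j \<in> N" using bspec[OF psubset.prems(2) f0(1)] jk by (rule subsetD)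
    have f0j: "coef f0 j \<noteq> 0" using jk by (simp add: in_keys_iff)
    define f where "f = mconst (inverse (coef f0 j)) * f0"
    have f: "f \<in> W" "coef f j = 1" "dominated_by \<omega> j f"
      unfolding f_def using mpoly_vs.subspace_scale[OF sub f0(1)] f0j dominated_by_normalized[OF j] by simp_all
    define W1 where "W1 = {h \<in> W. coef h j = 0}"
    have sub1: "mpoly_vs.subspace W1"
      using sub by (simp add: W1_def mpoly_vs.subspace_def lookup_add)
    have keys1: "\<forall>h\<in>W1. keys h \<subseteq> N - {j}"
    proof
      fix h assume "h \<in> W1"
      then have "h \<in> W" "j \<notin> keys h" by (simp_all add: W1_def in_keys_iff)
      with bspec[OF psubset.prems(2) this(1)] show "keys h \<subseteq> N - {j}" by blast
    qed
    have "N - {j} \<subset> N" using jN by blast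
    from psubset.IH[OF this sub1 keys1] obtain J b where J: "J \<subseteq> N - {j}"
      and zero: "\<forall>f\<in>W1. (\<forall>j\<in>J. coef f j = 0) \<longrightarrow> f = 0"
      and b: "\<forall>k\<in>J. b k \<in> W1 \<and> dominated_by \<omega> k (b k) \<and> (\<forall>i\<in>J. coef (b k) i = (if i = k then 1 else 0))"
      by (elim exE conjE)
    have finJ: "finite J" using J psubset.hyps by (meson finite_Diff finite_subset)
    have jJ: "j \<notin> J" using J by blast
    have b1: "b k \<in> W" "coef (b k) j = 0" "dominated_by \<omega> k (b k)" if "k \<in> J" for k
      using bspec[OF b that] by (simp_all add: W1_def)
    have b2: "coef (b k) i = (if i = k then 1 else 0)" if "k \<in> J" "i \<in> J" for k i
      using bspec[OF b that(1)] that(2) by simp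
    define f' where "f' = f - (\<Sum>i\<in>J. mconst (coef f i) * b i)"
    have f'W: "f' \<in> W" unfolding f'_def
      by (intro mpoly_vs.subspace_diff[OF sub] mpoly_vs.subspace_sum[OF sub] mpoly_vs.subspace_scale[OF sub] b1(1) f(1))
    have f'd: "dominated_by \<omega> j f'" unfolding f'_def
      by (intro dominated_by_diff dominated_by_sum dominated_by_mult f(3) b1(3))
    have f'j: "coef f' j = 1" using b1(2) f(2) by (simp add: f'_def lookup_minus lookup_sum)
    have f'J: "coef f' i = 0" if "i \<in> J" for i
      using that finJ by (simp add: f'_def lookup_minus lookup_sum b2 if_distrib cong: if_cong)
    define c where "c k = (if k = j then f' else b k)" for k
    have "insert j J \<subseteq> N" using J jN by blast
    moreover have "\<forall>h\<in>W. (\<forall>k\<in>insert j J. coef h k = 0) \<longrightarrow> h = 0"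
    proof (intro ballI impI)
      fix h assume h: "h \<in> W" "\<forall>k\<in>insert j J. coef h k = 0"
      then have "h \<in> W1" by (simp add: W1_def)
      then show "h = 0" using zero h(2) by simp
    qed
    moreover have "\<forall>k\<in>insert j J. c k \<in> W \<and> dominated_by \<omega> k (c k) \<and>
        (\<forall>i\<in>insert j J. coef (c k) i = (if i = k then 1 else 0))"
    proof (rule ballI)
      fix k assume k: "k \<in> insert j J"
      show "c k \<in> W \<and> dominated_by \<omega> k (c k) \<and> (\<forall>i\<in>insert j J. coef (c k) i = (if i = k then 1 else 0))"
      proof (cases "k = j")
        case True
        then show ?thesis using f'W f'd f'j f'J jJ by (auto simp: c_def)
      next
        case False
        then have kJ: "k \<in> J" using k by simp
        then show ?thesis using False b1[OF kJ] b2[OF kJ] by (auto simp: c_def)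
      qed
    qed
    ultimately show ?thesis by (intro exI[of _ "insert j J"] exI[of _ c]) simp
  qed
qed

text \<open>An element of \<open>W\<close> is the combination of the \<open>b j\<close> with its own coordinates in \<open>J\<close> as coefficients. If these
  have positive valuation after the substitution by \<open>\<omega>\<close>, so have, by dominance, all coordinates.\<close>

lemma pivot_set_residues:
  fixes W :: "('n::finite, 'k::field hahn) mpoly set"
  assumes sub: "mpoly_vs.subspace W" and fin: "finite J"
    and zero: "\<And>f. f \<in> W \<Longrightarrow> \<forall>j\<in>J. coef f j = 0 \<Longrightarrow> f = 0"
    and bW: "\<And>j. j \<in> J \<Longrightarrow> b j \<in> W" and dom: "\<And>j. j \<in> J \<Longrightarrow> dominated_by \<omega> j (b j)"
    and b1: "\<And>j i. j \<in> J \<Longrightarrow> i \<in> J \<Longrightarrow> coef (b j) i = (if i = j then 1 else 0)"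
  shows "pivot_set (residues \<omega> W) J"
proof (rule pivot_setI)
  fix g assume g: "g \<in> residues \<omega> W" "\<forall>j\<in>J. coef g j = 0"
  obtain f where f: "f \<in> W" "integral_at \<omega> f" "g = residue_at \<omega> f" using g(1) by (rule residuesE)
  have exp: "f = (\<Sum>j\<in>J. mconst (coef f j) * b j)"
    by (rule pivot_expansion[OF sub fin]) (rule f(1) bW b1 zero | assumption)+
  show "g = 0"
  proof (rule poly_mapping_eqI)
    fix m
    have "hahn_coeff (coef f j * coef (b j) m) (- mdot \<omega> m) = 0" if j: "j \<in> J" for j
    proof (rule hahn_coeff_mult_eq_0[of "- mdot \<omega> j" _ "mdot \<omega> j - mdot \<omega> m"])
      fix \<nu> assume "\<nu> \<le> - mdot \<omega> j"
      moreover have "hahn_coeff (coef f j) (- mdot \<omega> j) = 0" using bspec[OF g(2) j] by (simp add: f(3))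
      ultimately show "hahn_coeff (coef f j) \<nu> = 0"
        using f(2) unfolding integral_at_def by (metis order_le_less)
    qed (use dom[OF j] in \<open>simp_all add: dominated_by_def\<close>)
    moreover have "coef f m = (\<Sum>j\<in>J. coef f j * coef (b j) m)"
      by (subst exp) (simp add: lookup_sum)
    ultimately have "hahn_coeff (coef f m) (- mdot \<omega> m) = 0" by (simp add: hahn_coeff_sum)
    then show "coef g m = coef 0 m" by (simp add: f(3))
  qed
next
  fix j assume j: "j \<in> J"
  let ?f = "mconst (hahn_monom 1 (- mdot \<omega> j)) * b j"
  have "integral_at \<omega> ?f"
    using dom[OF j] by (simp add: integral_at_def dominated_by_def hahn_coeff_monom_mult)
  then have "residue_at \<omega> ?f \<in> residues \<omega> W"
    by (rule residuesI[OF mpoly_vs.subspace_scale[OF sub bW[OF j]] _ refl])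
  moreover have "\<forall>i\<in>J. coef (residue_at \<omega> ?f) i = (if i = j then 1 else 0)"
    using j by (simp add: hahn_coeff_monom_mult b1 hahn_coeff_1)
  ultimately show "\<exists>g\<in>residues \<omega> W. \<forall>i\<in>J. coef g i = (if i = j then 1 else 0)" by (rule bexI[rotated])
qed

lemma dim_residues:
  fixes W :: "('n::finite, 'k::field hahn) mpoly set"
  assumes fin: "finite N" and sub: "mpoly_vs.subspace W" and keys: "\<forall>f\<in>W. keys f \<subseteq> N"
  shows "mpoly_vs.dim (residues \<omega> W) = mpoly_vs.dim W"
proof -
  obtain J b where J: "J \<subseteq> N" and zero: "\<forall>f\<in>W. (\<forall>j\<in>J. coef f j = 0) \<longrightarrow> f = 0"
    and b: "\<forall>j\<in>J. b j \<in> W \<and> dominated_by \<omega> j (b j) \<and> (\<forall>i\<in>J. coef (b j) i = (if i = j then 1 else 0))"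
    using dominated_pivots_exist[OF assms, of \<omega>] by (elim exE conjE)
  have finJ: "finite J" using J fin by (rule finite_subset)
  have "\<forall>j\<in>J. \<exists>f\<in>W. \<forall>i\<in>J. coef f i = (if i = j then 1 else 0)"
  proof
    fix j assume "j \<in> J"
    from bspec[OF b this] show "\<exists>f\<in>W. \<forall>i\<in>J. coef f i = (if i = j then 1 else 0)" by (elim conjE bexI[rotated])
  qed
  with zero have "pivot_set W J" unfolding pivot_set_def by (rule conjI)
  moreover have "pivot_set (residues \<omega> W) J"
    by (rule pivot_set_residues[OF sub finJ, of b]) (use zero b in simp_all)
  ultimately show ?thesis
    using pivot_set_dim[OF sub finJ] pivot_set_dim[OF subspace_residues[OF sub] finJ] by simp
qed

lemma degree_part_keys: "f \<in> degree_part P d \<Longrightarrow> keys f \<subseteq> mons d"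
  by (simp add: degree_part_def)

lemma hilbert_initial_ideal:
  fixes I :: "('n::finite, 'k::field hahn) mpoly set"
  assumes "graded_ideal I"
  shows "hilbert (initial_ideal \<omega> I) = hilbert I"
proof
  fix d show "hilbert (initial_ideal \<omega> I) d = hilbert I d"
    unfolding hilbert_def degree_part_initial_ideal[OF assms]
    by (rule dim_residues[OF finite_mons[of d] subspace_degree_part[OF subspace_ideal[OF graded_ideal_ideal[OF assms]]]])
      (simp add: degree_part_keys)
qed

text \<open>A nonzero \<open>f \<in> W\<close> has a nonzero initial form, which does not vanish on \<open>J\<close>. If \<open>f\<close> itself is supported in
  \<open>J\<close> at \<open>j\<close> alone, its weight must therefore be attained at \<open>j\<close>.\<close>

lemma pivot_set_of_residues:
  fixes W :: "('n::finite, 'k::field hahn) mpoly set"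
  assumes N: "finite N" "J \<subseteq> N" and sub: "mpoly_vs.subspace W" and keys: "\<forall>f\<in>W. keys f \<subseteq> N"
    and J: "pivot_set (residues \<omega> W) J"
  shows "pivot_set W J"
    and "\<And>f j. f \<in> W \<Longrightarrow> f \<noteq> 0 \<Longrightarrow> \<forall>i\<in>J. i \<noteq> j \<longrightarrow> coef f i = 0 \<Longrightarrow> j \<in> initial_support \<omega> f"
proof -
  have finJ: "finite J" using N finite_subset by blast
  have init: "\<exists>i\<in>J. i \<in> initial_support \<omega> f" if f: "f \<in> W" "f \<noteq> 0" for f
  proof (rule ccontr)
    assume "\<not> ?thesis"
    then have "\<forall>i\<in>J. coef (initial_form \<omega> f) i = 0" using coef_initial_form_nonzero_iff by blast
    then have "initial_form \<omega> f = 0" by (rule pivot_set_zero[OF J initial_form_in_residues[OF sub f(1)]])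
    then show False using f(2) by (simp add: initial_form_eq_0_iff)
  qed
  show "j \<in> initial_support \<omega> f" if f: "f \<in> W" "f \<noteq> 0" "\<forall>i\<in>J. i \<noteq> j \<longrightarrow> coef f i = 0" for f j
  proof -
    obtain i where i: "i \<in> J" "i \<in> initial_support \<omega> f" using init[OF f(1,2)] by blast
    then have "coef f i \<noteq> 0" by (simp add: initial_support_def in_keys_iff)
    then have "i = j" using f(3) i(1) by blast
    then show ?thesis using i(2) by simp
  qed
  show "pivot_set W J"
  proof (rule pivot_set_if_card_eq_dim[OF sub finJ])
    show "f = 0" if f: "f \<in> W" "\<forall>j\<in>J. coef f j = 0" for f
    proof (rule ccontr)
      assume "f \<noteq> 0"
      then obtain i where "i \<in> J" "i \<in> initial_support \<omega> f" using init[OF f(1)] by blast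
      then show False using f(2) by (simp add: initial_support_def in_keys_iff)
    qed
    show "card J = mpoly_vs.dim W"
      using pivot_set_dim[OF subspace_residues[OF sub] finJ J] dim_residues[OF N(1) sub keys] by simp
  qed
qed

text \<open>Below, \<open>\<J>\<close> are the pivot sets of a space \<open>W\<close> of forms, and \<open>F J j\<close> spans the line in \<open>W\<close> of
  all forms that vanish on \<open>J - {j}\<close>. The optimal pivot sets are those of the initial space.
  Optimality, equality of initial spaces and the monomials in an initial space depend only on the
  supports and the valuations of the coefficients of the forms \<open>F J j\<close>.\<close>

definition optimal :: "('n::finite \<Rightarrow>\<^sub>0 nat) set set \<Rightarrow> (('n \<Rightarrow>\<^sub>0 nat) set \<Rightarrow> ('n \<Rightarrow>\<^sub>0 nat) \<Rightarrow> ('n, 'k::field hahn) mpoly) \<Rightarrow>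
    real ^ 'n \<Rightarrow> ('n \<Rightarrow>\<^sub>0 nat) set \<Rightarrow> bool" where
  "optimal \<J> F \<omega> J \<longleftrightarrow> J \<in> \<J> \<and> (\<forall>j\<in>J. j \<in> initial_support \<omega> (F J j))"

locale pivot_forms =
  fixes W :: "('n::finite, 'k::field hahn) mpoly set" and d :: nat
    and \<J> :: "('n \<Rightarrow>\<^sub>0 nat) set set" and F :: "('n \<Rightarrow>\<^sub>0 nat) set \<Rightarrow> ('n \<Rightarrow>\<^sub>0 nat) \<Rightarrow> ('n, 'k hahn) mpoly"
  assumes subspace: "mpoly_vs.subspace W" and keys: "f \<in> W \<Longrightarrow> keys f \<subseteq> mons d"
    and pivot_iff: "J \<subseteq> mons d \<Longrightarrow> pivot_set W J \<longleftrightarrow> J \<in> \<J>" and \<J>_mons: "J \<in> \<J> \<Longrightarrow> J \<subseteq> mons d"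
    and F_in: "J \<in> \<J> \<Longrightarrow> j \<in> J \<Longrightarrow> F J j \<in> W" and F_self: "J \<in> \<J> \<Longrightarrow> j \<in> J \<Longrightarrow> coef (F J j) j \<noteq> 0"
    and F_other: "J \<in> \<J> \<Longrightarrow> j \<in> J \<Longrightarrow> i \<in> J \<Longrightarrow> i \<noteq> j \<Longrightarrow> coef (F J j) i = 0"
begin

lemma finite_pivot: "J \<in> \<J> \<Longrightarrow> finite J"
  using \<J>_mons finite_mons finite_subset by blast

lemma pivot: "J \<in> \<J> \<Longrightarrow> pivot_set W J"
  using pivot_iff \<J>_mons by blast

lemma pivot_set_residues_iff_optimal:
  assumes "J \<subseteq> mons d"
  shows "pivot_set (residues \<omega> W) J \<longleftrightarrow> optimal \<J> F \<omega> J"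
proof
  assume P: "pivot_set (residues \<omega> W) J"
  have keysW: "\<forall>f\<in>W. keys f \<subseteq> mons d" using keys by simp
  note * = pivot_set_of_residues[OF finite_mons assms subspace keysW P]
  have J: "J \<in> \<J>" using *(1) pivot_iff[OF assms] by simp
  have "j \<in> initial_support \<omega> (F J j)" if "j \<in> J" for j
  proof (rule *(2)[OF F_in[OF J that]])
    show "F J j \<noteq> 0" using F_self[OF J that] by auto
    show "\<forall>i\<in>J. i \<noteq> j \<longrightarrow> coef (F J j) i = 0" using F_other[OF J that] by simp
  qed
  then show "optimal \<J> F \<omega> J" using J by (simp add: optimal_def)
next
  assume "optimal \<J> F \<omega> J"
  then have J: "J \<in> \<J>" and opt: "\<And>j. j \<in> J \<Longrightarrow> j \<in> initial_support \<omega> (F J j)" by (simp_all add: optimal_def)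
  show "pivot_set (residues \<omega> W) J"
  proof (rule pivot_set_residues[OF subspace finite_pivot[OF J] pivot_set_zero[OF pivot[OF J]],
        of "\<lambda>j. mconst (inverse (coef (F J j) j)) * F J j"])
    fix j assume j: "j \<in> J"
    show "mconst (inverse (coef (F J j) j)) * F J j \<in> W" by (rule mpoly_vs.subspace_scale[OF subspace F_in[OF J j]])
    show "dominated_by \<omega> j (mconst (inverse (coef (F J j) j)) * F J j)" by (rule dominated_by_normalized[OF opt[OF j]])
    show "coef (mconst (inverse (coef (F J j) j)) * F J j) i = (if i = j then 1 else 0)" if "i \<in> J" for i
      using F_self[OF J j] F_other[OF J j that] by simp
  qed
qed

lemma optimal_exists:
  obtains J where "optimal \<J> F \<omega> J" "J \<subseteq> mons d" "pivot_set (residues \<omega> W) J"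
proof -
  have sub: "mpoly_vs.subspace (residues \<omega> W)" by (rule subspace_residues[OF subspace])
  have "\<forall>g\<in>residues \<omega> W. (\<forall>j\<in>mons d. coef g j = 0) \<longrightarrow> g = 0"
  proof (intro ballI impI poly_mapping_eqI)
    fix g m assume g: "g \<in> residues \<omega> W" "\<forall>j\<in>mons d. coef g j = 0"
    obtain f where f: "f \<in> W" "g = residue_at \<omega> f" using g(1) by (rule residuesE)
    show "coef g m = coef 0 m"
    proof (cases "m \<in> mons d")
      case False
      then have "coef f m = 0" using keys[OF f(1)] by (metis in_keys_iff subsetD)
      then show ?thesis by (simp add: f(2))
    qed (use g(2) in simp)
  qed
  from pivot_subset_exists[OF sub finite_mons this] obtain J where "J \<subseteq> mons d" "pivot_set (residues \<omega> W) J"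
    by (elim exE conjE)
  then show thesis using that pivot_set_residues_iff_optimal by simp
qed

lemma initial_form_coef_pivot:
  assumes "J \<in> \<J>" "j \<in> J" "i \<in> J" "i \<noteq> j"
  shows "coef (initial_form \<omega> (F J j)) i = 0"
  using F_other[OF assms] by (simp add: coef_initial_form_support initial_support_def in_keys_iff)

lemma residues_eq_iff:
  "residues \<omega> W = residues \<omega>' W \<longleftrightarrow>
    (\<exists>J. optimal \<J> F \<omega> J \<and> optimal \<J> F \<omega>' J \<and> (\<forall>j\<in>J. initial_support \<omega> (F J j) = initial_support \<omega>' (F J j)))"
proof
  assume eq: "residues \<omega> W = residues \<omega>' W"
  obtain J where J: "optimal \<J> F \<omega> J" "J \<subseteq> mons d" "pivot_set (residues \<omega> W) J" by (rule optimal_exists)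
  then have J': "optimal \<J> F \<omega>' J" using pivot_set_residues_iff_optimal[OF J(2), of \<omega>'] eq by simp
  have "initial_support \<omega> (F J j) = initial_support \<omega>' (F J j)" if j: "j \<in> J" for j
  proof -
    let ?g = "initial_form \<omega> (F J j) - initial_form \<omega>' (F J j)"
    have JJ: "J \<in> \<J>" using J(1) by (simp add: optimal_def)
    have in': "initial_form \<omega>'' (F J j) \<in> residues \<omega>'' W" for \<omega>''
      by (rule initial_form_in_residues[OF subspace F_in[OF JJ j]])
    have "?g \<in> residues \<omega> W"
      using in'[of \<omega>] in'[of \<omega>'] eq by (intro mpoly_vs.subspace_diff[OF subspace_residues[OF subspace]]) simp_all
    moreover have "\<forall>i\<in>J. coef ?g i = 0"
    proof
      fix i assume i: "i \<in> J"
      show "coef ?g i = 0"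
      proof (cases "i = j")
        case True
        then show ?thesis using J(1) J' j by (simp add: lookup_minus coef_initial_form_support optimal_def)
      next
        case False
        then show ?thesis by (simp add: lookup_minus initial_form_coef_pivot[OF JJ j i])
      qed
    qed
    ultimately have "?g = 0" by (rule pivot_set_zero[OF J(3)])
    then have "initial_form \<omega> (F J j) = initial_form \<omega>' (F J j)" by simp
    then show ?thesis using coef_initial_form_nonzero_iff by (metis Set.set_eqI)
  qed
  then show "\<exists>J. optimal \<J> F \<omega> J \<and> optimal \<J> F \<omega>' J \<and>
      (\<forall>j\<in>J. initial_support \<omega> (F J j) = initial_support \<omega>' (F J j))"
    using J(1) J' by blast
next
  have half: "residues \<omega>1 W \<subseteq> residues \<omega>2 W"
    if o: "optimal \<J> F \<omega>1 J" and s: "\<And>j. j \<in> J \<Longrightarrow> initial_support \<omega>1 (F J j) = initial_support \<omega>2 (F J j)" for J \<omega>1 \<omega>2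
  proof
    have JJ: "J \<in> \<J>" using o by (simp add: optimal_def)
    have P: "pivot_set (residues \<omega>1 W) J" using o pivot_set_residues_iff_optimal[OF \<J>_mons[OF JJ]] by simp
    let ?c = "\<lambda>j. initial_form \<omega>1 (F J j)"
    let ?b = "\<lambda>j. mconst (inverse (coef (?c j) j)) * ?c j"
    have b: "coef (?b j) i = (if i = j then 1 else 0)" if "j \<in> J" "i \<in> J" for i j
    proof -
      have "coef (?c j) j \<noteq> 0" using o that(1) by (simp add: coef_initial_form_nonzero_iff optimal_def)
      then show ?thesis using initial_form_coef_pivot[OF JJ that] by auto
    qed
    have b1: "?b j \<in> residues \<omega>1 W" if "j \<in> J" for j
      by (rule mpoly_vs.subspace_scale[OF subspace_residues[OF subspace] initial_form_in_residues[OF subspace F_in[OF JJ that]]])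
    have b2: "?b j \<in> residues \<omega>2 W" if "j \<in> J" for j
    proof -
      have "?c j = initial_form \<omega>2 (F J j)"
        by (rule poly_mapping_eqI) (simp add: coef_initial_form_support s[OF that])
      then show ?thesis
        using mpoly_vs.subspace_scale[OF subspace_residues[OF subspace] initial_form_in_residues[OF subspace F_in[OF JJ that]]]
        by simp
    qed
    fix g assume g: "g \<in> residues \<omega>1 W"
    have "g = (\<Sum>j\<in>J. mconst (coef g j) * ?b j)"
      by (rule pivot_expansion[OF subspace_residues[OF subspace] finite_pivot[OF JJ]])
        (rule g b1 b pivot_set_zero[OF P] | assumption)+
    moreover have "(\<Sum>j\<in>J. mconst (coef g j) * ?b j) \<in> residues \<omega>2 W"
      by (intro mpoly_vs.subspace_sum mpoly_vs.subspace_scale subspace_residues[OF subspace] b2)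
    ultimately show "g \<in> residues \<omega>2 W" by simp
  qed
  assume "\<exists>J. optimal \<J> F \<omega> J \<and> optimal \<J> F \<omega>' J \<and>
      (\<forall>j\<in>J. initial_support \<omega> (F J j) = initial_support \<omega>' (F J j))"
  then obtain J where J: "optimal \<J> F \<omega> J" "optimal \<J> F \<omega>' J"
      "\<And>j. j \<in> J \<Longrightarrow> initial_support \<omega> (F J j) = initial_support \<omega>' (F J j)" by blast
  show "residues \<omega> W = residues \<omega>' W"
    using half[OF J(1,3)] half[OF J(2) J(3)[symmetric]] by (rule equalityI)
qed

lemma monomial_in_residues_iff:
  assumes "mdegree m = d"
  shows "single m 1 \<in> residues \<omega> W \<longleftrightarrow> (\<exists>J. optimal \<J> F \<omega> J \<and> m \<in> J \<and> initial_support \<omega> (F J m) = {m})"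
proof
  assume m: "single m 1 \<in> residues \<omega> W"
  obtain J where J: "optimal \<J> F \<omega> J" "J \<subseteq> mons d" "pivot_set (residues \<omega> W) J" by (rule optimal_exists)
  have JJ: "J \<in> \<J>" using J(1) by (simp add: optimal_def)
  have mJ: "m \<in> J"
  proof (rule ccontr)
    assume "m \<notin> J"
    then have "\<forall>j\<in>J. coef (single m (1 :: 'k)) j = 0" by (auto simp: lookup_single when_def)
    then have "single m (1 :: 'k) = 0" by (rule pivot_set_zero[OF J(3) m])
    then show False by (metis lookup_single_eq lookup_zero zero_neq_one)
  qed
  let ?c = "initial_form \<omega> (F J m)"
  let ?g = "?c - mconst (coef ?c m) * single m 1"
  have "?g \<in> residues \<omega> W"
    by (intro mpoly_vs.subspace_diff mpoly_vs.subspace_scale subspace_residues[OF subspace] m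
        initial_form_in_residues[OF subspace F_in[OF JJ mJ]])
  moreover have "\<forall>i\<in>J. coef ?g i = 0"
    using initial_form_coef_pivot[OF JJ mJ] by (auto simp: lookup_minus lookup_single when_def)
  ultimately have g0: "?g = 0" by (rule pivot_set_zero[OF J(3)])
  have "coef ?c i = 0" if "i \<noteq> m" for i
    using arg_cong[OF g0, of "\<lambda>f. coef f i"] that by (simp add: lookup_minus lookup_single when_def)
  then have "i = m" if "i \<in> initial_support \<omega> (F J m)" for i
    using that coef_initial_form_nonzero_iff[of \<omega> "F J m" i] by metis
  then have "initial_support \<omega> (F J m) \<subseteq> {m}" by (intro subsetI) simp
  moreover have "m \<in> initial_support \<omega> (F J m)" using J(1) mJ by (simp add: optimal_def)
  ultimately have "initial_support \<omega> (F J m) = {m}" by blast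
  then show "\<exists>J. optimal \<J> F \<omega> J \<and> m \<in> J \<and> initial_support \<omega> (F J m) = {m}" using J(1) mJ by blast
next
  assume "\<exists>J. optimal \<J> F \<omega> J \<and> m \<in> J \<and> initial_support \<omega> (F J m) = {m}"
  then obtain J where J: "optimal \<J> F \<omega> J" "m \<in> J" "initial_support \<omega> (F J m) = {m}" by blast
  have JJ: "J \<in> \<J>" using J(1) by (simp add: optimal_def)
  let ?c = "initial_form \<omega> (F J m)"
  have "coef ?c m \<noteq> 0" using J(3) by (simp add: coef_initial_form_nonzero_iff)
  moreover have "coef ?c i = 0" if "i \<noteq> m" for i
    using that J(3) by (simp add: coef_initial_form_support)
  ultimately have "mconst (inverse (coef ?c m)) * ?c = single m 1"
    by (intro poly_mapping_eqI) (auto simp: lookup_single when_def)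
  moreover have "mconst (inverse (coef ?c m)) * ?c \<in> residues \<omega> W"
    by (intro mpoly_vs.subspace_scale subspace_residues[OF subspace] initial_form_in_residues[OF subspace F_in[OF JJ J(2)]])
  ultimately show "single m 1 \<in> residues \<omega> W" by simp
qed

end

section \<open>Generic values of polynomial functions on a subvariety\<close>

definition generically :: "('k::field ^ 'n ^ 'n::finite) set \<Rightarrow> ('k ^ 'n ^ 'n \<Rightarrow> bool) \<Rightarrow> bool" where
  "generically V P \<longleftrightarrow> (\<exists>U. openin (subtopology GL_zariski V) U \<and> U \<noteq> {} \<and> (\<forall>g\<in>U. P g))"

lemma GL_subvariety_subset: "GL_subvariety V \<Longrightarrow> V \<subseteq> topspace GL_zariski"
  by (simp add: GL_subvariety_def closedin_subset)

text \<open>Irreducibility of \<open>V\<close>, in terms of open sets.\<close>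

lemma open_Int_nonempty:
  assumes V: "GL_subvariety V" and U: "openin (subtopology GL_zariski V) U" "U \<noteq> {}"
    and U': "openin (subtopology GL_zariski V) U'" "U' \<noteq> {}"
  shows "U \<inter> U' \<noteq> {}"
proof -
  obtain W W' where W: "openin GL_zariski W" "U = W \<inter> V" "openin GL_zariski W'" "U' = W' \<inter> V"
    using U(1) U'(1) by (auto simp: openin_subtopology)
  have top: "V \<subseteq> topspace GL_zariski" by (rule GL_subvariety_subset[OF V])
  have cl: "closedin GL_zariski (topspace GL_zariski - W)" "closedin GL_zariski (topspace GL_zariski - W')"
    using W by (auto intro: openin_closedin_eq[THEN iffD1, THEN conjunct2])
  have "\<not> V \<subseteq> topspace GL_zariski - W" "\<not> V \<subseteq> topspace GL_zariski - W'"
    using U(2) U'(2) W by auto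
  then have "\<not> V \<subseteq> (topspace GL_zariski - W) \<union> (topspace GL_zariski - W')"
    using V cl unfolding GL_subvariety_def by blast
  then show ?thesis using top W by auto
qed

lemma generically_conj:
  assumes V: "GL_subvariety V" and "generically V P" "generically V Q"
  shows "generically V (\<lambda>g. P g \<and> Q g)"
proof -
  obtain U U' where U: "openin (subtopology GL_zariski V) U" "U \<noteq> {}" "\<forall>g\<in>U. P g"
    and U': "openin (subtopology GL_zariski V) U'" "U' \<noteq> {}" "\<forall>g\<in>U'. Q g"
    using assms(2,3) unfolding generically_def by (elim exE conjE)
  show ?thesis
    unfolding generically_def
    by (rule exI[of _ "U \<inter> U'"])
      (use openin_Int[OF U(1) U'(1)] open_Int_nonempty[OF V U(1,2) U'(1,2)] U(3) U'(3) in simp)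
qed

lemma generically_mono: "generically V P \<Longrightarrow> (\<And>g. g \<in> V \<Longrightarrow> P g \<Longrightarrow> Q g) \<Longrightarrow> generically V Q"
  unfolding generically_def by (metis openin_imp_subset subsetD)

lemma generically_all:
  assumes V: "GL_subvariety V" and "\<And>g. g \<in> V \<Longrightarrow> P g"
  shows "generically V P"
  unfolding generically_def
proof (intro exI[of _ V] conjI ballI)
  show "openin (subtopology GL_zariski V) V"
    using GL_subvariety_subset[OF V] by (simp add: openin_subtopology_refl)
  show "V \<noteq> {}" using V by (simp add: GL_subvariety_def)
qed (rule assms(2))

lemma generically_ball:
  assumes V: "GL_subvariety V" and "finite A" "\<And>a. a \<in> A \<Longrightarrow> generically V (P a)"
  shows "generically V (\<lambda>g. \<forall>a\<in>A. P a g)"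
  using assms(2,3)
proof (induction A rule: finite_induct)
  case empty
  show ?case by (rule generically_all[OF V]) simp
next
  case (insert x A)
  have "generically V (\<lambda>g. P x g \<and> (\<forall>a\<in>A. P a g))"
    by (rule generically_conj[OF V]) (use insert in simp_all)
  then show ?case by simp
qed

lemma generically_ex:
  assumes "generically V P"
  obtains g where "g \<in> V" "P g"
proof -
  obtain U where U: "openin (subtopology GL_zariski V) U" "U \<noteq> {}" "\<forall>g\<in>U. P g"
    using assms unfolding generically_def by (elim exE conjE)
  obtain g where "g \<in> U" using U(2) by blast
  moreover have "U \<subseteq> V" by (rule openin_imp_subset[OF U(1)])
  ultimately show thesis using U(3) that by blast
qed

lemma generically_nonzero:
  assumes V: "GL_subvariety V" and "\<exists>g\<in>V. mat_eval id g f \<noteq> 0"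
  shows "generically V (\<lambda>g. mat_eval id g f \<noteq> 0)"
  unfolding generically_def
proof (intro exI[of _ "{g. invertible g \<and> (\<exists>f'\<in>{f}. mat_eval id g f' \<noteq> 0)} \<inter> V"] conjI)
  have "openin GL_zariski {g. invertible g \<and> (\<exists>f'\<in>{f}. mat_eval id g f' \<noteq> 0)}"
    unfolding openin_GL_zariski by (rule exI[of _ "{f}"]) (rule refl)
  then show "openin (subtopology GL_zariski V) ({g. invertible g \<and> (\<exists>f'\<in>{f}. mat_eval id g f' \<noteq> 0)} \<inter> V)"
    unfolding openin_subtopology by blast
  have "V \<subseteq> {g. invertible g}" using GL_subvariety_subset[OF V] by (simp only: topspace_GL_zariski)
  then show "{g. invertible g \<and> (\<exists>f'\<in>{f}. mat_eval id g f' \<noteq> 0)} \<inter> V \<noteq> {}" using assms(2) by auto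
qed simp

abbreviation eval_L :: "'k::field ^ 'n ^ 'n::finite \<Rightarrow> ('n \<times> 'n, 'k hahn) mpoly \<Rightarrow> 'k hahn" where
  "eval_L \<equiv> mat_eval hahn_const"

lemma eval_add: "mat_eval h g (a + b) = mat_eval h g a + mat_eval h g b"
  and eval_mult: "mat_eval h g (a * b) = mat_eval h g a * mat_eval h g b"
  and eval_0 [simp]: "mat_eval h g 0 = 0"
  by (simp_all add: mat_eval_def msubst_add msubst_mult) (simp add: msubst_def)

lemma eval_single: "mat_eval h g (single m c) = c * (\<Prod>(i, j)\<in>UNIV. h (g $ i $ j) ^ coef m (i, j))"
  unfolding mat_eval_def by (subst msubst_single) (simp_all add: split_def)

lemma eval_mconst [simp]: "mat_eval h g (mconst c) = c"
  unfolding mconst_def eval_single by simp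

lemma eval_1 [simp]: "mat_eval h g 1 = 1"
  using eval_mconst[of h g 1] by simp

lemma eval_sum: "mat_eval h g (sum f A) = (\<Sum>a\<in>A. mat_eval h g (f a))"
  by (induction A rule: infinite_finite_induct) (simp_all add: eval_add)

lemma eval_uminus: "mat_eval h g (- a) = - mat_eval h g a"
  using eval_add[of h g a "- a"] by (simp add: eq_neg_iff_add_eq_0 add.commute)

lemma eval_diff: "mat_eval h g (a - b) = mat_eval h g a - mat_eval h g b"
  using eval_add[of h g a "- b"] by (simp add: eval_uminus)

lemma eval_prod: "mat_eval h g (prod f A) = (\<Prod>a\<in>A. mat_eval h g (f a))"
  by (induction A rule: infinite_finite_induct) (simp_all add: eval_mult)

definition coeff_slice :: "real \<Rightarrow> ('n, 'k::field hahn) mpoly \<Rightarrow> ('n, 'k) mpoly" where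
  "coeff_slice \<nu> a = Poly_Mapping.map (\<lambda>c. hahn_coeff c \<nu>) a"

lemma coef_coeff_slice [simp]: "coef (coeff_slice \<nu> a) m = hahn_coeff (coef a m) \<nu>"
  by (simp add: coeff_slice_def Poly_Mapping.map.rep_eq when_def)

lemma hahn_const_1: "hahn_const 1 = 1"
  by (simp add: hahn_const_def one_hahn_def)

lemma hahn_const_mult: "hahn_const (a * b) = hahn_const a * hahn_const b" for a :: "'k::comm_ring_1"
  by (simp add: hahn_const_def hahn_monom_mult)

lemma hahn_const_power: "hahn_const (a ^ n) = hahn_const a ^ n" for a :: "'k::comm_ring_1"
  by (induction n) (simp_all add: hahn_const_1 hahn_const_mult)

lemma hahn_const_prod: "hahn_const (prod f A) = (\<Prod>a\<in>A. hahn_const (f a))" for f :: "'i \<Rightarrow> 'k::comm_ring_1"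
  by (induction A rule: infinite_finite_induct) (simp_all add: hahn_const_1 hahn_const_mult)

text \<open>Since the matrix entries have valuation \<open>0\<close>, evaluation acts separately on the coefficient of each
  power of \<open>t\<close>.\<close>

lemma hahn_coeff_eval: "hahn_coeff (eval_L g a) \<nu> = mat_eval id g (coeff_slice \<nu> a)"
proof -
  define p where "p m = (\<Prod>ij\<in>UNIV. (g $ fst ij $ snd ij) ^ coef m ij)" for m
  have "eval_L g a = (\<Sum>m\<in>keys a. coef a m * hahn_const (p m))"
    by (simp add: mat_eval_def msubst_def split_def p_def hahn_const_prod hahn_const_power)
  moreover have "hahn_coeff (coef a m * hahn_const (p m)) \<nu> = hahn_coeff (coef a m) \<nu> * p m" for m
    using hahn_coeff_monom_mult[of "p m" 0 "coef a m" \<nu>] by (simp add: hahn_const_def mult.commute)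
  ultimately have "hahn_coeff (eval_L g a) \<nu> = (\<Sum>m\<in>keys a. hahn_coeff (coef a m) \<nu> * p m)"
    by (simp add: hahn_coeff_sum)
  moreover have "mat_eval id g (coeff_slice \<nu> a) = (\<Sum>m\<in>keys a. hahn_coeff (coef a m) \<nu> * p m)"
  proof -
    have "coef a m \<noteq> 0" if "hahn_coeff (coef a m) \<nu> \<noteq> 0" for m using that by auto
    then have "keys (coeff_slice \<nu> a) \<subseteq> keys a"
      by (intro subsetI) (simp add: in_keys_iff)
    then show ?thesis
      unfolding mat_eval_def
      by (subst msubst_superset[of "keys a"]) (simp_all add: p_def split_def)
  qed
  ultimately show ?thesis by simp
qed

definition nonvanishing :: "('k::field ^ 'n ^ 'n::finite) set \<Rightarrow> ('n \<times> 'n, 'k hahn) mpoly \<Rightarrow> bool" where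
  "nonvanishing V a \<longleftrightarrow> (\<exists>g\<in>V. eval_L g a \<noteq> 0)"

text \<open>The generic valuation is the least exponent whose coefficient, a polynomial on \<open>V\<close>, does not vanish
  identically.\<close>

lemma generic_valuation:
  assumes V: "GL_subvariety V" and a: "nonvanishing V a"
  shows "\<exists>v. generically V (\<lambda>g. eval_L g a \<noteq> 0 \<and> hahn_val (eval_L g a) = v)"
proof -
  define E where "E = {\<nu>. \<exists>g\<in>V. mat_eval id g (coeff_slice \<nu> a) \<noteq> 0}"
  obtain g \<nu> where "g \<in> V" "hahn_coeff (eval_L g a) \<nu> \<noteq> 0"
    using a unfolding nonvanishing_def by (metis hahn_coeff_0 hahn_eqI)
  then have "\<nu> \<in> E" unfolding E_def hahn_coeff_eval by blast
  have "E \<subseteq> (\<Union>m\<in>keys a. hahn_support (coef a m))"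
  proof
    fix \<nu> assume "\<nu> \<in> E"
    then have "coeff_slice \<nu> a \<noteq> 0" by (auto simp: E_def)
    then obtain m where "hahn_coeff (coef a m) \<nu> \<noteq> 0"
      by (metis coef_coeff_slice lookup_zero poly_mapping_eqI)
    then show "\<nu> \<in> (\<Union>m\<in>keys a. hahn_support (coef a m))"
      by (force simp: hahn_support_def in_keys_iff)
  qed
  moreover have "well_ordered (\<Union>m\<in>keys a. hahn_support (coef a m))"
    by (rule well_ordered_UN) simp_all
  ultimately have "\<exists>m\<in>E. \<forall>b\<in>E. m \<le> b" using \<open>\<nu> \<in> E\<close> unfolding well_ordered_def by blast
  then obtain v where v: "v \<in> E" "\<forall>b\<in>E. v \<le> b" by (rule bexE)
  have "generically V (\<lambda>g. mat_eval id g (coeff_slice v a) \<noteq> 0)"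
    using v(1) by (intro generically_nonzero[OF V]) (simp add: E_def)
  then have "generically V (\<lambda>g. eval_L g a \<noteq> 0 \<and> hahn_val (eval_L g a) = v)"
  proof (rule generically_mono)
    fix g assume g: "g \<in> V" "mat_eval id g (coeff_slice v a) \<noteq> 0"
    have nz: "hahn_coeff (eval_L g a) v \<noteq> 0" using g(2) by (simp add: hahn_coeff_eval)
    have "hahn_coeff (eval_L g a) \<mu> = 0" if "\<mu> < v" for \<mu>
    proof (rule ccontr)
      assume "hahn_coeff (eval_L g a) \<mu> \<noteq> 0"
      then have "\<mu> \<in> E" using g(1) unfolding E_def hahn_coeff_eval by blast
      then show False using v(2) that by force
    qed
    then have "hahn_val (eval_L g a) = v" by (rule hahn_val_eqI[OF nz])
    moreover have "eval_L g a \<noteq> 0" using nz by auto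
    ultimately show "eval_L g a \<noteq> 0 \<and> hahn_val (eval_L g a) = v" by simp
  qed
  then show ?thesis by (rule exI)
qed

lemma generically_nonvanishing:
  assumes "GL_subvariety V" "nonvanishing V a"
  shows "generically V (\<lambda>g. eval_L g a \<noteq> 0)"
proof -
  obtain v where "generically V (\<lambda>g. eval_L g a \<noteq> 0 \<and> hahn_val (eval_L g a) = v)"
    using generic_valuation[OF assms] by (rule exE)
  then show ?thesis by (rule generically_mono) simp
qed

lemma nonvanishing_mult:
  assumes "GL_subvariety V" "nonvanishing V a" "nonvanishing V b"
  shows "nonvanishing V (a * b)"
proof -
  obtain g where "g \<in> V" "eval_L g a \<noteq> 0 \<and> eval_L g b \<noteq> 0"
    by (rule generically_ex[OF generically_conj[OF assms(1) generically_nonvanishing[OF assms(1,2)]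
          generically_nonvanishing[OF assms(1,3)]]])
  then show ?thesis by (auto simp: nonvanishing_def eval_mult)
qed

lemma eval_not_nonvanishing: "\<not> nonvanishing V a \<Longrightarrow> g \<in> V \<Longrightarrow> eval_L g a = 0"
  by (auto simp: nonvanishing_def)

section \<open>Families of ideals parametrized by a subvariety\<close>

definition spec_at :: "'k::field ^ 'n ^ 'n \<Rightarrow> ('n::finite, ('n \<times> 'n, 'k hahn) mpoly) mpoly \<Rightarrow> ('n, 'k hahn) mpoly" where
  "spec_at g F = msubst (\<lambda>c. mconst (eval_L g c)) mvar F"

lemma prod_mvar_power: "(\<Prod>i\<in>UNIV. mvar i ^ coef m i) = single m (1 :: 'a::comm_ring_1)"
  for m :: "'n::finite \<Rightarrow>\<^sub>0 nat"
proof -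
  have "mvar i ^ coef m i = single (\<Sum>k<coef m i. single i 1) (1 :: 'a)" for i
    by (simp only: mvar_def single_power power_one)
  moreover have "(\<Sum>i\<in>UNIV. \<Sum>k<coef m i. single i 1) = m"
    by (rule poly_mapping_eqI) (simp add: lookup_sum lookup_single when_def if_distrib cong: if_cong)
  ultimately show ?thesis by (simp add: prod_single)
qed

lemma coef_msubst_mvar:
  fixes F :: "('n::finite, 'a::zero) mpoly" and h :: "'a \<Rightarrow> 'b::comm_ring_1"
  assumes "h 0 = 0"
  shows "coef (msubst (\<lambda>c. mconst (h c)) mvar F) m = h (coef F m)"
proof -
  have "msubst (\<lambda>c. mconst (h c)) mvar F = (\<Sum>a\<in>keys F. mconst (h (coef F a)) * single a 1)"
    by (simp only: msubst_def prod_mvar_power)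
  also have "coef \<dots> m = (\<Sum>a\<in>keys F. if a = m then h (coef F a) else 0)"
    by (simp add: lookup_sum lookup_single when_def if_distrib cong: if_cong)
  also have "\<dots> = h (coef F m)" using assms by (simp add: in_keys_iff)
  finally show ?thesis .
qed

lemma coef_spec_at [simp]: "coef (spec_at g F) m = eval_L g (coef F m)"
  unfolding spec_at_def by (rule coef_msubst_mvar) simp

lemma spec_at_add: "spec_at g (F + G) = spec_at g F + spec_at g G"
  by (rule poly_mapping_eqI) (simp add: lookup_add eval_add)

lemma spec_at_0 [simp]: "spec_at g 0 = 0"
  by (rule poly_mapping_eqI) simp

lemma spec_at_mult: "spec_at g (F * G) = spec_at g F * spec_at g G"
  unfolding spec_at_def by (rule msubst_mult) (simp_all add: mconst_add mconst_mult eval_add eval_mult)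

definition const_family :: "('n::finite, 'k::field hahn) mpoly \<Rightarrow> ('n, ('n \<times> 'n, 'k hahn) mpoly) mpoly" where
  "const_family q = msubst (\<lambda>c. mconst (mconst c)) mvar q"

lemma spec_at_const_family [simp]: "spec_at g (const_family q) = q"
  by (rule poly_mapping_eqI) (simp add: const_family_def coef_msubst_mvar)

lemma hom_component_spec_at: "hom_component d (spec_at g F) = spec_at g (hom_component d F)"
  by (rule poly_mapping_eqI) simp

lemma graded_ideal_spec_at:
  assumes "graded_ideal M"
  shows "graded_ideal (spec_at g ` M)"
  unfolding graded_ideal_def ideal_type_ring_iff
proof (intro conjI)
  note M = ideal_type_ringD[OF graded_ideal_ideal[OF assms]]
  have M_hom: "\<And>F d. F \<in> M \<Longrightarrow> hom_component d F \<in> M" using assms unfolding graded_ideal_def by blast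
  show "0 \<in> spec_at g ` M" by (rule image_eqI[OF _ M(1)]) simp
  show "\<forall>f\<in>spec_at g ` M. \<forall>h\<in>spec_at g ` M. f + h \<in> spec_at g ` M"
    using M(2) by (auto simp: spec_at_add[symmetric])
  show "\<forall>f\<in>spec_at g ` M. \<forall>q. q * f \<in> spec_at g ` M"
  proof (intro ballI allI)
    fix f q assume "f \<in> spec_at g ` M"
    then obtain F where F: "F \<in> M" "f = spec_at g F" by blast
    show "q * f \<in> spec_at g ` M"
      by (rule image_eqI[OF _ M(3)[OF F(1), of "const_family q"]]) (simp add: F(2) spec_at_mult)
  qed
  show "\<forall>f\<in>spec_at g ` M. \<forall>d. hom_component d f \<in> spec_at g ` M"
    using M_hom by (auto simp: hom_component_spec_at)
qed

lemma degree_part_spec_at: "graded_ideal M \<Longrightarrow> degree_part (spec_at g ` M) d = spec_at g ` degree_part M d"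
  by (rule degree_part_image[OF _ hom_component_spec_at])

text \<open>The generic form of the first condition on a pivot set. Statements about vanishing on \<open>V\<close> replace linear
  algebra over the function field, so that everything can be specialized.\<close>

definition separating :: "('k::field ^ 'n ^ 'n) set \<Rightarrow> ('n::finite, ('n \<times> 'n, 'k hahn) mpoly) mpoly set \<Rightarrow> ('n \<Rightarrow>\<^sub>0 nat) set \<Rightarrow> bool" where
  "separating V P J \<longleftrightarrow> (\<forall>F\<in>P. (\<forall>j\<in>J. \<not> nonvanishing V (coef F j)) \<longrightarrow> (\<forall>k. \<not> nonvanishing V (coef F k)))"

definition generic_pivot_form :: "('k::field ^ 'n ^ 'n) set \<Rightarrow> ('n::finite, ('n \<times> 'n, 'k hahn) mpoly) mpoly set \<Rightarrow>
    ('n \<Rightarrow>\<^sub>0 nat) set \<Rightarrow> ('n \<Rightarrow>\<^sub>0 nat) \<Rightarrow> ('n, ('n \<times> 'n, 'k hahn) mpoly) mpoly \<Rightarrow> bool" where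
  "generic_pivot_form V P J j F \<longleftrightarrow> F \<in> P \<and> nonvanishing V (coef F j) \<and>
     (\<forall>i\<in>J. i \<noteq> j \<longrightarrow> \<not> nonvanishing V (coef F i))"

lemma separating_remove:
  assumes J: "separating V P J" and j: "\<not> separating V P (J - {j})"
  shows "\<exists>F. generic_pivot_form V P J j F"
proof -
  obtain F k where F: "F \<in> P" "\<forall>i\<in>J - {j}. \<not> nonvanishing V (coef F i)" "nonvanishing V (coef F k)"
    using j unfolding separating_def by blast
  have "nonvanishing V (coef F j)"
  proof (rule ccontr)
    assume "\<not> nonvanishing V (coef F j)"
    with F(2) have "\<forall>i\<in>J. \<not> nonvanishing V (coef F i)" by blast
    then show False using J F(1,3) unfolding separating_def by blast
  qed
  then show ?thesis unfolding generic_pivot_form_def using F(1,2) by blast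
qed

lemma separating_minimal:
  assumes "finite J" "separating V P J"
  shows "\<exists>J'\<subseteq>J. separating V P J' \<and> (\<forall>j\<in>J'. \<not> separating V P (J' - {j}))"
  using assms
proof (induction J rule: finite_psubset_induct)
  case (psubset J)
  show ?case
  proof (cases "\<exists>j\<in>J. separating V P (J - {j})")
    case True
    then obtain j where j: "j \<in> J" "separating V P (J - {j})" by (rule bexE)
    have "J - {j} \<subset> J" using j(1) by blast
    from psubset.IH[OF this j(2)] show ?thesis by blast
  next
    case False
    then show ?thesis using psubset.prems by blast
  qed
qed

locale ideal_family =
  fixes V :: "('k::field ^ 'n ^ 'n) set" and M :: "('n::finite, ('n \<times> 'n, 'k hahn) mpoly) mpoly set"
  assumes V: "GL_subvariety V" and graded: "graded_ideal M"
begin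

abbreviation member :: "'k ^ 'n ^ 'n \<Rightarrow> ('n, 'k hahn) mpoly set" where
  "member g \<equiv> spec_at g ` M"

lemma graded_member: "graded_ideal (member g)"
  by (rule graded_ideal_spec_at[OF graded])

lemma subspace_member: "mpoly_vs.subspace (degree_part (member g) d)"
  by (rule subspace_degree_part[OF subspace_ideal[OF graded_ideal_ideal[OF graded_member]]])

lemma spec_at_degree_part: "F \<in> degree_part M d \<Longrightarrow> spec_at g F \<in> degree_part (member g) d"
  unfolding degree_part_spec_at[OF graded] by (rule imageI)

lemmas M_closed = ideal_type_ringD[OF graded_ideal_ideal[OF graded]]

lemma degree_part_closed:
  "F \<in> degree_part M d \<Longrightarrow> G \<in> degree_part M d \<Longrightarrow> F - G \<in> degree_part M d"
  "(\<And>i. i \<in> A \<Longrightarrow> f i \<in> degree_part M d) \<Longrightarrow> sum f A \<in> degree_part M d"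
  "F \<in> degree_part M d \<Longrightarrow> mconst c * F \<in> degree_part M d"
proof -
  have *: "F \<in> degree_part M d \<longleftrightarrow> F \<in> M \<and> (\<forall>m. mdegree m \<noteq> d \<longrightarrow> coef F m = 0)" for F
    by (auto simp: degree_part_def in_keys_iff subset_iff)
  have "F + G \<in> degree_part M d" if "F \<in> degree_part M d" "G \<in> degree_part M d" for F G
    using that unfolding * by (simp add: M_closed(2) lookup_add)
  note plus = this
  show mult: "mconst c * F \<in> degree_part M d" if "F \<in> degree_part M d" for c F
    using that unfolding * by (simp add: M_closed(3))
  show "F - G \<in> degree_part M d" if "F \<in> degree_part M d" "G \<in> degree_part M d"
    using plus[OF that(1) mult[OF that(2), of "- 1"]] by (simp add: mconst_def single_uminus)
  have "0 \<in> degree_part M d" unfolding * by (simp add: M_closed(1))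
  then show "sum f A \<in> degree_part M d" if "\<And>i. i \<in> A \<Longrightarrow> f i \<in> degree_part M d"
    using that by (induction A rule: infinite_finite_induct) (simp_all add: plus)
qed

text \<open>For a member \<open>G\<close>, the combination \<open>\<delta> G - \<Sum> \<delta>\<^sub>i G\<^sub>i F\<^sub>i\<close>, with \<open>\<delta>\<close> the product of the pivot entries and
  \<open>\<delta>\<^sub>i\<close> the product of all but the \<open>i\<close>-th, vanishes on \<open>J\<close> identically and hence altogether. At a matrix where
  \<open>\<delta>\<close> does not vanish, this expresses \<open>G(g)\<close> by its coordinates in \<open>J\<close>.\<close>

lemma pivot_set_specialized:
  assumes J: "finite J" "separating V (degree_part M d) J"
    and F: "\<And>j. j \<in> J \<Longrightarrow> generic_pivot_form V (degree_part M d) J j (F j)"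
    and g: "g \<in> V" "\<And>j. j \<in> J \<Longrightarrow> eval_L g (coef (F j) j) \<noteq> 0"
  shows "pivot_set (degree_part (member g) d) J"
proof (rule pivot_setI)
  have other: "eval_L h (coef (F j) i) = 0" if "j \<in> J" "i \<in> J" "i \<noteq> j" "h \<in> V" for i j h
    using F[OF that(1)] that(2-4) eval_not_nonvanishing unfolding generic_pivot_form_def by blast
  fix f assume f: "f \<in> degree_part (member g) d" "\<forall>j\<in>J. coef f j = 0"
  obtain G where G: "G \<in> degree_part M d" "f = spec_at g G"
    using f(1) unfolding degree_part_spec_at[OF graded] by (rule imageE)
  \<comment> \<open>the common denominator, and the cofactors that replace division by the pivot entries\<close>
  define \<delta> where "\<delta> = (\<Prod>j\<in>J. coef (F j) j)"
  define \<delta>' where "\<delta>' i = (\<Prod>j\<in>J - {i}. coef (F j) j)" for i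
  define H where "H = mconst \<delta> * G - (\<Sum>i\<in>J. mconst (\<delta>' i * coef G i) * F i)"
  have "H \<in> degree_part M d" unfolding H_def
    using F by (intro degree_part_closed G(1)) (simp add: generic_pivot_form_def)
  moreover have "\<forall>j\<in>J. \<not> nonvanishing V (coef H j)"
  proof
    fix j assume j: "j \<in> J"
    have "eval_L h (coef H j) = 0" if h: "h \<in> V" for h
    proof -
      have "(\<Sum>i\<in>J. eval_L h (\<delta>' i) * eval_L h (coef G i) * eval_L h (coef (F i) j)) =
          (\<Sum>i\<in>J. if i = j then eval_L h (\<delta>' j) * eval_L h (coef G j) * eval_L h (coef (F j) j) else 0)"
        by (rule sum.cong) (use other[OF _ j _ h] in auto)
      also have "\<dots> = eval_L h (\<delta>' j) * eval_L h (coef G j) * eval_L h (coef (F j) j)" using j J(1) by simp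
      also have "\<dots> = eval_L h \<delta> * eval_L h (coef G j)"
        using prod.remove[OF J(1) j, of "\<lambda>j. coef (F j) j"] by (simp add: \<delta>_def \<delta>'_def eval_mult)
      finally show ?thesis by (simp add: H_def lookup_minus lookup_sum eval_diff eval_sum eval_mult)
    qed
    then show "\<not> nonvanishing V (coef H j)" by (simp add: nonvanishing_def)
  qed
  ultimately have "\<forall>k. \<not> nonvanishing V (coef H k)" using J(2) unfolding separating_def by blast
  then have "eval_L g (coef H k) = 0" for k using eval_not_nonvanishing g(1) by blast
  moreover have "coef G i \<in> {c. eval_L g c = 0}" if "i \<in> J" for i using f(2) that by (simp add: G(2))
  ultimately have "eval_L g \<delta> * eval_L g (coef G k) = 0" for k
    by (simp add: H_def lookup_minus lookup_sum eval_diff eval_sum eval_mult)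
  moreover have "eval_L g \<delta> \<noteq> 0" using g(2) J(1) by (simp add: \<delta>_def eval_prod)
  ultimately show "f = 0" by (intro poly_mapping_eqI) (simp add: G(2))
next
  fix j assume j: "j \<in> J"
  let ?c = "inverse (eval_L g (coef (F j) j))"
  have Fj: "F j \<in> degree_part M d" using F[OF j] by (simp add: generic_pivot_form_def)
  have "eval_L g (coef (F j) i) = 0" if "i \<in> J" "i \<noteq> j" for i
    using F[OF j] that g(1) eval_not_nonvanishing unfolding generic_pivot_form_def by blast
  then have "\<forall>i\<in>J. coef (mconst ?c * spec_at g (F j)) i = (if i = j then 1 else 0)"
    using g(2)[OF j] by auto
  then show "\<exists>f\<in>degree_part (member g) d. \<forall>i\<in>J. coef f i = (if i = j then 1 else 0)"
    by (rule bexI) (rule mpoly_vs.subspace_scale[OF subspace_member spec_at_degree_part[OF Fj]])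
qed

lemma card_minimal_separating:
  assumes J: "finite J" "separating V (degree_part M d) J" "\<forall>j\<in>J. \<not> separating V (degree_part M d) (J - {j})"
    and r: "generically V (\<lambda>g. hilbert (member g) d = r)"
  shows "card J = r"
proof -
  have "\<forall>j\<in>J. \<exists>F. generic_pivot_form V (degree_part M d) J j F"
    using separating_remove[OF J(2)] J(3) by blast
  from bchoice[OF this] obtain F where F: "\<forall>j\<in>J. generic_pivot_form V (degree_part M d) J j (F j)" by (rule exE)
  have "generically V (\<lambda>g. \<forall>j\<in>J. eval_L g (coef (F j) j) \<noteq> 0)"
    using F by (intro generically_ball[OF V J(1)] generically_nonvanishing[OF V]) (simp add: generic_pivot_form_def)
  from generically_conj[OF V r this] obtain g where
    g: "g \<in> V" "hilbert (member g) d = r \<and> (\<forall>j\<in>J. eval_L g (coef (F j) j) \<noteq> 0)" by (rule generically_ex)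
  have "pivot_set (degree_part (member g) d) J"
    by (rule pivot_set_specialized[OF J(1,2), of F]) (use F g in simp_all)
  from pivot_set_dim[OF subspace_member J(1) this] show ?thesis using g(2) by (simp add: hilbert_def)
qed

text \<open>For a set \<open>J\<close> of the right size there are two cases. If \<open>J\<close> is separating, it is minimal with this
  property, because minimal separating sets have the size \<open>r\<close>, and it is a pivot set wherever the pivot
  entries do not vanish. Otherwise some member vanishes on \<open>J\<close> but not identically, and \<open>J\<close> is generically not a pivot set.\<close>

lemma generic_pivot_forms_exist:
  assumes r: "generically V (\<lambda>g. hilbert (member g) d = r)"
  shows "\<exists>\<J> F. (\<forall>J\<in>\<J>. J \<subseteq> mons d) \<and>
    (\<forall>J\<in>\<J>. \<forall>j\<in>J. F J j \<in> degree_part M d \<and> nonvanishing V (coef (F J j) j)) \<and>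
    generically V (\<lambda>g. pivot_forms (degree_part (member g) d) d \<J> (\<lambda>J j. spec_at g (F J j)))"
proof -
  let ?P = "degree_part M d"
  define \<J> where "\<J> = {J. J \<subseteq> mons d \<and> card J = r \<and> separating V ?P J}"
  have fin: "finite J" if "J \<subseteq> mons d" for J :: "('n \<Rightarrow>\<^sub>0 nat) set" using that finite_mons by (rule finite_subset)
  have ex: "\<exists>F. generic_pivot_form V ?P J j F" if J: "J \<in> \<J>" and j: "j \<in> J" for J j
  proof -
    have J': "J \<subseteq> mons d" "card J = r" "separating V ?P J" using J by (simp_all add: \<J>_def)
    from separating_minimal[OF fin[OF J'(1)] J'(3)] obtain J0 where
      J0: "J0 \<subseteq> J" "separating V ?P J0" "\<forall>j\<in>J0. \<not> separating V ?P (J0 - {j})" by blast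
    have "finite J0" using J0(1) fin[OF J'(1)] by (rule finite_subset)
    from card_minimal_separating[OF this J0(2,3) r] have "J0 = J"
      using card_subset_eq[OF fin[OF J'(1)] J0(1)] J'(2) by simp
    then show ?thesis using separating_remove[OF J'(3)] J0(3) j by blast
  qed
  define F where "F J j = (SOME F. generic_pivot_form V ?P J j F)" for J j
  have F: "generic_pivot_form V ?P J j (F J j)" if "J \<in> \<J>" "j \<in> J" for J j
    unfolding F_def by (rule someI_ex[OF ex[OF that]])
  have F_props: "F J j \<in> ?P" "nonvanishing V (coef (F J j) j)"
      "\<And>i. i \<in> J \<Longrightarrow> i \<noteq> j \<Longrightarrow> \<not> nonvanishing V (coef (F J j) i)" if "J \<in> \<J>" "j \<in> J" for J j
    using F[OF that] by (simp_all add: generic_pivot_form_def)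
  have fin\<J>: "finite \<J>" by (rule finite_subset[of _ "Pow (mons d)"]) (auto simp: \<J>_def)
  have G1: "generically V (\<lambda>g. \<forall>J\<in>\<J>. \<forall>j\<in>J. eval_L g (coef (F J j) j) \<noteq> 0)"
    by (intro generically_ball[OF V] fin\<J> generically_nonvanishing[OF V] F_props(2)) (auto simp: \<J>_def intro: fin)
  define \<N> where "\<N> = {J. J \<subseteq> mons d \<and> \<not> separating V ?P J}"
  have G2: "generically V (\<lambda>g. \<forall>J\<in>\<N>. \<not> pivot_set (degree_part (member g) d) J)"
  proof (rule generically_ball[OF V])
    show "finite \<N>" by (rule finite_subset[of _ "Pow (mons d)"]) (auto simp: \<N>_def)
    fix J assume "J \<in> \<N>"
    then obtain G k where G: "G \<in> ?P" "\<forall>j\<in>J. \<not> nonvanishing V (coef G j)" "nonvanishing V (coef G k)"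
      by (auto simp: \<N>_def separating_def)
    from generically_nonvanishing[OF V G(3)] show "generically V (\<lambda>g. \<not> pivot_set (degree_part (member g) d) J)"
    proof (rule generically_mono, intro notI)
      fix g assume g: "g \<in> V" "eval_L g (coef G k) \<noteq> 0" and P: "pivot_set (degree_part (member g) d) J"
      have "\<forall>j\<in>J. coef (spec_at g G) j = 0" using G(2) g(1) eval_not_nonvanishing by auto
      then have "spec_at g G = 0" by (rule pivot_set_zero[OF P spec_at_degree_part[OF G(1)]])
      then have "coef (spec_at g G) k = 0" by simp
      then show False using g(2) by simp
    qed
  qed
  have "generically V (\<lambda>g. pivot_forms (degree_part (member g) d) d \<J> (\<lambda>J j. spec_at g (F J j)))"
  proof (rule generically_mono[OF generically_conj[OF V r generically_conj[OF V G1 G2]]])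
    fix g assume gV: "g \<in> V" and g: "hilbert (member g) d = r \<and> (\<forall>J\<in>\<J>. \<forall>j\<in>J. eval_L g (coef (F J j) j) \<noteq> 0) \<and>
        (\<forall>J\<in>\<N>. \<not> pivot_set (degree_part (member g) d) J)"
    show "pivot_forms (degree_part (member g) d) d \<J> (\<lambda>J j. spec_at g (F J j))"
    proof
      show "mpoly_vs.subspace (degree_part (member g) d)" by (rule subspace_member)
      show "keys f \<subseteq> mons d" if "f \<in> degree_part (member g) d" for f using that by (rule degree_part_keys)
      show "J \<subseteq> mons d" if "J \<in> \<J>" for J using that by (simp add: \<J>_def)
      show "spec_at g (F J j) \<in> degree_part (member g) d" if "J \<in> \<J>" "j \<in> J" for J j
        by (rule spec_at_degree_part[OF F_props(1)[OF that]])
      show "coef (spec_at g (F J j)) j \<noteq> 0" if "J \<in> \<J>" "j \<in> J" for J j using g that by simp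
      show "coef (spec_at g (F J j)) i = 0" if "J \<in> \<J>" "j \<in> J" "i \<in> J" "i \<noteq> j" for J j i
        using eval_not_nonvanishing[OF F_props(3)[OF that] gV] by simp
      show "pivot_set (degree_part (member g) d) J \<longleftrightarrow> J \<in> \<J>" if J: "J \<subseteq> mons d" for J
      proof
        assume P: "pivot_set (degree_part (member g) d) J"
        have "card J = r" using pivot_set_dim[OF subspace_member fin[OF J] P] g by (simp add: hilbert_def)
        moreover have "separating V ?P J" using g P J by (auto simp: \<N>_def)
        ultimately show "J \<in> \<J>" using J by (simp add: \<J>_def)
      next
        assume JJ: "J \<in> \<J>"
        show "pivot_set (degree_part (member g) d) J"
          by (rule pivot_set_specialized[OF fin[OF J] _ F[OF JJ] gV]) (use JJ g in \<open>simp_all add: \<J>_def\<close>)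
      qed
    qed
  qed
  moreover have "\<forall>J\<in>\<J>. J \<subseteq> mons d" by (simp add: \<J>_def)
  moreover have "\<forall>J\<in>\<J>. \<forall>j\<in>J. F J j \<in> ?P \<and> nonvanishing V (coef (F J j) j)" using F_props(1,2) by blast
  ultimately show ?thesis by (intro exI[of _ \<J>] exI[of _ F] conjI)
qed

end

section \<open>The generic tropical structure of a family\<close>

lemma hom_component_add: "hom_component d (f + g) = hom_component d f + hom_component d g"
  by (rule poly_mapping_eqI) (simp add: lookup_add)

lemma hom_component_sum: "hom_component d (sum f A) = (\<Sum>a\<in>A. hom_component d (f a))"
  by (rule poly_mapping_eqI) (simp add: lookup_sum)

lemma graded_genideal:
  fixes S :: "('n::finite, 'a::comm_ring_1) mpoly set"
  assumes S: "\<And>s d. s \<in> S \<Longrightarrow> hom_component d s \<in> Idl\<^bsub>type_ring\<^esub> S"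
  shows "graded_ideal (Idl\<^bsub>type_ring\<^esub> S)"
proof -
  define I where "I = Idl\<^bsub>type_ring\<^esub> S"
  have idI: "ideal I type_ring" unfolding I_def by (rule ideal_genideal)
  note I = ideal_type_ringD[OF idI]
  define K where "K = {f. \<forall>d. hom_component d f \<in> I}"
  have "ideal K type_ring"
    unfolding ideal_type_ring_iff
  proof (intro conjI ballI allI)
    have "hom_component d (0 :: ('n, 'a) mpoly) = 0" for d by (rule poly_mapping_eqI) simp
    then show "0 \<in> K" using I(1) by (simp add: K_def)
    show "f + g \<in> K" if "f \<in> K" "g \<in> K" for f g
      using that I(2) by (simp add: K_def hom_component_add)
    fix f q assume f: "f \<in> K"
    have 1: "hom_component d (single u c * f) \<in> I" for d u c
    proof (cases "mdegree u \<le> d")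
      case True
      then have "hom_component d (single u c * f) = single u c * hom_component (d - mdegree u) f"
        using hom_component_single_mult[of u "d - mdegree u" c f] by simp
      then show ?thesis using f I(3) by (simp add: K_def)
    next
      case False
      have "hom_component d (single u c * f) = 0"
      proof (rule poly_mapping_eqI)
        fix a
        have "coef (single u c * f) a = 0" if "mdegree a = d"
          by (rule coef_single_mult_eq_0) (use that False in auto)
        then show "coef (hom_component d (single u c * f)) a = coef 0 a" by simp
      qed
      then show ?thesis using I(1) by simp
    qed
    have sumI: "(\<Sum>u\<in>A. p u) \<in> I" if "\<And>u. p u \<in> I" for A and p :: "('n \<Rightarrow>\<^sub>0 nat) \<Rightarrow> ('n, 'a) mpoly"
      by (induction A rule: infinite_finite_induct) (simp_all add: I that)
    have "hom_component d (q * f) \<in> I" for d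
    proof -
      have "q * f = (\<Sum>u\<in>keys q. single u (coef q u)) * f"
        by (simp only: poly_mapping_sum_single[symmetric])
      then show ?thesis by (simp add: sum_distrib_right hom_component_sum sumI 1)
    qed
    then show "q * f \<in> K" by (simp add: K_def)
  qed
  moreover have "S \<subseteq> K" using S by (auto simp: K_def I_def)
  ultimately have "I \<subseteq> K" unfolding I_def by (rule genideal_least)
  then show ?thesis unfolding I_def[symmetric] graded_ideal_def using idI by (auto simp: K_def)
qed

lemma hom_component_homogeneous:
  assumes "homogeneous s" shows "hom_component d s = s \<or> hom_component d s = 0"
proof -
  obtain e where e: "\<forall>m\<in>keys s. mdegree m = e" using assms unfolding homogeneous_def by (rule exE)
  have "coef s m = 0" if "mdegree m \<noteq> e" for m using e that by (auto simp: in_keys_iff)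
  then have "hom_component d s = (if d = e then s else 0)" by (intro poly_mapping_eqI) auto
  then show ?thesis by simp
qed

lemma graded_genideal_homogeneous:
  fixes S :: "('n::finite, 'a::comm_ring_1) mpoly set"
  assumes "\<And>s. s \<in> S \<Longrightarrow> homogeneous s"
  shows "graded_ideal (Idl\<^bsub>type_ring\<^esub> S)"
proof (rule graded_genideal)
  fix s d assume s: "s \<in> S"
  have "0 \<in> Idl\<^bsub>type_ring\<^esub> S" by (rule ideal_type_ringD(1)[OF ideal_genideal])
  moreover have "s \<in> Idl\<^bsub>type_ring\<^esub> S" by (rule subsetD[OF subset_genideal s])
  ultimately show "hom_component d s \<in> Idl\<^bsub>type_ring\<^esub> S"
    using hom_component_homogeneous[OF assms[OF s], of d] by auto
qed

lemma initial_ideal_mono: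
  assumes "ideal I type_ring" "ideal J type_ring" "I \<subseteq> J"
  shows "initial_ideal \<omega> I \<subseteq> initial_ideal \<omega> J"
  unfolding initial_ideal_eq_residues[OF assms(1)] initial_ideal_eq_residues[OF assms(2)] residues_def
  using assms(3) by blast

lemma tropical_set_antimono:
  assumes "ideal I type_ring" "ideal J type_ring" "I \<subseteq> J"
  shows "tropical_set J \<subseteq> tropical_set I"
  using initial_ideal_mono[OF assms] unfolding tropical_set_def by blast

lemma initial_monomial_in_initial_ideal:
  assumes I: "ideal I type_ring" "f \<in> I" and m: "initial_support \<omega> f = {m}"
  shows "single m 1 \<in> initial_ideal \<omega> I"
proof -
  let ?c = "initial_form \<omega> f"
  have "coef ?c m \<noteq> 0" using m by (simp add: coef_initial_form_nonzero_iff)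
  moreover have "coef ?c i = 0" if "i \<noteq> m" for i using that m by (simp add: coef_initial_form_support)
  ultimately have eq: "mconst (inverse (coef ?c m)) * ?c = single m 1"
    by (intro poly_mapping_eqI) (auto simp: lookup_single when_def)
  have "mconst (inverse (coef ?c m)) * ?c \<in> residues \<omega> I"
    by (intro mpoly_vs.subspace_scale subspace_residues subspace_ideal I(1) initial_form_in_residues I(2))
  then show ?thesis by (simp only: eq initial_ideal_eq_residues[OF I(1)])
qed

text \<open>The data of the pivot forms on which initial spaces depend; the value \<open>None\<close> stands for infinite valuation.\<close>

definition coef_valuations :: "('n, 'k::field hahn) mpoly \<Rightarrow> ('n \<Rightarrow>\<^sub>0 nat) \<Rightarrow> real option" where
  "coef_valuations f k = (if coef f k = 0 then None else Some (hahn_val (coef f k)))"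

lemma initial_support_cong:
  assumes "coef_valuations f = coef_valuations f'"
  shows "initial_support \<omega> f = initial_support \<omega> f'"
proof -
  have e: "coef_valuations f k = coef_valuations f' k" for k by (simp add: assms)
  have k: "k \<in> keys f \<longleftrightarrow> k \<in> keys f'" for k
    using e[of k] by (simp add: coef_valuations_def in_keys_iff split: if_splits)
  have w: "term_weight \<omega> f k = term_weight \<omega> f' k" if "k \<in> keys f" for k
    using e[of k] that k[of k] by (simp add: coef_valuations_def term_weight_def in_keys_iff)
  have "keys f' = keys f" using k by blast
  then show ?thesis unfolding initial_support_def using w by auto
qed

context ideal_family
begin

lemma generic_coef_valuations: "\<exists>s. generically V (\<lambda>g. coef_valuations (spec_at g F) = s)"
proof -
  have "\<exists>s. generically V (\<lambda>g. coef_valuations (spec_at g F) k = s)" for k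
  proof (cases "nonvanishing V (coef F k)")
    case True
    then obtain v where "generically V (\<lambda>g. eval_L g (coef F k) \<noteq> 0 \<and> hahn_val (eval_L g (coef F k)) = v)"
      using generic_valuation[OF V] by blast
    then have "generically V (\<lambda>g. coef_valuations (spec_at g F) k = Some v)"
      by (rule generically_mono) (simp add: coef_valuations_def)
    then show ?thesis by (rule exI)
  next
    case False
    then have "generically V (\<lambda>g. coef_valuations (spec_at g F) k = None)"
      by (intro generically_all[OF V]) (simp add: coef_valuations_def eval_not_nonvanishing)
    then show ?thesis by (rule exI)
  qed
  then obtain s where s: "\<And>k. generically V (\<lambda>g. coef_valuations (spec_at g F) k = s k)" by metis
  have "generically V (\<lambda>g. \<forall>k\<in>keys F. coef_valuations (spec_at g F) k = s k)"
    by (rule generically_ball[OF V finite_keys s])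
  then have "generically V (\<lambda>g. coef_valuations (spec_at g F) = (\<lambda>k. if k \<in> keys F then s k else None))"
    by (rule generically_mono) (auto simp: coef_valuations_def in_keys_iff fun_eq_iff)
  then show ?thesis by (intro exI[of _ "\<lambda>k. if k \<in> keys F then s k else None"])
qed

text \<open>By the uniform degree bounds, finitely many degrees decide everything, and in each degree the generic pivot
  forms do, by the valuations of their coefficients. These forms are also a tropical basis: in each relevant degree
  they contain a basis of the member, and a monomial in the initial ideal is, up to a constant, the initial form of
  one of them.\<close>

theorem generic_tropical_structure:
  assumes h: "generically V (\<lambda>g. hilbert (member g) = h)"
  shows "\<exists>B R T. finite B \<and> B \<subseteq> M \<and> (\<forall>F\<in>B. \<exists>d. keys F \<subseteq> mons d) \<and>
    (\<forall>F\<in>B. \<exists>k. nonvanishing V (coef F k)) \<and>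
    generically V (\<lambda>g. (\<forall>\<omega> \<omega>'. initial_ideal \<omega> (member g) = initial_ideal \<omega>' (member g) \<longleftrightarrow> R \<omega> \<omega>') \<and>
      tropical_set (member g) = T \<and> tropical_basis (member g) (spec_at g ` B))"
proof -
  \<comment> \<open>degree bounds for the generators of the initial ideals and of the members of the family, and for monomials\<close>
  obtain D1 where D1: "\<forall>I J :: ('n, 'k) mpoly set. graded_ideal I \<longrightarrow> graded_ideal J \<longrightarrow> hilbert I = h \<longrightarrow>
      (\<forall>d\<le>D1. degree_part I d \<subseteq> J) \<longrightarrow> I \<subseteq> J"
    using uniform_generation_bound[of h] by (rule exE)
  obtain D2 where D2: "\<forall>I J :: ('n, 'k hahn) mpoly set. graded_ideal I \<longrightarrow> graded_ideal J \<longrightarrow> hilbert I = h \<longrightarrow>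
      (\<forall>d\<le>D2. degree_part I d \<subseteq> J) \<longrightarrow> I \<subseteq> J"
    using uniform_generation_bound[of h] by (rule exE)
  obtain D3 where D3: "\<forall>I :: ('n, 'k) mpoly set. graded_ideal I \<longrightarrow> hilbert I = h \<longrightarrow>
      (\<exists>m. single m 1 \<in> I) \<longrightarrow> (\<exists>m. mdegree m \<le> D3 \<and> single m 1 \<in> I)"
    using uniform_monomial_bound[of h] by (rule exE)
  define D where "D = max D1 (max D2 D3)"
  define Q where "Q d \<J> F \<longleftrightarrow> (\<forall>J\<in>\<J>. J \<subseteq> mons d) \<and>
      (\<forall>J\<in>\<J>. \<forall>j\<in>J. F J j \<in> degree_part M d \<and> nonvanishing V (coef (F J j) j)) \<and>
      generically V (\<lambda>g. pivot_forms (degree_part (member g) d) d \<J> (\<lambda>J j. spec_at g (F J j)))" for d \<J> F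
  have "\<exists>\<J> F. Q d \<J> F" for d
  proof -
    have "generically V (\<lambda>g. hilbert (member g) d = h d)" using h by (rule generically_mono) simp
    then show ?thesis unfolding Q_def by (rule generic_pivot_forms_exist)
  qed
  then obtain \<J> F where Q: "\<And>d. Q d (\<J> d) (F d)" by metis
  note JF = Q[unfolded Q_def]
  have \<J>_mons: "J \<subseteq> mons d" if "J \<in> \<J> d" for J d using JF[of d] that by blast
  have F_part: "F d J j \<in> degree_part M d" and F_nv: "nonvanishing V (coef (F d J j) j)"
    if "J \<in> \<J> d" "j \<in> J" for d J j using JF[of d] that by blast+
  have pf: "generically V (\<lambda>g. pivot_forms (degree_part (member g) d) d (\<J> d) (\<lambda>J j. spec_at g (F d J j)))" for d
    using JF[of d] by (elim conjE)
  define A where "A = Sigma {..D} (\<lambda>d. Sigma (\<J> d) (\<lambda>J. J))"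
  have "finite (\<J> d)" for d
    by (rule finite_subset[of _ "Pow (mons d)"]) (use \<J>_mons in auto)
  moreover have "finite J" if "J \<in> \<J> d" for J d using \<J>_mons[OF that] finite_mons by (rule finite_subset)
  ultimately have finA: "finite A" unfolding A_def by (intro finite_SigmaI) auto
  define form where "form = (\<lambda>(d, J, j). F d J j)"
  define B where "B = form ` A"
  have B_E: "\<exists>d J j. d \<le> D \<and> J \<in> \<J> d \<and> j \<in> J \<and> G = F d J j" if "G \<in> B" for G
    using that by (auto simp: B_def A_def form_def)
  obtain s where s: "\<And>F. generically V (\<lambda>g. coef_valuations (spec_at g F) = s F)"
    using generic_coef_valuations by metis
  \<comment> \<open>the finitely many generic conditions; any two matrices that satisfy them have the same combinatorial data\<close>
  define good where "good g \<longleftrightarrow> hilbert (member g) = h \<and>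
      (\<forall>d\<in>{..D}. pivot_forms (degree_part (member g) d) d (\<J> d) (\<lambda>J j. spec_at g (F d J j))) \<and>
      (\<forall>a\<in>A. coef_valuations (spec_at g (form a)) = s (form a))" for g
  have gen: "generically V good" unfolding good_def
    by (intro generically_conj[OF V] generically_ball[OF V] h pf s finA finite_atMost)
  obtain g0 where g0: "good g0" using generically_ex[OF gen] by blast
  have part: "degree_part (initial_ideal \<omega> (member g)) d = residues \<omega> (degree_part (member g) d)" for \<omega> g d
    by (rule degree_part_initial_ideal[OF graded_member])
  have grI: "graded_ideal (initial_ideal \<omega> (member g))" for \<omega> g by (rule graded_initial_ideal[OF graded_member])
  have idm: "ideal (member g) type_ring" for g by (rule graded_ideal_ideal[OF graded_member])
  have pfg: "pivot_forms (degree_part (member g) d) d (\<J> d) (\<lambda>J j. spec_at g (F d J j))" if "good g" "d \<le> D" for g d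
    using that by (simp add: good_def)
  have hilb: "hilbert (initial_ideal \<omega> (member g)) = h" if "good g" for g \<omega>
    using that hilbert_initial_ideal[OF graded_member, of \<omega> g] by (simp add: good_def)
  have sup: "initial_support \<omega> (spec_at g (F d J j)) = initial_support \<omega> (spec_at g0 (F d J j))"
    if "good g" "d \<le> D" "J \<in> \<J> d" "j \<in> J" for g d J j \<omega>
  proof (rule initial_support_cong)
    have "(d, J, j) \<in> A" using that by (simp add: A_def)
    then have "coef_valuations (spec_at g' (form (d, J, j))) = s (form (d, J, j))" if "good g'" for g'
      using that unfolding good_def by blast
    from this[OF that(1)] this[OF g0] show "coef_valuations (spec_at g (F d J j)) = coef_valuations (spec_at g0 (F d J j))"
      by (simp add: form_def)
  qed
  let ?opt = "\<lambda>g d. optimal (\<J> d) (\<lambda>J j. spec_at g (F d J j))"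
  have opt: "?opt g d \<omega> J \<longleftrightarrow> ?opt g0 d \<omega> J" if "good g" "d \<le> D" for g d \<omega> J
    unfolding optimal_def using sup[OF that] by auto
  have res_eq: "residues \<omega> (degree_part (member g) d) = residues \<omega>' (degree_part (member g) d) \<longleftrightarrow>
      residues \<omega> (degree_part (member g0) d) = residues \<omega>' (degree_part (member g0) d)"
    if g: "good g" "d \<le> D" for g d \<omega> \<omega>'
  proof -
    have "(\<forall>j\<in>J. initial_support \<omega> (spec_at g (F d J j)) = initial_support \<omega>' (spec_at g (F d J j))) \<longleftrightarrow>
        (\<forall>j\<in>J. initial_support \<omega> (spec_at g0 (F d J j)) = initial_support \<omega>' (spec_at g0 (F d J j)))"
      if "?opt g0 d \<omega> J" for J
      using that sup[OF g, of J] by (simp add: optimal_def)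
    then show ?thesis
      unfolding pivot_forms.residues_eq_iff[OF pfg[OF g]] pivot_forms.residues_eq_iff[OF pfg[OF g0 g(2)]] opt[OF g]
      by blast
  qed
  have mon: "single m 1 \<in> residues \<omega> (degree_part (member g) (mdegree m)) \<longleftrightarrow>
      (\<exists>J. ?opt g0 (mdegree m) \<omega> J \<and> m \<in> J \<and> initial_support \<omega> (spec_at g0 (F (mdegree m) J m)) = {m})"
    if g: "good g" "mdegree m \<le> D" for g m \<omega>
  proof -
    have "initial_support \<omega> (spec_at g (F (mdegree m) J m)) = initial_support \<omega> (spec_at g0 (F (mdegree m) J m))"
      if "?opt g0 (mdegree m) \<omega> J" "m \<in> J" for J
      using that sup[OF g, of J m] by (simp add: optimal_def)
    then show ?thesis
      unfolding pivot_forms.monomial_in_residues_iff[OF pfg[OF g] refl] opt[OF g] by metis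
  qed
  have in_eq: "initial_ideal \<omega> (member g) = initial_ideal \<omega>' (member g) \<longleftrightarrow>
      (\<forall>d\<le>D. residues \<omega> (degree_part (member g) d) = residues \<omega>' (degree_part (member g) d))" if g: "good g" for g \<omega> \<omega>'
  proof
    assume "initial_ideal \<omega> (member g) = initial_ideal \<omega>' (member g)"
    then show "\<forall>d\<le>D. residues \<omega> (degree_part (member g) d) = residues \<omega>' (degree_part (member g) d)"
      by (simp only: part[symmetric]) simp
  next
    assume eq: "\<forall>d\<le>D. residues \<omega> (degree_part (member g) d) = residues \<omega>' (degree_part (member g) d)"
    \<comment> \<open>equality in the degrees up to \<open>D\<close> yields both inclusions, by the generation bound over \<open>K\<close>\<close>
    have half: "initial_ideal \<omega>1 (member g) \<subseteq> initial_ideal \<omega>2 (member g)"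
      if "\<And>d. d \<le> D \<Longrightarrow> residues \<omega>1 (degree_part (member g) d) = residues \<omega>2 (degree_part (member g) d)" for \<omega>1 \<omega>2
    proof (rule D1[rule_format, OF grI grI hilb[OF g]])
      fix d assume "d \<le> D1"
      then have "d \<le> D" by (simp add: D_def)
      from that[OF this] have "degree_part (initial_ideal \<omega>1 (member g)) d = degree_part (initial_ideal \<omega>2 (member g)) d"
        by (simp only: part)
      then show "degree_part (initial_ideal \<omega>1 (member g)) d \<subseteq> initial_ideal \<omega>2 (member g)"
        unfolding degree_part_def by blast
    qed
    show "initial_ideal \<omega> (member g) = initial_ideal \<omega>' (member g)"
      by (rule equalityI; rule half) (simp_all add: eq)
  qed
  have single_part: "single m 1 \<in> initial_ideal \<omega> (member g) \<longleftrightarrow>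
      single m 1 \<in> residues \<omega> (degree_part (member g) (mdegree m))" for m \<omega> g
    unfolding part[symmetric] by (simp add: degree_part_def keys_single_subset_mons)
  have trop: "\<omega> \<notin> tropical_set (member g) \<longleftrightarrow>
      (\<exists>m. mdegree m \<le> D \<and> single m 1 \<in> residues \<omega> (degree_part (member g) (mdegree m)))"
    if g: "good g" for g \<omega>
  proof -
    have "\<exists>m. mdegree m \<le> D \<and> single m 1 \<in> initial_ideal \<omega> (member g)"
      if m: "single m 1 \<in> initial_ideal \<omega> (member g)" for m
    proof -
      obtain m' where "mdegree m' \<le> D3" "single m' 1 \<in> initial_ideal \<omega> (member g)"
        using D3[rule_format, OF grI hilb[OF g]] m by blast
      then show ?thesis by (intro exI[of _ m']) (simp add: D_def)
    qed
    then show ?thesis unfolding tropical_set_def mem_Collect_eq single_part[symmetric] by blast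
  qed
  have main: "(\<forall>\<omega> \<omega>'. initial_ideal \<omega> (member g) = initial_ideal \<omega>' (member g) \<longleftrightarrow>
        initial_ideal \<omega> (member g0) = initial_ideal \<omega>' (member g0)) \<and>
      tropical_set (member g) = tropical_set (member g0) \<and> tropical_basis (member g) (spec_at g ` B)"
    if g: "good g" for g
  proof (intro conjI allI)
    show "initial_ideal \<omega> (member g) = initial_ideal \<omega>' (member g) \<longleftrightarrow>
        initial_ideal \<omega> (member g0) = initial_ideal \<omega>' (member g0)" for \<omega> \<omega>'
      unfolding in_eq[OF g] in_eq[OF g0] using res_eq[OF g] by simp
    have "\<omega> \<notin> tropical_set (member g) \<longleftrightarrow> \<omega> \<notin> tropical_set (member g0)" for \<omega>
      unfolding trop[OF g] trop[OF g0] using mon[OF g] mon[OF g0] by auto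
    then show "tropical_set (member g) = tropical_set (member g0)" by blast
    have form_in: "spec_at g (F d J j) \<in> spec_at g ` B" if "d \<le> D" "J \<in> \<J> d" "j \<in> J" for d J j
    proof -
      have "(d, J, j) \<in> A" using that by (simp add: A_def)
      then have "form (d, J, j) \<in> B" unfolding B_def by (rule imageI)
      then show ?thesis by (simp add: form_def)
    qed
    have B_part: "\<exists>d. f \<in> degree_part (member g) d" if f: "f \<in> spec_at g ` B" for f
    proof -
      obtain d J j where "J \<in> \<J> d" "j \<in> J" "f = spec_at g (F d J j)"
        using f B_E by blast
      then show ?thesis using spec_at_degree_part[OF F_part] by blast
    qed
    have hom: "homogeneous f" if "f \<in> spec_at g ` B" for f
      using B_part[OF that] by (auto simp: degree_part_def homogeneous_def subset_iff)
    have B_mem: "spec_at g ` B \<subseteq> member g" using B_part by (auto simp: degree_part_def)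
    have idB: "ideal (Idl\<^bsub>type_ring\<^esub> (spec_at g ` B)) type_ring" by (rule ideal_genideal)
    have Idl_le: "Idl\<^bsub>type_ring\<^esub> (spec_at g ` B) \<subseteq> member g" by (rule genideal_least[OF idm B_mem])
    moreover have "member g \<subseteq> Idl\<^bsub>type_ring\<^esub> (spec_at g ` B)"
    proof (rule D2[rule_format, OF graded_member graded_genideal_homogeneous[OF hom]])
      show "hilbert (member g) = h" using g by (simp add: good_def)
      fix d assume "d \<le> D2"
      then have d: "d \<le> D" by (simp add: D_def)
      interpret pivot_forms "degree_part (member g) d" d "\<J> d" "\<lambda>J j. spec_at g (F d J j)" by (rule pfg[OF g d])
      obtain J where "?opt g d 0 J" by (rule optimal_exists)
      then have J: "J \<in> \<J> d" by (simp add: optimal_def)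
      \<comment> \<open>the forms of one pivot set, normalized, are a vector space basis in degree \<open>d\<close>\<close>
      let ?b = "\<lambda>j. mconst (inverse (coef (spec_at g (F d J j)) j)) * spec_at g (F d J j)"
      have b: "coef (?b j) i = (if i = j then 1 else 0)" if "j \<in> J" "i \<in> J" for i j
      proof (cases "i = j")
        case True then show ?thesis using F_self[OF J that(1)] by simp
      next
        case False then show ?thesis using F_other[OF J that False] by simp
      qed
      have b1: "?b j \<in> degree_part (member g) d" if "j \<in> J" for j
        by (rule mpoly_vs.subspace_scale[OF subspace F_in[OF J that]])
      have b2: "?b j \<in> Idl\<^bsub>type_ring\<^esub> (spec_at g ` B)" if "j \<in> J" for j
        by (rule mpoly_vs.subspace_scale[OF subspace_ideal[OF idB] subsetD[OF subset_genideal form_in[OF d J that]]])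
      show "degree_part (member g) d \<subseteq> Idl\<^bsub>type_ring\<^esub> (spec_at g ` B)"
      proof
        fix f assume f: "f \<in> degree_part (member g) d"
        have "f = (\<Sum>j\<in>J. mconst (coef f j) * ?b j)"
          by (rule pivot_expansion[OF subspace finite_pivot[OF J]])
            (rule f b1 b pivot_set_zero[OF pivot[OF J]] | assumption)+
        moreover have "(\<Sum>j\<in>J. mconst (coef f j) * ?b j) \<in> Idl\<^bsub>type_ring\<^esub> (spec_at g ` B)"
          by (intro mpoly_vs.subspace_sum mpoly_vs.subspace_scale subspace_ideal[OF idB] b2)
        ultimately show "f \<in> Idl\<^bsub>type_ring\<^esub> (spec_at g ` B)" by simp
      qed
    qed
    ultimately have Idl_eq: "Idl\<^bsub>type_ring\<^esub> (spec_at g ` B) = member g" by (rule equalityI)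
    have "tropical_set (member g) = (\<Inter>f\<in>spec_at g ` B. tropical_set (Idl\<^bsub>type_ring\<^esub> {f}))"
    proof (rule equalityI)
      show "tropical_set (member g) \<subseteq> (\<Inter>f\<in>spec_at g ` B. tropical_set (Idl\<^bsub>type_ring\<^esub> {f}))"
      proof (rule INF_greatest)
        fix f assume "f \<in> spec_at g ` B"
        then have "{f} \<subseteq> member g" using B_mem by blast
        from genideal_least[OF idm this]
        show "tropical_set (member g) \<subseteq> tropical_set (Idl\<^bsub>type_ring\<^esub> {f})"
          by (rule tropical_set_antimono[OF ideal_genideal idm])
      qed
      show "(\<Inter>f\<in>spec_at g ` B. tropical_set (Idl\<^bsub>type_ring\<^esub> {f})) \<subseteq> tropical_set (member g)"
      proof (rule subsetI, rule ccontr)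
        fix \<omega> assume \<omega>: "\<omega> \<in> (\<Inter>f\<in>spec_at g ` B. tropical_set (Idl\<^bsub>type_ring\<^esub> {f}))" "\<omega> \<notin> tropical_set (member g)"
        then obtain m where m: "mdegree m \<le> D"
            "single m 1 \<in> residues \<omega> (degree_part (member g) (mdegree m))"
          using trop[OF g] by blast
        then obtain J where J: "?opt g (mdegree m) \<omega> J" "m \<in> J" "initial_support \<omega> (spec_at g (F (mdegree m) J m)) = {m}"
          unfolding pivot_forms.monomial_in_residues_iff[OF pfg[OF g m(1)] refl] by blast
        have JJ: "J \<in> \<J> (mdegree m)" using J(1) by (simp add: optimal_def)
        let ?f = "spec_at g (F (mdegree m) J m)"
        have "?f \<in> Idl\<^bsub>type_ring\<^esub> {?f}" by (rule subsetD[OF subset_genideal]) simp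
        from initial_monomial_in_initial_ideal[OF ideal_genideal this J(3)]
        have "\<omega> \<notin> tropical_set (Idl\<^bsub>type_ring\<^esub> {?f})" unfolding tropical_set_def by blast
        then show False using \<omega>(1) form_in[OF m(1) JJ J(2)] by blast
      qed
    qed
    moreover have "finite (spec_at g ` B)" using finA by (simp add: B_def)
    ultimately show "tropical_basis (member g) (spec_at g ` B)"
      unfolding tropical_basis_def using hom Idl_eq by simp
  qed
  show ?thesis
  proof (intro exI[of _ B] exI[of _ "\<lambda>\<omega> \<omega>'. initial_ideal \<omega> (member g0) = initial_ideal \<omega>' (member g0)"]
      exI[of _ "tropical_set (member g0)"] conjI ballI)
    show "finite B" using finA by (simp add: B_def)
    show "B \<subseteq> M" 
    proof
      fix G assume "G \<in> B"
      then obtain d J j where "J \<in> \<J> d" "j \<in> J" "G = F d J j" using B_E by blast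
      then show "G \<in> M" using F_part[of J d j] by (simp add: degree_part_def)
    qed
    show "\<exists>d. keys G \<subseteq> mons d" if G: "G \<in> B" for G
    proof -
      obtain d J j where "J \<in> \<J> d" "j \<in> J" "G = F d J j" using B_E[OF G] by blast
      then show ?thesis using F_part[of J d j] by (auto simp: degree_part_def)
    qed
    show "\<exists>k. nonvanishing V (coef G k)" if G: "G \<in> B" for G
    proof -
      obtain d J j where "J \<in> \<J> d" "j \<in> J" "G = F d J j" using B_E[OF G] by blast
      then show ?thesis using F_nv[of J d j] by blast
    qed
    show "generically V (\<lambda>g. (\<forall>\<omega> \<omega>'. initial_ideal \<omega> (member g) = initial_ideal \<omega>' (member g) \<longleftrightarrow>
        initial_ideal \<omega> (member g0) = initial_ideal \<omega>' (member g0)) \<and>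
      tropical_set (member g) = tropical_set (member g0) \<and> tropical_basis (member g) (spec_at g ` B))"
      by (rule generically_mono[OF gen main])
  qed
qed

end

section \<open>The family of the ideals g(I)\<close>

definition generic_image :: "('n::finite, 'k::field hahn) mpoly \<Rightarrow> ('n, ('n \<times> 'n, 'k hahn) mpoly) mpoly" where
  "generic_image = msubst (\<lambda>c. mconst (mconst c)) (\<lambda>i. \<Sum>j\<in>UNIV. mconst (mvar (j, i)) * mvar j)"

lemma additive_sum:
  fixes \<phi> :: "'a::comm_monoid_add \<Rightarrow> 'b::comm_monoid_add"
  assumes "\<phi> 0 = 0" "\<And>a b. \<phi> (a + b) = \<phi> a + \<phi> b"
  shows "\<phi> (sum f A) = (\<Sum>a\<in>A. \<phi> (f a))"
  by (induction A rule: infinite_finite_induct) (simp_all add: assms)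

lemma hom_msubst:
  fixes \<phi> :: "'b::comm_ring_1 \<Rightarrow> 'c::comm_ring_1"
  assumes \<phi>: "\<phi> 0 = 0" "\<phi> 1 = 1" "\<And>a b. \<phi> (a + b) = \<phi> a + \<phi> b" "\<And>a b. \<phi> (a * b) = \<phi> a * \<phi> b"
  shows "\<phi> (msubst h x f) = msubst (\<lambda>c. \<phi> (h c)) (\<lambda>i. \<phi> (x i)) f"
proof -
  have power: "\<phi> (a ^ k) = \<phi> a ^ k" for a k by (induction k) (simp_all add: \<phi>)
  have prod: "\<phi> (prod p A) = (\<Prod>a\<in>A. \<phi> (p a))" for p and A :: "'d set"
    by (induction A rule: infinite_finite_induct) (simp_all add: \<phi>)
  show ?thesis by (simp add: msubst_def additive_sum[of \<phi>] \<phi> power prod)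
qed

lemma msubst_mvar: "h 0 = 0 \<Longrightarrow> h 1 = 1 \<Longrightarrow> msubst h x (mvar i) = x i"
  unfolding mvar_def by (subst msubst_single) (simp_all add: lookup_single when_def if_distrib prod.If_cases cong: if_cong)

lemma msubst_mconst: "h 0 = 0 \<Longrightarrow> msubst h x (mconst c) = h c"
  unfolding mconst_def by (subst msubst_single) simp_all

lemma spec_at_1 [simp]: "spec_at g 1 = 1"
  by (rule poly_mapping_eqI) (simp add: lookup_one when_def)

lemma spec_at_mconst [simp]: "spec_at g (mconst a) = mconst (eval_L g a)"
  by (rule poly_mapping_eqI) (simp add: mconst_def lookup_single when_def)

lemma spec_at_mvar [simp]: "spec_at g (mvar j) = mvar j"
  by (rule poly_mapping_eqI) (simp add: mvar_def lookup_single when_def)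

lemma eval_mvar [simp]: "mat_eval hahn_const g (mvar (j, i)) = hahn_const (g $ j $ i)"
  unfolding mat_eval_def by (subst msubst_mvar) simp_all

lemma spec_at_sum: "spec_at g (sum f A) = (\<Sum>a\<in>A. spec_at g (f a))"
  by (rule additive_sum) (simp_all add: spec_at_add)

lemma spec_at_generic_image: "spec_at g (generic_image f) = GL_act g f"
  unfolding generic_image_def GL_act_def
  by (subst hom_msubst[of "spec_at g"]) (simp_all add: spec_at_add spec_at_mult spec_at_sum)

lemma GL_act_add: "GL_act g (f + h) = GL_act g f + GL_act g h"
  and GL_act_mult: "GL_act g (f * h) = GL_act g f * GL_act g h"
  and GL_act_mconst [simp]: "GL_act g (mconst c) = mconst c"
  unfolding GL_act_def by (simp_all add: msubst_add msubst_mult msubst_mconst mconst_add mconst_mult)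

lemma GL_act_0 [simp]: "GL_act g 0 = 0"
  by (simp add: GL_act_def msubst_def)

lemma GL_act_1 [simp]: "GL_act g 1 = 1"
  using GL_act_mconst[of g 1] by simp

lemma GL_act_mvar: "GL_act g (mvar i) = (\<Sum>j\<in>UNIV. mconst (hahn_const (g $ j $ i)) * mvar j)"
  unfolding GL_act_def by (rule msubst_mvar) simp_all

lemma GL_act_sum: "GL_act g (sum f A) = (\<Sum>a\<in>A. GL_act g (f a))"
  by (rule additive_sum) (simp_all add: GL_act_add)

lemma hahn_const_add: "hahn_const (a + b) = hahn_const a + hahn_const b" for a :: "'k::comm_ring_1"
  by (rule hahn_eqI) (simp add: hahn_const_def hahn_coeff_monom)

lemma hahn_const_0 [simp]: "hahn_const 0 = (0 :: 'k::comm_ring_1 hahn)"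
  by (rule hahn_eqI) (simp add: hahn_const_def hahn_coeff_monom)

lemma hahn_const_sum: "hahn_const (sum f A) = (\<Sum>a\<in>A. hahn_const (f a))" for f :: "'i \<Rightarrow> 'k::comm_ring_1"
  by (rule additive_sum) (simp_all add: hahn_const_add)

lemma mconst_sum: "mconst (sum f A) = (\<Sum>a\<in>A. mconst (f a))"
  by (rule additive_sum) (simp_all add: mconst_add)

lemma GL_act_comp: "GL_act g (GL_act h f) = GL_act (g ** h) f"
proof -
  have "GL_act g (\<Sum>j\<in>UNIV. mconst (hahn_const (h $ j $ i)) * mvar j) =
      (\<Sum>k\<in>UNIV. mconst (hahn_const ((g ** h) $ k $ i)) * mvar k)" for i
  proof -
    have "GL_act g (\<Sum>j\<in>UNIV. mconst (hahn_const (h $ j $ i)) * mvar j) =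
        (\<Sum>j\<in>UNIV. \<Sum>k\<in>UNIV. mconst (hahn_const (h $ j $ i)) * (mconst (hahn_const (g $ k $ j)) * mvar k))"
      by (simp add: GL_act_sum GL_act_mult GL_act_mvar sum_distrib_left)
    also have "\<dots> = (\<Sum>k\<in>UNIV. \<Sum>j\<in>UNIV. mconst (hahn_const (h $ j $ i)) * (mconst (hahn_const (g $ k $ j)) * mvar k))"
      by (rule sum.swap)
    also have "\<dots> = (\<Sum>k\<in>UNIV. mconst (hahn_const ((g ** h) $ k $ i)) * mvar k)"
      by (simp add: matrix_matrix_mult_def hahn_const_sum hahn_const_mult mconst_sum mconst_mult sum_distrib_left
          sum_distrib_right mult_ac)
    finally show ?thesis .
  qed
  then show ?thesis
    unfolding GL_act_def[of h] GL_act_def[of "g ** h"]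
    by (subst hom_msubst[of "GL_act g"]) (simp_all add: GL_act_add GL_act_mult)
qed

lemma GL_act_mat_1: "GL_act (mat 1) f = f" for f :: "('n::finite, 'k::field hahn) mpoly"
proof -
  have "(\<Sum>j\<in>UNIV. mconst (hahn_const ((mat 1 :: 'k::field ^ 'n ^ 'n) $ j $ i)) * mvar j) = mvar i" for i :: 'n
  proof -
    have "(\<Sum>j\<in>UNIV. mconst (hahn_const ((mat 1 :: 'k ^ 'n ^ 'n) $ j $ i)) * mvar j) =
        (\<Sum>j\<in>UNIV. if j = i then mvar j else 0)"
      by (rule sum.cong) (auto simp: mat_def hahn_const_1)
    then show ?thesis by simp
  qed
  then have "GL_act (mat 1) f = msubst mconst mvar f" by (simp add: GL_act_def)
  then show ?thesis using coef_msubst_mvar[of "\<lambda>c. c" f] by (intro poly_mapping_eqI) simp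
qed

lemma GL_act_inverse:
  assumes "invertible g"
  obtains h where "\<And>f. GL_act g (GL_act h f) = f" "\<And>f. GL_act h (GL_act g f) = f"
proof -
  obtain h where "g ** h = mat 1" "h ** g = mat 1" using assms unfolding invertible_def by blast
  then show thesis by (intro that[of h]) (simp_all add: GL_act_comp GL_act_mat_1)
qed

lemma keys_sum_subset: "(\<And>a. a \<in> A \<Longrightarrow> keys (f a) \<subseteq> N) \<Longrightarrow> keys (sum f A) \<subseteq> N"
proof (induction A rule: infinite_finite_induct)
  case (insert x A)
  have "keys (f x + sum f A) \<subseteq> keys (f x) \<union> keys (sum f A)"
    by (rule keys_add)
  then show ?case using insert by auto
qed simp_all

lemma keys_mconst: "keys (mconst c :: ('n::finite, 'a::zero) mpoly) \<subseteq> mons 0"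
  by (auto simp: mconst_def in_keys_iff lookup_single when_def split: if_splits)

lemma keys_msubst_linear:
  fixes x :: "'n::finite \<Rightarrow> ('n, 'b::comm_ring_1) mpoly"
  assumes x: "\<forall>i. keys (x i) \<subseteq> mons 1" and f: "keys f \<subseteq> mons d"
  shows "keys (msubst (\<lambda>c. mconst (h c)) x f) \<subseteq> mons d"
  unfolding msubst_def
proof (rule keys_sum_subset)
  fix m assume "m \<in> keys f"
  then have m: "mdegree m = d" using f by auto
  have one: "keys (1 :: ('n, 'b) mpoly) \<subseteq> mons 0" using keys_mconst[of 1] by simp
  have power: "keys (x i ^ k) \<subseteq> mons k" for i k
    by (induction k) (use one keys_mult_subset_mons[OF x[rule_format]] in simp_all)
  have "keys (\<Prod>i\<in>A. x i ^ coef m i) \<subseteq> mons (\<Sum>i\<in>A. coef m i)" for A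
    by (induction A rule: infinite_finite_induct) (use one keys_mult_subset_mons[OF power] in simp_all)
  from this[of UNIV] have "keys (\<Prod>i\<in>UNIV. x i ^ coef m i) \<subseteq> mons d"
    unfolding m[symmetric] mdegree_def .
  from keys_mult_subset_mons[OF keys_mconst this]
  show "keys (mconst (h (coef f m)) * (\<Prod>i\<in>UNIV. x i ^ coef m i)) \<subseteq> mons d" by simp
qed

lemma hom_component_msubst_linear:
  fixes x :: "'n::finite \<Rightarrow> ('n, 'b::comm_ring_1) mpoly" and f :: "('n, 'a::comm_ring_1) mpoly"
  assumes x: "\<forall>i. keys (x i) \<subseteq> mons 1" and h: "h 0 = 0" "\<And>a b. h (a + b) = h a + h b"
  shows "hom_component d (msubst (\<lambda>c. mconst (h c)) x f) = msubst (\<lambda>c. mconst (h c)) x (hom_component d f)"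
proof -
  let ?\<phi> = "msubst (\<lambda>c. mconst (h c)) x"
  have add: "?\<phi> (a + b) = ?\<phi> a + ?\<phi> b" for a b by (rule msubst_add) (simp_all add: h mconst_add)
  have zero: "?\<phi> 0 = 0" by (simp add: msubst_def)
  have part: "hom_component d (?\<phi> (hom_component e f)) = (if e = d then ?\<phi> (hom_component e f) else 0)" for e
  proof -
    have "keys (hom_component e f) \<subseteq> mons e" by (auto simp: in_keys_iff split: if_splits)
    from keys_msubst_linear[OF x this, of h]
    have k: "coef (?\<phi> (hom_component e f)) m = 0" if "mdegree m \<noteq> e" for m
      using that by (auto simp: in_keys_iff subset_iff)
    show ?thesis by (rule poly_mapping_eqI) (use k in auto)
  qed
  have "?\<phi> f = ?\<phi> (\<Sum>e\<in>mdegree ` keys f. hom_component e f)" by (simp only: sum_hom_components)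
  also have "\<dots> = (\<Sum>e\<in>mdegree ` keys f. ?\<phi> (hom_component e f))"
    by (rule additive_sum[of ?\<phi>, OF zero add])
  finally have "hom_component d (?\<phi> f) = (\<Sum>e\<in>mdegree ` keys f. if e = d then ?\<phi> (hom_component e f) else 0)"
    by (simp only: hom_component_sum part)
  also have "\<dots> = (if d \<in> mdegree ` keys f then ?\<phi> (hom_component d f) else 0)" by simp
  also have "\<dots> = ?\<phi> (hom_component d f)"
  proof (cases "d \<in> mdegree ` keys f")
    case False
    then have "hom_component d f = 0" by (intro poly_mapping_eqI) (auto simp: in_keys_iff image_iff)
    then show ?thesis using False zero by simp
  qed simp
  finally show ?thesis .
qed

lemma keys_linear_form: "keys (\<Sum>j\<in>UNIV. mconst (c j) * mvar j :: ('n::finite, 'a::comm_ring_1) mpoly) \<subseteq> mons 1"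
proof (rule keys_sum_subset)
  fix j :: 'n
  have "keys (mvar j :: ('n, 'a) mpoly) \<subseteq> mons 1"
    using keys_single_subset_mons[of "single j 1" "1 :: 'a"] mdegree_power_mon[of j 1]
    by (simp add: mvar_def power_mon_def)
  from keys_mult_subset_mons[OF keys_mconst this] show "keys (mconst (c j) * mvar j :: ('n, 'a) mpoly) \<subseteq> mons 1" by simp
qed

lemma hom_component_GL_act: "hom_component d (GL_act g f) = GL_act g (hom_component d f)"
  unfolding GL_act_def using hom_component_msubst_linear[of _ "\<lambda>c. c", OF allI[OF keys_linear_form]] by simp

lemma hom_component_generic_image: "hom_component d (generic_image f) = generic_image (hom_component d f)"
  unfolding generic_image_def using hom_component_msubst_linear[of _ mconst, OF allI[OF keys_linear_form]] by (simp add: mconst_add)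

text \<open>The ideal of \<open>L[Y][x]\<close> generated by \<open>y(I)\<close>. Its specialization at \<open>g\<close> is \<open>g(I)\<close>, and it maps to \<open>y(I)\<close> over
  the function field.\<close>

definition generic_family :: "('n::finite, 'k::field hahn) mpoly set \<Rightarrow> ('n, ('n \<times> 'n, 'k hahn) mpoly) mpoly set" where
  "generic_family I = Idl\<^bsub>type_ring\<^esub> (generic_image ` I)"

lemma graded_generic_family:
  assumes "graded_ideal I"
  shows "graded_ideal (generic_family I)"
  unfolding generic_family_def
proof (rule graded_genideal)
  fix s d assume "s \<in> generic_image ` I"
  then obtain f where f: "f \<in> I" "s = generic_image f" by blast
  have "hom_component d f \<in> I" using assms f(1) by (simp add: graded_ideal_def)
  then have "hom_component d s \<in> generic_image ` I" by (simp add: f(2) hom_component_generic_image)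
  then show "hom_component d s \<in> Idl\<^bsub>type_ring\<^esub> (generic_image ` I)" by (rule subsetD[OF subset_genideal])
qed

lemma ideal_GL_act:
  assumes g: "invertible g" and I: "ideal I type_ring"
  shows "ideal (GL_act g ` I) type_ring"
  unfolding ideal_type_ring_iff
proof (intro conjI ballI allI)
  note II = ideal_type_ringD[OF I]
  show "0 \<in> GL_act g ` I" by (rule image_eqI[OF _ II(1)]) simp
  show "f + f' \<in> GL_act g ` I" if "f \<in> GL_act g ` I" "f' \<in> GL_act g ` I" for f f'
    using that II(2) by (auto simp: GL_act_add[symmetric])
  fix f q assume "f \<in> GL_act g ` I"
  then obtain f' where f': "f' \<in> I" "f = GL_act g f'" by blast
  obtain h where h: "\<And>f. GL_act g (GL_act h f) = f" using GL_act_inverse[OF g] by metis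
  show "q * f \<in> GL_act g ` I"
    by (rule image_eqI[OF _ II(3)[OF f'(1), of "GL_act h q"]]) (simp add: f'(2) GL_act_mult h)
qed

lemma spec_at_generic_family:
  assumes g: "invertible g" and I: "ideal I type_ring"
  shows "spec_at g ` generic_family I = GL_act g ` I"
proof (intro equalityI subsetI)
  fix f assume "f \<in> GL_act g ` I"
  then obtain f' where f': "f' \<in> I" "f = GL_act g f'" by blast
  have "generic_image f' \<in> generic_family I"
    unfolding generic_family_def by (rule subsetD[OF subset_genideal imageI[OF f'(1)]])
  then show "f \<in> spec_at g ` generic_family I" by (rule image_eqI[rotated]) (simp add: f'(2) spec_at_generic_image)
next
  note J = ideal_type_ringD[OF ideal_GL_act[OF assms]]
  have "ideal {F. spec_at g F \<in> GL_act g ` I} type_ring"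
    unfolding ideal_type_ring_iff mem_Collect_eq
  proof (intro conjI ballI allI)
    show "spec_at g 0 \<in> GL_act g ` I" using J(1) by simp
  qed (simp_all add: spec_at_add spec_at_mult J)
  moreover have "generic_image ` I \<subseteq> {F. spec_at g F \<in> GL_act g ` I}" by (auto simp: spec_at_generic_image)
  ultimately have "generic_family I \<subseteq> {F. spec_at g F \<in> GL_act g ` I}"
    unfolding generic_family_def by (rule genideal_least)
  then show "f \<in> GL_act g ` I" if "f \<in> spec_at g ` generic_family I" for f using that by blast
qed

lemma dim_GL_act_le:
  assumes sub: "mpoly_vs.subspace W" and keys: "\<forall>f\<in>W. keys f \<subseteq> N" and N: "finite N"
  shows "mpoly_vs.dim (GL_act g ` W) \<le> mpoly_vs.dim W"
proof -
  have "\<forall>f\<in>W. (\<forall>j\<in>N. coef f j = 0) \<longrightarrow> f = 0"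
  proof (intro ballI impI poly_mapping_eqI)
    fix f k assume f: "f \<in> W" "\<forall>j\<in>N. coef f j = 0"
    show "coef f k = coef 0 k" using bspec[OF keys f(1)] f(2) by (cases "k \<in> N") (auto simp: in_keys_iff)
  qed
  from pivot_subset_exists[OF sub N this] obtain J where J: "J \<subseteq> N" "pivot_set W J" by blast
  have finJ: "finite J" using J(1) N by (rule finite_subset)
  obtain b where b: "\<And>j. j \<in> J \<Longrightarrow> b j \<in> W" "\<And>j i. j \<in> J \<Longrightarrow> i \<in> J \<Longrightarrow> coef (b j) i = (if i = j then 1 else 0)"
    using pivot_set_basis[OF J(2)] by metis
  have "GL_act g ` W \<subseteq> mpoly_vs.span ((\<lambda>j. GL_act g (b j)) ` J)"
  proof (rule image_subsetI)
    fix f assume f: "f \<in> W"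
    have "f = (\<Sum>j\<in>J. mconst (coef f j) * b j)"
      by (rule pivot_expansion[OF sub finJ]) (rule f b pivot_set_zero[OF J(2)] | assumption)+
    then have "GL_act g f = (\<Sum>j\<in>J. mconst (coef f j) * GL_act g (b j))"
      by (metis (no_types, lifting) GL_act_sum GL_act_mult GL_act_mconst sum.cong)
    moreover have "(\<Sum>j\<in>J. mconst (coef f j) * GL_act g (b j)) \<in> mpoly_vs.span ((\<lambda>j. GL_act g (b j)) ` J)"
      by (intro mpoly_vs.span_sum mpoly_vs.span_scale mpoly_vs.span_base imageI)
    ultimately show "GL_act g f \<in> mpoly_vs.span ((\<lambda>j. GL_act g (b j)) ` J)" by simp
  qed
  then have "mpoly_vs.dim (GL_act g ` W) \<le> card ((\<lambda>j. GL_act g (b j)) ` J)"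
    by (rule mpoly_vs.dim_le_card) (use finJ in simp)
  also have "\<dots> \<le> card J" by (rule card_image_le[OF finJ])
  also have "\<dots> = mpoly_vs.dim W" using pivot_set_dim[OF sub finJ J(2)] by simp
  finally show ?thesis .
qed

lemma degree_part_GL_act: "graded_ideal I \<Longrightarrow> degree_part (GL_act g ` I) d = GL_act g ` degree_part I d"
  by (rule degree_part_image[OF _ hom_component_GL_act])

text \<open>Both \<open>g\<close> and its inverse do not increase the dimension of the space of forms of degree \<open>d\<close>.\<close>

lemma hilbert_GL_act:
  assumes g: "invertible g" and I: "graded_ideal I"
  shows "hilbert (GL_act g ` I) = hilbert I"
proof
  fix d
  obtain h where h: "\<And>f. GL_act h (GL_act g f) = f" using GL_act_inverse[OF g] by metis
  let ?W = "degree_part I d"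
  have sub: "mpoly_vs.subspace ?W" by (rule subspace_degree_part[OF subspace_ideal[OF graded_ideal_ideal[OF I]]])
  have eq: "degree_part (GL_act g ` I) d = GL_act g ` ?W" by (rule degree_part_GL_act[OF I])
  have sub': "mpoly_vs.subspace (GL_act g ` ?W)"
    unfolding eq[symmetric] by (rule subspace_degree_part[OF subspace_ideal[OF ideal_GL_act[OF g graded_ideal_ideal[OF I]]]])
  have keys': "\<forall>f\<in>GL_act g ` ?W. keys f \<subseteq> mons d"
    unfolding eq[symmetric] by (simp add: degree_part_def)
  have "mpoly_vs.dim (GL_act g ` ?W) \<le> mpoly_vs.dim ?W"
    by (rule dim_GL_act_le[OF sub _ finite_mons[of d]]) (simp add: degree_part_def)
  moreover have "mpoly_vs.dim (GL_act h ` GL_act g ` ?W) \<le> mpoly_vs.dim (GL_act g ` ?W)"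
    by (rule dim_GL_act_le[OF sub' keys' finite_mons])
  moreover have "GL_act h ` GL_act g ` ?W = ?W" by (simp add: image_image h)
  ultimately show "hilbert (GL_act g ` I) d = hilbert I d" by (simp add: hilbert_def eq)
qed

section \<open>Principal families\<close>

lemma leading_monomials_principal:
  fixes f :: "('n::finite, 'a::field) mpoly"
  assumes e: "inj e" and f: "is_lead e f m" "keys f \<subseteq> mons d"
  shows "leading_monomials e (Idl\<^bsub>type_ring\<^esub> {f}) = range (\<lambda>u. m + u)"
proof (intro equalityI subsetI)
  fix a assume "a \<in> leading_monomials e (Idl\<^bsub>type_ring\<^esub> {f})"
  then obtain q where q: "is_lead e (q * f) a"
    unfolding mem_leading_monomials genideal_singleton by blast
  have "q \<noteq> 0" using q by (auto simp: is_lead_def)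
  then obtain u where u: "is_lead e q u" using is_lead_exists[OF e] by blast
  have uniq: "a = b" if "is_lead e p a" "is_lead e p b" for p :: "('n, 'a) mpoly" and a b
    using that mless_trans[OF e, of a b a] mless_irrefl[of e a] unfolding is_lead_def by blast
  have "a = u + m" by (rule uniq[OF q is_lead_mult[OF e u f(1)]])
  then show "a \<in> range (\<lambda>u. m + u)" by (simp add: add.commute)
next
  fix a assume "a \<in> range (\<lambda>u. m + u)"
  then obtain u where a: "a = u + m" by (auto simp: add.commute)
  have m: "mdegree m = d"
  proof -
    have "m \<in> keys f" using f(1) by (simp add: is_lead_def in_keys_iff)
    then show ?thesis using f(2) by auto
  qed
  have "single u 1 * f \<in> Idl\<^bsub>type_ring\<^esub> {f}" unfolding genideal_singleton by blast
  moreover have "keys (single u 1 * f) \<subseteq> mons (mdegree a)"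
    using keys_mult_subset_mons[OF keys_single_subset_mons f(2), of u 1] by (simp add: a m)
  moreover have "is_lead e (single u 1 * f) a"
    unfolding a by (rule is_lead_mult[OF e is_lead_single f(1)]) simp
  ultimately show "a \<in> leading_monomials e (Idl\<^bsub>type_ring\<^esub> {f})" unfolding mem_leading_monomials by blast
qed

lemma hilbert_principal:
  fixes f :: "('n::finite, 'a::field) mpoly"
  assumes "f \<noteq> 0" and f: "keys f \<subseteq> mons d"
  shows "hilbert (Idl\<^bsub>type_ring\<^esub> {f}) = (\<lambda>c. card {u :: 'n \<Rightarrow>\<^sub>0 nat. d + mdegree u = c})"
proof
  fix c
  obtain e :: "'n \<Rightarrow> nat" where e: "inj e" using exists_variable_order[of undefined] by metis
  obtain m where m: "is_lead e f m" using is_lead_exists[OF e assms(1)] by (rule exE)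
  have md: "mdegree m = d"
  proof -
    have "m \<in> keys f" using m by (simp add: is_lead_def in_keys_iff)
    then show ?thesis using f by auto
  qed
  have "range (\<lambda>u. m + u) \<inter> mons c = (\<lambda>u. m + u) ` {u. d + mdegree u = c}" by (auto simp: md)
  then have "card (range (\<lambda>u. m + u) \<inter> mons c) = card {u :: 'n \<Rightarrow>\<^sub>0 nat. d + mdegree u = c}"
    by (simp add: card_image inj_on_def)
  then show "hilbert (Idl\<^bsub>type_ring\<^esub> {f}) c = card {u :: 'n \<Rightarrow>\<^sub>0 nat. d + mdegree u = c}"
    using card_leading_monomials[OF e subspace_ideal[OF ideal_genideal[of "{f}"]], of c]
    by (simp add: leading_monomials_principal[OF e m f])
qed

lemma spec_at_principal: "spec_at g ` (Idl\<^bsub>type_ring\<^esub> {F}) = Idl\<^bsub>type_ring\<^esub> {spec_at g F}"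
proof (intro equalityI subsetI)
  fix f assume "f \<in> spec_at g ` (Idl\<^bsub>type_ring\<^esub> {F})"
  then obtain Q where "f = spec_at g (Q * F)" unfolding genideal_singleton by blast
  then show "f \<in> Idl\<^bsub>type_ring\<^esub> {spec_at g F}" unfolding genideal_singleton by (simp add: spec_at_mult)
next
  fix f assume "f \<in> Idl\<^bsub>type_ring\<^esub> {spec_at g F}"
  then obtain q where "f = q * spec_at g F" unfolding genideal_singleton by blast
  then have "f = spec_at g (const_family q * F)" by (simp add: spec_at_mult)
  then show "f \<in> spec_at g ` (Idl\<^bsub>type_ring\<^esub> {F})" unfolding genideal_singleton by blast
qed

lemma tropical_variety_cong:
  assumes "\<And>\<omega> \<omega>'. initial_ideal \<omega> I = initial_ideal \<omega>' I \<longleftrightarrow> initial_ideal \<omega> J = initial_ideal \<omega>' J"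
    and "tropical_set I = tropical_set J"
  shows "tropical_variety I = tropical_variety J"
  unfolding tropical_variety_def groebner_complex_def using assms by simp

lemma (in ideal_family) generic_tropical_variety_of_family:
  assumes "generically V (\<lambda>g. hilbert (member g) = h)"
  shows "\<exists>T. generically V (\<lambda>g. tropical_variety (member g) = T)"
proof -
  obtain B R T where gen: "generically V (\<lambda>g. (\<forall>\<omega> \<omega>'. initial_ideal \<omega> (member g) = initial_ideal \<omega>' (member g) \<longleftrightarrow> R \<omega> \<omega>') \<and>
       tropical_set (member g) = T \<and> tropical_basis (member g) (spec_at g ` B))"
    using generic_tropical_structure[OF assms] by (elim exE conjE)
  obtain g0 where g0: "\<forall>\<omega> \<omega>'. initial_ideal \<omega> (member g0) = initial_ideal \<omega>' (member g0) \<longleftrightarrow> R \<omega> \<omega>'"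
      "tropical_set (member g0) = T"
    using generically_ex[OF gen] by blast
  have "generically V (\<lambda>g. tropical_variety (member g) = tropical_variety (member g0))"
    using gen by (rule generically_mono) (rule tropical_variety_cong, simp_all add: g0)
  then show ?thesis by (rule exI)
qed

lemma generic_principal_tropical_variety:
  fixes V :: "('k::field ^ 'n ^ 'n::finite) set"
  assumes V: "GL_subvariety V" and F: "keys F \<subseteq> mons d" "nonvanishing V (coef F k)"
  shows "\<exists>T. generically V (\<lambda>g. tropical_variety (Idl\<^bsub>type_ring\<^esub> {spec_at g F}) = T)"
proof -
  interpret ideal_family V "Idl\<^bsub>type_ring\<^esub> {F}"
  proof
    have "homogeneous F" using F(1) unfolding homogeneous_def by (intro exI[of _ d]) auto
    then show "graded_ideal (Idl\<^bsub>type_ring\<^esub> {F})" by (intro graded_genideal_homogeneous) simp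
  qed (rule V)
  have "generically V (\<lambda>g. hilbert (member g) = (\<lambda>c. card {u :: 'n \<Rightarrow>\<^sub>0 nat. d + mdegree u = c}))"
  proof (rule generically_mono[OF generically_nonvanishing[OF V F(2)]])
    fix g assume "eval_L g (coef F k) \<noteq> 0"
    then have nz: "spec_at g F \<noteq> 0" by (metis coef_spec_at lookup_zero)
    have "keys (spec_at g F) \<subseteq> keys F"
      by (rule subsetI, rule ccontr) (simp add: in_keys_iff)
    with F(1) have "keys (spec_at g F) \<subseteq> mons d" by blast
    from hilbert_principal[OF nz this]
    show "hilbert (member g) = (\<lambda>c. card {u :: 'n \<Rightarrow>\<^sub>0 nat. d + mdegree u = c})" by (simp only: spec_at_principal)
  qed
  from generic_tropical_variety_of_family[OF this] show ?thesis by (simp only: spec_at_principal)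
qed

section \<open>The function field\<close>

lemma coeff_slice_map_const: "coeff_slice \<nu> (Poly_Mapping.map hahn_const f) = (if \<nu> = 0 then f else 0)"
  by (rule poly_mapping_eqI)
    (auto simp: Poly_Mapping.map.rep_eq when_def hahn_const_def hahn_coeff_monom)

lemma ideal_not_nonvanishing: "ideal {a. \<not> nonvanishing V a} type_ring"
  unfolding ideal_type_ring_iff by (auto simp: nonvanishing_def eval_add eval_mult)

text \<open>The vanishing ideal over \<open>L\<close> is extended from \<open>K\<close>: if \<open>a\<close> vanishes on \<open>V\<close>, then so do the
  coefficients of all powers of \<open>t\<close> in \<open>a\<close>. They lie in a finite-dimensional space, and expanding them in a basis
  adapted to a pivot set expresses \<open>a\<close> by elements of \<open>\<pp>\<close>.\<close>

lemma vanishing_ideal_L_eq: "vanishing_ideal_L V = {a. \<not> nonvanishing V a}"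
proof (rule equalityI)
  have "Poly_Mapping.map hahn_const f \<in> {a. \<not> nonvanishing V a}" if "f \<in> vanishing_ideal V" for f
  proof -
    have "eval_L g (Poly_Mapping.map hahn_const f) = 0" if "g \<in> V" for g
      by (rule hahn_eqI) (use \<open>f \<in> vanishing_ideal V\<close> that in \<open>simp add: hahn_coeff_eval coeff_slice_map_const vanishing_ideal_def\<close>)
    then show ?thesis by (simp add: nonvanishing_def)
  qed
  then show "vanishing_ideal_L V \<subseteq> {a. \<not> nonvanishing V a}"
    unfolding vanishing_ideal_L_def by (intro genideal_least ideal_not_nonvanishing image_subsetI)
  show "{a. \<not> nonvanishing V a} \<subseteq> vanishing_ideal_L V"
  proof (rule subsetI, unfold mem_Collect_eq)
    fix a assume a: "\<not> nonvanishing V a"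
    define P where "P = {f \<in> vanishing_ideal V. \<forall>m. m \<notin> keys a \<longrightarrow> coef f m = 0}"
    have sub: "mpoly_vs.subspace P"
      by (auto simp: mpoly_vs.subspace_def P_def vanishing_ideal_def eval_add eval_mult lookup_add)
    have slice: "coeff_slice \<nu> a \<in> P" for \<nu>
    proof -
      have "mat_eval id g (coeff_slice \<nu> a) = 0" if "g \<in> V" for g
        using eval_not_nonvanishing[OF a that] by (simp add: hahn_coeff_eval[symmetric])
      then show ?thesis by (simp add: P_def vanishing_ideal_def in_keys_iff)
    qed
    have "\<forall>f\<in>P. (\<forall>j\<in>keys a. coef f j = 0) \<longrightarrow> f = 0"
    proof (intro ballI impI poly_mapping_eqI)
      fix f m assume "f \<in> P" "\<forall>j\<in>keys a. coef f j = 0"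
      then show "coef f m = coef 0 m" by (cases "m \<in> keys a") (simp_all add: P_def)
    qed
    from pivot_subset_exists[OF sub finite_keys this] obtain J where
      J: "J \<subseteq> keys a" "pivot_set P J" by blast
    have finJ: "finite J" using J(1) finite_keys by (rule finite_subset)
    obtain b where b: "\<And>j. j \<in> J \<Longrightarrow> b j \<in> P" "\<And>j i. j \<in> J \<Longrightarrow> i \<in> J \<Longrightarrow> coef (b j) i = (if i = j then 1 else 0)"
      using pivot_set_basis[OF J(2)] by metis
    have exp: "coeff_slice \<nu> a = (\<Sum>j\<in>J. mconst (coef (coeff_slice \<nu> a) j) * b j)" for \<nu>
      by (rule pivot_expansion[OF sub finJ]) (rule slice b pivot_set_zero[OF J(2)] | assumption)+
    have a_eq: "a = (\<Sum>j\<in>J. mconst (coef a j) * Poly_Mapping.map hahn_const (b j))"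
    proof (intro poly_mapping_eqI hahn_eqI)
      fix m \<nu>
      have map: "coef (Poly_Mapping.map hahn_const (b j)) m = hahn_const (coef (b j) m)" for j
        by (simp add: Poly_Mapping.map.rep_eq when_def)
      have "hahn_coeff (coef a j * hahn_const (coef (b j) m)) \<nu> = hahn_coeff (coef a j) \<nu> * coef (b j) m" for j
        using hahn_coeff_monom_mult[of "coef (b j) m" 0 "coef a j" \<nu>] by (simp add: hahn_const_def mult.commute)
      moreover have "hahn_coeff (coef a m) \<nu> = (\<Sum>j\<in>J. hahn_coeff (coef a j) \<nu> * coef (b j) m)"
        using arg_cong[OF exp[of \<nu>], of "\<lambda>f. coef f m"] by (simp add: lookup_sum)
      ultimately show "hahn_coeff (coef a m) \<nu> =
          hahn_coeff (coef (\<Sum>j\<in>J. mconst (coef a j) * Poly_Mapping.map hahn_const (b j)) m) \<nu>"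
        by (simp add: lookup_sum hahn_coeff_sum map)
    qed
    have "(\<Sum>j\<in>A. mconst (coef a j) * Poly_Mapping.map hahn_const (b j)) \<in> vanishing_ideal_L V" if "A \<subseteq> J" for A
    proof -
      note I = ideal_type_ringD[OF ideal_genideal[of "Poly_Mapping.map hahn_const ` vanishing_ideal V"],
          folded vanishing_ideal_L_def]
      have "Poly_Mapping.map hahn_const (b j) \<in> vanishing_ideal_L V" if "j \<in> J" for j
        unfolding vanishing_ideal_L_def using b(1)[OF that]
        by (intro subsetD[OF subset_genideal imageI]) (simp add: P_def)
      then show ?thesis using that
        by (induction A rule: infinite_finite_induct) (simp_all add: I)
    qed
    from this[OF order_refl] show "a \<in> vanishing_ideal_L V" by (simp only: a_eq[symmetric])
  qed
qed

text \<open>A product that vanishes on the irreducible set \<open>V\<close> has a factor that vanishes on \<open>V\<close>.\<close>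

lemma domain_coord_ring:
  fixes V :: "('k::field ^ 'n ^ 'n::finite) set"
  assumes V: "GL_subvariety V"
  shows "domain (coord_ring V)"
proof -
  have "primeideal (vanishing_ideal_L V) type_ring"
  proof (rule primeidealI)
    show "ideal (vanishing_ideal_L V) type_ring"
      unfolding vanishing_ideal_L_eq by (rule ideal_not_nonvanishing)
    show "cring (type_ring :: ('n \<times> 'n, 'k hahn) mpoly ring)" by (rule cring_type_ring)
    have "V \<noteq> {}" using V by (simp add: GL_subvariety_def)
    then have "1 \<notin> vanishing_ideal_L V" by (auto simp: vanishing_ideal_L_eq nonvanishing_def)
    then show "carrier type_ring \<noteq> vanishing_ideal_L V" by auto
    show "a \<in> vanishing_ideal_L V \<or> b \<in> vanishing_ideal_L V"
      if "a \<otimes>\<^bsub>type_ring\<^esub> b \<in> vanishing_ideal_L V" for a b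
      using that nonvanishing_mult[OF V, of a b] by (auto simp: vanishing_ideal_L_eq)
  qed
  then show ?thesis unfolding coord_ring_def by (rule primeideal.quotient_is_domain)
qed

lemma ideal_vanishing_ideal_L: "ideal (vanishing_ideal_L V) type_ring"
  unfolding vanishing_ideal_L_eq by (rule ideal_not_nonvanishing)

lemma coord_class_hom: "coord_class V \<in> ring_hom type_ring (coord_ring V)"
  using ideal.rcos_ring_hom[OF ideal_vanishing_ideal_L[of V]]
  unfolding coord_class_def[abs_def] coord_ring_def .

lemma coord_class_eq_iff:
  fixes V :: "('k::field ^ 'n ^ 'n::finite) set"
  assumes V: "GL_subvariety V"
  shows "coord_class V a = coord_class V b \<longleftrightarrow> \<not> nonvanishing V (a - b)"
proof -
  interpret I: ideal "vanishing_ideal_L V" "type_ring :: ('n \<times> 'n, 'k hahn) mpoly ring"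
    by (rule ideal_vanishing_ideal_L)
  have "\<ominus>\<^bsub>type_ring\<^esub> x = - x" for x :: "('n \<times> 'n, 'k hahn) mpoly"
    by (rule I.minus_equality) simp_all
  then have "a \<ominus>\<^bsub>type_ring\<^esub> b = a - b" by (simp add: a_minus_def)
  then show ?thesis
    using I.quotient_eq_iff_same_a_r_cos[OF ideal_vanishing_ideal_L, of a b]
    by (simp add: coord_class_def vanishing_ideal_L_eq)
qed

lemma (in domain) fraction_self: "a \<in> carrier R \<Longrightarrow> b \<in> carrier R \<Longrightarrow> b \<noteq> \<zero> \<Longrightarrow> (a, b) \<in> fraction R a b"
  by (auto simp: fraction_def frac_rel_def)

lemma (in domain) fraction_memD:
  "(x, y) \<in> fraction R a b \<Longrightarrow> x \<in> carrier R \<and> y \<in> carrier R \<and> y \<noteq> \<zero> \<and> a \<otimes> y = x \<otimes> b"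
  by (auto simp: fraction_def frac_rel_def)

lemma (in domain) frac_rel_trans: "trans (frac_rel R)"
proof (rule transI)
  fix p q s assume "(p, q) \<in> frac_rel R" "(q, s) \<in> frac_rel R"
  then obtain a b c d e f where *: "p = (a, b)" "q = (c, d)" "s = (e, f)"
    "a \<in> carrier R" "c \<in> carrier R" "e \<in> carrier R" "b \<in> carrier R - {\<zero>}" "d \<in> carrier R - {\<zero>}" "f \<in> carrier R - {\<zero>}"
    "a \<otimes> d = c \<otimes> b" "c \<otimes> f = e \<otimes> d" by (auto simp: frac_rel_def)
  have "d \<otimes> (a \<otimes> f) = (a \<otimes> d) \<otimes> f" using *(4-9) by (simp add: m_ac)
  also have "\<dots> = (c \<otimes> f) \<otimes> b" unfolding *(10) using *(4-9) by (simp add: m_ac)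
  also have "\<dots> = d \<otimes> (e \<otimes> b)" unfolding *(11) using *(4-9) by (simp add: m_ac)
  finally have "a \<otimes> f = e \<otimes> b" using * by (subst (asm) m_lcancel) auto
  then show "(p, s) \<in> frac_rel R" using * by (auto simp: frac_rel_def)
qed

lemma (in domain) fraction_eqI:
  assumes "a \<in> carrier R" "b \<in> carrier R" "b \<noteq> \<zero>" "c \<in> carrier R" "d \<in> carrier R" "d \<noteq> \<zero>" "a \<otimes> d = c \<otimes> b"
  shows "fraction R a b = fraction R c d"
proof -
  have *: "fraction R x y \<subseteq> fraction R z w" if "((z, w), (x, y)) \<in> frac_rel R" for x y z w
    using transD[OF frac_rel_trans that] by (auto simp: fraction_def)
  have "((a, b), (c, d)) \<in> frac_rel R" "((c, d), (a, b)) \<in> frac_rel R"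
    using assms by (auto simp: frac_rel_def)
  then show ?thesis using * by blast
qed

lemma (in domain) fraction_hom: "(\<lambda>a. fraction R a \<one>) \<in> ring_hom R (frac_field R)"
proof (rule ring_hom_memI)
  show "fraction R a \<one> \<in> carrier (frac_field R)" if "a \<in> carrier R" for a
    using that by (auto simp: frac_field_def fraction_def intro: quotientI)
  show "fraction R \<one> \<one> = \<one>\<^bsub>frac_field R\<^esub>" by (simp add: frac_field_def)
  fix a c assume ac: "a \<in> carrier R" "c \<in> carrier R"
  have self: "(a, \<one>) \<in> fraction R a \<one>" "(c, \<one>) \<in> fraction R c \<one>" using ac by (auto intro: fraction_self)
  have rep: "x \<in> carrier R \<and> y \<in> carrier R \<and> y \<noteq> \<zero> \<and> x = e \<otimes> y" if "(x, y) \<in> fraction R e \<one>" "e \<in> carrier R" for x y e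
    using fraction_memD[OF that(1)] that(2) by simp
  have "(\<Union>(x, y)\<in>fraction R a \<one>. \<Union>(z, w)\<in>fraction R c \<one>. fraction R (x \<otimes> z) (y \<otimes> w)) = fraction R (a \<otimes> c) \<one>"
  proof (rule UN_pairs_const[OF self])
    fix x y z w assume "(x, y) \<in> fraction R a \<one>" "(z, w) \<in> fraction R c \<one>"
    then have *: "x \<in> carrier R" "y \<in> carrier R" "y \<noteq> \<zero>" "x = a \<otimes> y" "z \<in> carrier R" "w \<in> carrier R" "w \<noteq> \<zero>" "z = c \<otimes> w"
      using rep ac by blast+
    have "(x \<otimes> z) \<otimes> \<one> = (a \<otimes> c) \<otimes> (y \<otimes> w)" unfolding *(4,8) using *(2,6) ac by (simp add: m_ac)
    then show "fraction R (x \<otimes> z) (y \<otimes> w) = fraction R (a \<otimes> c) \<one>"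
      by (intro fraction_eqI) (use * ac integral in auto)
  qed
  then show "fraction R (a \<otimes> c) \<one> = fraction R a \<one> \<otimes>\<^bsub>frac_field R\<^esub> fraction R c \<one>"
    by (simp only: frac_field_def monoid.select_convs ring.select_convs)
  have "(\<Union>(x, y)\<in>fraction R a \<one>. \<Union>(z, w)\<in>fraction R c \<one>. fraction R (x \<otimes> w \<oplus> z \<otimes> y) (y \<otimes> w)) = fraction R (a \<oplus> c) \<one>"
  proof (rule UN_pairs_const[OF self])
    fix x y z w assume "(x, y) \<in> fraction R a \<one>" "(z, w) \<in> fraction R c \<one>"
    then have *: "x \<in> carrier R" "y \<in> carrier R" "y \<noteq> \<zero>" "x = a \<otimes> y" "z \<in> carrier R" "w \<in> carrier R" "w \<noteq> \<zero>" "z = c \<otimes> w"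
      using rep ac by blast+
    have "(x \<otimes> w \<oplus> z \<otimes> y) \<otimes> \<one> = (a \<oplus> c) \<otimes> (y \<otimes> w)" unfolding *(4,8) using *(2,6) ac
      by (simp add: l_distr m_assoc m_comm[of w y])
    then show "fraction R (x \<otimes> w \<oplus> z \<otimes> y) (y \<otimes> w) = fraction R (a \<oplus> c) \<one>"
      by (intro fraction_eqI) (use * ac integral in auto)
  qed
  then show "fraction R (a \<oplus> c) \<one> = fraction R a \<one> \<oplus>\<^bsub>frac_field R\<^esub> fraction R c \<one>"
    by (simp only: frac_field_def monoid.select_convs ring.select_convs)
qed

lemma rational_fun_hom:
  fixes V :: "('k::field ^ 'n ^ 'n::finite) set"
  assumes V: "GL_subvariety V"
  shows "(\<lambda>a. rational_fun V a 1) \<in> ring_hom type_ring (function_field V)"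
proof -
  interpret R: domain "coord_ring V" by (rule domain_coord_ring[OF V])
  have "coord_class V 1 = \<one>\<^bsub>coord_ring V\<^esub>" using ring_hom_one[OF coord_class_hom[of V]] by simp
  then have "(\<lambda>a. rational_fun V a 1) = (\<lambda>a. fraction (coord_ring V) a \<one>\<^bsub>coord_ring V\<^esub>) \<circ> coord_class V"
    by (simp add: rational_fun_def fun_eq_iff)
  then show ?thesis
    using ring_hom_trans[OF coord_class_hom R.fraction_hom] by (simp only: function_field_def)
qed

lemma field_function_field: "GL_subvariety V \<Longrightarrow> field (function_field V)"
  unfolding function_field_def by (rule domain.frac_field_field[OF domain_coord_ring])

text \<open>The image in \<open>S\<^sub>L\<^sub>(\<^sub>V\<^sub>)\<close> of a polynomial with coefficients in \<open>L[Y]\<close>.\<close>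

definition class_poly :: "('k::field ^ 'n ^ 'n) set \<Rightarrow> ('n::finite, ('n \<times> 'n, 'k hahn) mpoly) mpoly \<Rightarrow>
    (('n \<Rightarrow>\<^sub>0 nat) \<Rightarrow> ('n, 'k) function_field_elem)" where
  "class_poly V F = (\<lambda>m. rational_fun V (coef F m) 1)"

lemma generic_map_eq: "generic_map V f = class_poly V (generic_image f)"
  by (simp add: generic_map_def class_poly_def generic_image_def)

lemma coef_mult_decomp:
  fixes F G :: "('n::finite, 'a::comm_ring_1) mpoly"
  shows "coef (F * G) m = (\<Sum>p\<in>{p. fst p + snd p = m}. coef F (fst p) * coef G (snd p))"
proof -
  let ?K = "keys F \<times> keys G"
  have "coef (F * G) m = (\<Sum>a\<in>keys F. \<Sum>b\<in>keys G. if a + b = m then coef F a * coef G b else 0)"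
    by (subst mult_eq_sum_single) (simp add: lookup_sum lookup_single when_def)
  also have "\<dots> = (\<Sum>p\<in>?K. if fst p + snd p = m then coef F (fst p) * coef G (snd p) else 0)"
    by (simp add: sum.cartesian_product split_def)
  also have "\<dots> = (\<Sum>p\<in>?K \<inter> {p. fst p + snd p = m}. coef F (fst p) * coef G (snd p))"
    by (simp add: sum.inter_restrict)
  also have "\<dots> = (\<Sum>p\<in>{p. fst p + snd p = m}. coef F (fst p) * coef G (snd p))"
    by (rule sum.mono_neutral_left) (auto simp: in_keys_iff)
  finally show ?thesis .
qed

lemma class_poly_hom:
  fixes V :: "('k::field ^ 'n ^ 'n::finite) set"
  assumes V: "GL_subvariety V"
  shows "class_poly V \<in> ring_hom type_ring (mpoly_ring (function_field V))"
proof -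
  let ?\<phi> = "\<lambda>a. rational_fun V a 1" and ?Q = "function_field V"
  interpret Q: field ?Q by (rule field_function_field[OF V])
  note hom = rational_fun_hom[OF V]
  have carr: "?\<phi> a \<in> carrier ?Q" for a using ring_hom_closed[OF hom, of a] by simp
  have add: "?\<phi> (a + b) = ?\<phi> a \<oplus>\<^bsub>?Q\<^esub> ?\<phi> b" for a b using ring_hom_add[OF hom, of a b] by simp
  have mult: "?\<phi> (a * b) = ?\<phi> a \<otimes>\<^bsub>?Q\<^esub> ?\<phi> b" for a b using ring_hom_mult[OF hom, of a b] by simp
  have one: "?\<phi> 1 = \<one>\<^bsub>?Q\<^esub>" using ring_hom_one[OF hom] by simp
  have zero: "?\<phi> 0 = \<zero>\<^bsub>?Q\<^esub>" using add[of 0 0] carr[of 0] Q.add.l_cancel_one[of "?\<phi> 0" "?\<phi> 0"] by simp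
  have sum: "?\<phi> (sum f A) = finsum ?Q (\<lambda>x. ?\<phi> (f x)) A" if "finite A"
    for A and f :: "('n \<Rightarrow>\<^sub>0 nat) \<times> ('n \<Rightarrow>\<^sub>0 nat) \<Rightarrow> ('n \<times> 'n, 'k hahn) mpoly"
    using that by (induction A rule: finite_induct) (simp_all add: zero add carr Q.finsum_insert)
  show ?thesis
  proof (rule ring_hom_memI)
    fix F :: "('n, ('n \<times> 'n, 'k hahn) mpoly) mpoly"
    have "{m. ?\<phi> (coef F m) \<noteq> \<zero>\<^bsub>?Q\<^esub>} \<subseteq> keys F"
      by (rule subsetI, rule ccontr) (simp add: in_keys_iff zero)
    then have "finite {m. ?\<phi> (coef F m) \<noteq> \<zero>\<^bsub>?Q\<^esub>}" by (rule finite_subset) simp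
    then show "class_poly V F \<in> carrier (mpoly_ring ?Q)" by (simp add: mpoly_ring_def class_poly_def carr)
    fix G :: "('n, ('n \<times> 'n, 'k hahn) mpoly) mpoly"
    show "class_poly V (F \<oplus>\<^bsub>type_ring\<^esub> G) = class_poly V F \<oplus>\<^bsub>mpoly_ring ?Q\<^esub> class_poly V G"
      by (simp add: mpoly_ring_def class_poly_def lookup_add add)
    show "class_poly V (F \<otimes>\<^bsub>type_ring\<^esub> G) = class_poly V F \<otimes>\<^bsub>mpoly_ring ?Q\<^esub> class_poly V G"
      by (simp add: mpoly_ring_def class_poly_def coef_mult_decomp sum mult)
  next
    show "class_poly V \<one>\<^bsub>type_ring\<^esub> = \<one>\<^bsub>mpoly_ring ?Q\<^esub>"
      by (auto simp: mpoly_ring_def class_poly_def lookup_one when_def one zero fun_eq_iff)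
  qed
qed

text \<open>The polynomials over \<open>L[Y]\<close> whose image lies in \<open>y(I)\<close> form an ideal that contains the generators.\<close>

lemma class_poly_in_generic_ideal:
  fixes V :: "('k::field ^ 'n ^ 'n::finite) set"
  assumes V: "GL_subvariety V" and F: "F \<in> generic_family I"
  shows "class_poly V F \<in> generic_ideal V I"
proof -
  let ?P = "mpoly_ring (function_field V) :: (('n \<Rightarrow>\<^sub>0 nat) \<Rightarrow> ('n, 'k) function_field_elem) ring"
  note hom = class_poly_hom[OF V]
  interpret P: cring ?P by (rule cring.mpoly_ring_cring) (rule domain.axioms(1)[OF field.axioms(1)[OF field_function_field[OF V]]])
  have "generic_map V ` I \<subseteq> carrier ?P"
    using ring_hom_closed[OF hom] by (auto simp: generic_map_eq)
  then interpret J: ideal "generic_ideal V I" ?P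
    unfolding generic_ideal_def by (rule P.genideal_ideal)
  have zero: "class_poly V 0 = \<zero>\<^bsub>?P\<^esub>"
    using ring_hom_zero[OF hom cring.axioms(1)[OF cring_type_ring] P.ring_axioms] by simp
  have "ideal {F. class_poly V F \<in> generic_ideal V I} type_ring"
    unfolding ideal_type_ring_iff mem_Collect_eq
  proof (intro conjI ballI allI; (unfold mem_Collect_eq)?)
    show "class_poly V 0 \<in> generic_ideal V I"
      unfolding zero by (rule additive_subgroup.zero_closed[OF J.is_additive_subgroup])
    show "class_poly V (F + G) \<in> generic_ideal V I"
      if "class_poly V F \<in> generic_ideal V I" "class_poly V G \<in> generic_ideal V I" for F G
      using additive_subgroup.a_closed[OF J.is_additive_subgroup that] ring_hom_add[OF hom, of F G] by simp
    show "class_poly V (Q * F) \<in> generic_ideal V I" if "class_poly V F \<in> generic_ideal V I" for F Q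
      using J.I_l_closed[OF that, of "class_poly V Q"] ring_hom_closed[OF hom, of Q] ring_hom_mult[OF hom, of Q F] by simp
  qed
  moreover have "generic_image ` I \<subseteq> {F. class_poly V F \<in> generic_ideal V I}"
  proof (rule image_subsetI, unfold mem_Collect_eq)
    fix f assume "f \<in> I"
    then have "generic_map V f \<in> generic_ideal V I"
      unfolding generic_ideal_def
      using P.genideal_self[OF \<open>generic_map V ` I \<subseteq> carrier ?P\<close>] by blast
    then show "class_poly V (generic_image f) \<in> generic_ideal V I" by (simp only: generic_map_eq)
  qed
  ultimately have "generic_family I \<subseteq> {F. class_poly V F \<in> generic_ideal V I}"
    unfolding generic_family_def by (rule genideal_least)
  then show ?thesis using F by blast
qed

lemma rational_value_iff:
  fixes V :: "('k::field ^ 'n ^ 'n::finite) set"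
  assumes V: "GL_subvariety V" and g: "g \<in> V"
  shows "rational_value V g (rational_fun V a 1) v \<longleftrightarrow> v = eval_L g a"
proof
  assume "v = eval_L g a"
  then show "rational_value V g (rational_fun V a 1) v"
    unfolding rational_value_def by (intro exI[of _ a] exI[of _ 1]) simp
next
  interpret R: domain "coord_ring V" by (rule domain_coord_ring[OF V])
  let ?c = "coord_class V"
  assume "rational_value V g (rational_fun V a 1) v"
  then obtain a' b where ab: "rational_fun V a 1 = rational_fun V a' b" "eval_L g b \<noteq> 0" "v = eval_L g a' / eval_L g b"
    unfolding rational_value_def by blast
  have carr: "?c x \<in> carrier (coord_ring V)" for x using ring_hom_closed[OF coord_class_hom, of x V] by simp
  have zero: "?c 0 = \<zero>\<^bsub>coord_ring V\<^esub>"
    using ring_hom_zero[OF coord_class_hom cring.axioms(1)[OF cring_type_ring] R.ring_axioms] by simp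
  have "nonvanishing V (b - 0)" using ab(2) g by (auto simp: nonvanishing_def)
  then have "?c b \<noteq> \<zero>\<^bsub>coord_ring V\<^esub>" using coord_class_eq_iff[OF V, of b 0] zero by simp
  then have "(?c a', ?c b) \<in> fraction (coord_ring V) (?c a) (?c 1)"
    using R.fraction_self[OF carr carr, of b a'] ab(1) by (simp add: rational_fun_def)
  then have "?c a \<otimes>\<^bsub>coord_ring V\<^esub> ?c b = ?c a' \<otimes>\<^bsub>coord_ring V\<^esub> ?c 1" using R.fraction_memD by blast
  then have "?c (a * b) = ?c (a' * 1)"
    using ring_hom_mult[OF coord_class_hom, of a b V] ring_hom_mult[OF coord_class_hom, of a' 1 V] by simp
  then have "eval_L g (a * b - a' * 1) = 0" using coord_class_eq_iff[OF V] eval_not_nonvanishing g by blast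
  then have "eval_L g a * eval_L g b = eval_L g a'" by (simp add: eval_diff eval_mult)
  then show "v = eval_L g a" using ab(2) unfolding ab(3) by (metis nonzero_mult_div_cancel_right)
qed

lemma specialize_class_poly:
  assumes "GL_subvariety V" "g \<in> V"
  shows "defined_at V g (class_poly V F)" "specialize V g (class_poly V F) = spec_at g F"
proof -
  note * = rational_value_iff[OF assms]
  show "defined_at V g (class_poly V F)" by (simp add: defined_at_def class_poly_def *)
  have "specialize V g (class_poly V F) = Abs_poly_mapping (\<lambda>m. coef (spec_at g F) m)"
    by (simp add: specialize_def class_poly_def *)
  then show "specialize V g (class_poly V F) = spec_at g F" by (simp only: lookup_inverse)
qed

theorem theorem8p7:
  fixes I :: "('n::finite, 'k::alg_closed_field hahn) mpoly set"
    and V :: "('k ^ 'n ^ 'n) set"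
  assumes "graded_ideal I"
    and "GL_subvariety V"
  shows "(\<exists>T. is_generic_tropical_variety V I T) \<and>
    (\<forall>T. is_generic_tropical_variety V I T \<and> T \<noteq> {} \<longrightarrow> (\<exists>\<F>. generic_tropical_basis V I \<F>))"
proof -
  note I = assms(1) and V = assms(2)
  interpret ideal_family V "generic_family I" by standard (rule V, rule graded_generic_family[OF I])
  have inv: "invertible g" if "g \<in> V" for g
    using GL_subvariety_subset[OF V] that unfolding topspace_GL_zariski by blast
  have member: "member g = GL_act g ` I" if "g \<in> V" for g
    by (rule spec_at_generic_family[OF inv[OF that] graded_ideal_ideal[OF I]])
  have h: "generically V (\<lambda>g. hilbert (member g) = hilbert I)"
    by (rule generically_all[OF V]) (simp add: member hilbert_GL_act[OF inv I])
  from generic_tropical_variety_of_family[OF h] obtain T where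
    "generically V (\<lambda>g. tropical_variety (member g) = T)" by (rule exE)
  then have "generically V (\<lambda>g. tropical_variety (GL_act g ` I) = T)"
    by (rule generically_mono) (simp add: member)
  then have T: "\<exists>T. is_generic_tropical_variety V I T"
    unfolding is_generic_tropical_variety_def generically_def by (rule exI)
  obtain B R S where B: "finite B" "B \<subseteq> generic_family I" "\<forall>F\<in>B. \<exists>d. keys F \<subseteq> mons d"
      "\<forall>F\<in>B. \<exists>k. nonvanishing V (coef F k)"
    and gen: "generically V (\<lambda>g. (\<forall>\<omega> \<omega>'. initial_ideal \<omega> (member g) = initial_ideal \<omega>' (member g) \<longleftrightarrow> R \<omega> \<omega>') \<and>
      tropical_set (member g) = S \<and> tropical_basis (member g) (spec_at g ` B))"
    using generic_tropical_structure[OF h] by (elim exE conjE)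
  have "\<forall>F\<in>B. \<exists>X. generically V (\<lambda>g. tropical_variety (Idl\<^bsub>type_ring\<^esub> {spec_at g F}) = X)"
  proof
    fix F assume "F \<in> B"
    with B(3,4) obtain d k where "keys F \<subseteq> mons d" "nonvanishing V (coef F k)" by blast
    then show "\<exists>X. generically V (\<lambda>g. tropical_variety (Idl\<^bsub>type_ring\<^esub> {spec_at g F}) = X)"
      by (rule generic_principal_tropical_variety[OF V])
  qed
  from bchoice[OF this] obtain X where
    X: "\<forall>F\<in>B. generically V (\<lambda>g. tropical_variety (Idl\<^bsub>type_ring\<^esub> {spec_at g F}) = X F)" by (rule exE)
  have "generically V (\<lambda>g. tropical_basis (member g) (spec_at g ` B) \<and>
      (\<forall>F\<in>B. tropical_variety (Idl\<^bsub>type_ring\<^esub> {spec_at g F}) = X F))"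
    by (rule generically_conj[OF V generically_mono[OF gen] generically_ball[OF V B(1)]]) (use X in simp_all)
  then obtain U where U: "openin (subtopology GL_zariski V) U" "U \<noteq> {}"
      "\<forall>g\<in>U. tropical_basis (member g) (spec_at g ` B) \<and>
        (\<forall>F\<in>B. tropical_variety (Idl\<^bsub>type_ring\<^esub> {spec_at g F}) = X F)"
    unfolding generically_def by (elim exE conjE)
  have UV: "g \<in> V" if "g \<in> U" for g using openin_imp_subset[OF U(1)] that by blast
  have "generic_tropical_basis V I (class_poly V ` B)"
    unfolding generic_tropical_basis_def
  proof (intro conjI exI[of _ U] ballI)
    show "finite (class_poly V ` B)" using B(1) by simp
    show "class_poly V ` B \<subseteq> generic_ideal V I"
      using B(2) by (intro image_subsetI class_poly_in_generic_ideal[OF V]) (rule subsetD)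
    show "defined_at V g F" if "g \<in> U" "F \<in> class_poly V ` B" for g F
      using that(2) specialize_class_poly(1)[OF V UV[OF that(1)]] by blast
    show "tropical_basis (GL_act g ` I) (specialize V g ` class_poly V ` B)" if "g \<in> U" for g
      using bspec[OF U(3) that] by (simp add: image_image specialize_class_poly(2)[OF V UV[OF that]] member[OF UV[OF that]])
    fix F g g' assume F: "F \<in> class_poly V ` B" and g: "g \<in> U" "g' \<in> U"
    obtain F' where F': "F' \<in> B" "F = class_poly V F'" using F by blast
    show "tropical_variety (Idl\<^bsub>type_ring\<^esub> {specialize V g F}) = tropical_variety (Idl\<^bsub>type_ring\<^esub> {specialize V g' F})"
      using bspec[OF U(3) g(1)] bspec[OF U(3) g(2)] F'(1)
      by (simp add: F'(2) specialize_class_poly(2)[OF V UV[OF g(1)]] specialize_class_poly(2)[OF V UV[OF g(2)]])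
  qed (rule U)+
  then show ?thesis using T by blast
qed

end
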